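(* Let $a<b$, $K\ge2$, $\mathcal{I}=\{1,\dots,K\}$, $\mathscr{D}\subseteq D_{cdf}([a,b])$ nonempty and convex, $\mathsf{T}:D_{cdf}([a,b])\to\mathbb{R}$ with $|\mathsf{T}(F)-\mathsf{T}(G)|\le C\|F-G\|_\infty$ for all $F\in\mathscr{D}$, $G\in D_{cdf}([a,b])$ and some $C>0$, and assume for every $m\in\mathbb{N}$, $\delta\in\mathscr{S}_m$ the map $x\mapsto\mathsf{T}(\sum_{j=1}^m\delta_j\mathbf{1}\{x_j\le\cdot\})$ on $[a,b]^m$ is Borel measurable. Let $\mathscr{M}_K\subseteq\mathscr{S}_K$ be closed with at least two elements. Then for every $n\ge2K$, the sequential elimination policy $\check\pi$ (with any nonempty finite discretization $\mathscr{M}_K^n\subseteq\mathscr{M}_K$, any admissible set of elimination rounds $\mathcal{R}$, and any $\eta>0$) satisfies $$\sup_{F^1,\dots,F^K\in\mathscr{D}}\mathbb{E}[r_n(\check\pi,\mathscr{M}_K)]\le\varepsilon(n)+4C\sqrt{K/n}\,D_{n,K}+4C\frac{K^{1-\frac{3\eta}{4+2\eta}}}{\sqrt n}(1+18.5\eta^{-1})^2,$$ with $D_{n,K}=\sqrt{K\log(17K)}\wedge\sqrt{\log(3.01\,K(n+2))}$, the supremum over i.i.d. potential outcome distributions with marginal cdfs in $\mathscr{D}$.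
   Context: $D_{cdf}([a,b])$: cdfs with $F(a-)=0$, $F(b)=1$; $\mathscr{S}_K$ the unit simplex; $\langle\delta,\mathbf{F}\rangle=\sum_i\delta_iF^i$. Potential outcomes $Y_t=(Y_{1,t},\dots,Y_{K,t})$ i.i.d. over $t$, $Y_{i,t}\sim F^i$. $\hat F_{i,t,n}$ is the empirical cdf of outcomes of subjects among $1,\dots,t$ assigned to treatment $i$, $\hat{\mathbf{F}}_{t,n}=(\hat F_{1,t,n},\dots,\hat F_{K,t,n})$. $u_\eta(r,n)=C\sqrt{\frac{1+\eta}{r}[0.5\log n+\log(rK)]}$. Admissible elimination rounds: $\mathcal{R}\subseteq\{1,\dots,\lfloor n/2\rfloor\}$ with $\min\mathcal{R}\le\lfloor n/K\rfloor$. Policy $\check\pi$: $t=0$, $r=0$, $\mathcal{I}_0=\mathcal{I}$, $\mathscr{M}^n_{K,0}=\mathscr{M}^n_K$. While $n-t\ge|\mathcal{I}_r|$: assign the next subjects once to each $i\in\mathcal{I}_r$; $r\leftarrow r+1$; $\mathcal{I}_r=\mathcal{I}_{r-1}$; if $r\in\mathcal{R}$ and $|\mathcal{I}_r|\ge2$: $h=\max\{\mathsf{T}(\langle\delta,\hat{\mathbf{F}}_{t,n}\rangle):\delta\in\mathscr{M}^n_{K,r-1}\}$, $\mathscr{M}^n_{K,r}=\{\gamma\in\mathscr{M}^n_{K,r-1}:h-\mathsf{T}(\langle\gamma,\hat{\mathbf{F}}_{t,n}\rangle)\le 2u_\eta(r,n)\}$, $\mathcal{I}_r=\{i\in\mathcal{I}_r:\exists\gamma\in\mathscr{M}^n_{K,r},\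 \gamma_i>0\}$; otherwise $\mathscr{M}^n_{K,r}=\mathscr{M}^n_{K,r-1}$. After the loop, if $t<n$, assign the remaining $n-t$ subjects to the $n-t$ smallest elements of $\mathcal{I}_r$, one each. Recommend the lexicographic minimum of $\arg\max\{\mathsf{T}(\langle\delta,\hat{\mathbf{F}}_{n,n}\rangle):\delta\in\mathscr{M}^n_{K,r}\}$. Regret $r_n(\pi,\mathscr{M}_K)=\max_{\delta\in\mathscr{M}_K}\mathsf{T}(\langle\delta,\mathbf{F}\rangle)-\mathsf{T}(\langle\text{recommendation},\mathbf{F}\rangle)$; $\varepsilon(n)=\sup_{\mathbf{F}\in\mathscr{D}^K}|\max_{\mathscr{M}_K}\mathsf{T}(\langle\delta,\mathbf{F}\rangle)-\max_{\mathscr{M}^n_K}\mathsf{T}(\langle\delta,\mathbf{F}\rangle)|$. *)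

theory Defs
  imports "HOL-Probability.Probability"
begin

definition cdf_ab :: "real \<Rightarrow> real \<Rightarrow> (real \<Rightarrow> real) set" where
  "cdf_ab a b = {F. mono F \<and> (\<forall>x. continuous (at_right x) F)
       \<and> (\<forall>x<a. F x = 0) \<and> (\<forall>x\<ge>b. F x = 1)}"

definition sup_dist :: "(real \<Rightarrow> real) \<Rightarrow> (real \<Rightarrow> real) \<Rightarrow> real" where
  "sup_dist F G = (SUP x. \<bar>F x - G x\<bar>)"

definition convex_fset :: "(real \<Rightarrow> real) set \<Rightarrow> bool" where
  "convex_fset D \<longleftrightarrow> (\<forall>F\<in>D. \<forall>G\<in>D. \<forall>l\<in>{0..1::real}. (\<lambda>x. l * F x + (1 - l) * G x) \<in> D)"

definition unit_simplex :: "nat \<Rightarrow> (nat \<Rightarrow> real) set" where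
  "unit_simplex K = {\<delta>. (\<forall>i. 0 \<le> \<delta> i) \<and> (\<forall>i. i \<notin> {1..K} \<longrightarrow> \<delta> i = 0) \<and> (\<Sum>i=1..K. \<delta> i) = 1}"

definition mix :: "nat \<Rightarrow> (nat \<Rightarrow> real) \<Rightarrow> (nat \<Rightarrow> real \<Rightarrow> real) \<Rightarrow> (real \<Rightarrow> real)" where
  "mix K \<delta> F = (\<lambda>y. \<Sum>i=1..K. \<delta> i * F i y)"

definition lex_less :: "nat \<Rightarrow> (nat \<Rightarrow> real) \<Rightarrow> (nat \<Rightarrow> real) \<Rightarrow> bool" where
  "lex_less K \<delta> \<gamma> \<longleftrightarrow> (\<exists>i\<in>{1..K}. \<delta> i < \<gamma> i \<and> (\<forall>j\<in>{1..K}. j < i \<longrightarrow> \<delta> j = \<gamma> j))"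

definition lex_min :: "nat \<Rightarrow> (nat \<Rightarrow> real) set \<Rightarrow> (nat \<Rightarrow> real)" where
  "lex_min K S = (THE \<delta>. \<delta> \<in> S \<and> (\<forall>\<gamma>\<in>S. \<gamma> \<noteq> \<delta> \<longrightarrow> lex_less K \<delta> \<gamma>))"

text \<open>Empirical cdf of the outcomes of the subjects among 1..t assigned (by A) to treatment i;
  Y s i is the potential outcome of subject s under treatment i.\<close>
definition emp_cdf :: "(nat \<Rightarrow> nat) \<Rightarrow> (nat \<Rightarrow> nat \<Rightarrow> real) \<Rightarrow> nat \<Rightarrow> nat \<Rightarrow> real \<Rightarrow> real" where
  "emp_cdf A Y t i = (\<lambda>y. real (card {s\<in>{1..t}. A s = i \<and> Y s i \<le> y})
                           / real (card {s\<in>{1..t}. A s = i}))"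

definition u_eta :: "real \<Rightarrow> nat \<Rightarrow> real \<Rightarrow> nat \<Rightarrow> nat \<Rightarrow> real" where
  "u_eta C K \<eta> r n = C * sqrt ((1 + \<eta>) / real r * (0.5 * ln (real n) + ln (real r * real K)))"

record pstate =
  st_t :: nat
  st_r :: nat
  st_I :: "nat set"
  st_M :: "(nat \<Rightarrow> real) set"
  st_A :: "nat \<Rightarrow> nat"

definition assign_next :: "nat \<Rightarrow> nat \<Rightarrow> nat set \<Rightarrow> (nat \<Rightarrow> nat) \<Rightarrow> (nat \<Rightarrow> nat)" where
  "assign_next t k I A = (\<lambda>s. if t < s \<and> s \<le> t + k then sorted_list_of_set I ! (s - t - 1) else A s)"

definition pol_step ::
  "((real \<Rightarrow> real) \<Rightarrow> real) \<Rightarrow> real \<Rightarrow> nat \<Rightarrow> nat \<Rightarrow> nat set \<Rightarrow> real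
     \<Rightarrow> (nat \<Rightarrow> nat \<Rightarrow> real) \<Rightarrow> pstate \<Rightarrow> pstate" where
  "pol_step T C K n R \<eta> Y st =
    (if st_t st + card (st_I st) \<le> n then
       (let I = st_I st; M = st_M st;
            A' = assign_next (st_t st) (card I) I (st_A st);
            t' = st_t st + card I;
            r' = st_r st + 1;
            Fh = (\<lambda>i. emp_cdf A' Y t' i)
        in if r' \<in> R \<and> 2 \<le> card I then
             (let h = Max ((\<lambda>\<delta>. T (mix K \<delta> Fh)) ` M);
                  M' = {\<gamma>\<in>M. h - T (mix K \<gamma> Fh) \<le> 2 * u_eta C K \<eta> r' n};
                  I' = {i\<in>I. \<exists>\<gamma>\<in>M'. 0 < \<gamma> i}
              in \<lparr>st_t = t', st_r = r', st_I = I', st_M = M', st_A = A'\<rparr>)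
           else \<lparr>st_t = t', st_r = r', st_I = I, st_M = M, st_A = A'\<rparr>)
     else st)"

definition pol_init :: "nat \<Rightarrow> (nat \<Rightarrow> real) set \<Rightarrow> pstate" where
  "pol_init K Mn = \<lparr>st_t = 0, st_r = 0, st_I = {1..K}, st_M = Mn, st_A = (\<lambda>_. 0)\<rparr>"

text \<open>State after the while loop: every effective pass assigns at least one subject,
  so at most n passes are effective.\<close>
definition pol_loop ::
  "((real \<Rightarrow> real) \<Rightarrow> real) \<Rightarrow> real \<Rightarrow> nat \<Rightarrow> nat \<Rightarrow> nat set \<Rightarrow> real
     \<Rightarrow> (nat \<Rightarrow> real) set \<Rightarrow> (nat \<Rightarrow> nat \<Rightarrow> real) \<Rightarrow> pstate" where
  "pol_loop T C K n R \<eta> Mn Y = (pol_step T C K n R \<eta> Y ^^ (n + 1)) (pol_init K Mn)"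

definition pol_rec ::
  "((real \<Rightarrow> real) \<Rightarrow> real) \<Rightarrow> real \<Rightarrow> nat \<Rightarrow> nat \<Rightarrow> nat set \<Rightarrow> real
     \<Rightarrow> (nat \<Rightarrow> real) set \<Rightarrow> (nat \<Rightarrow> nat \<Rightarrow> real) \<Rightarrow> (nat \<Rightarrow> real)" where
  "pol_rec T C K n R \<eta> Mn Y =
    (let st = pol_loop T C K n R \<eta> Mn Y;
         A = assign_next (st_t st) (n - st_t st) (st_I st) (st_A st);
         Fh = (\<lambda>i. emp_cdf A Y n i);
         M = st_M st;
         m = Max ((\<lambda>\<delta>. T (mix K \<delta> Fh)) ` M)
     in lex_min K {\<delta>\<in>M. T (mix K \<delta> Fh) = m})"

definition regret ::
  "((real \<Rightarrow> real) \<Rightarrow> real) \<Rightarrow> nat \<Rightarrow> (nat \<Rightarrow> real) set \<Rightarrow> (nat \<Rightarrow> real \<Rightarrow> real)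
     \<Rightarrow> (nat \<Rightarrow> real) \<Rightarrow> real" where
  "regret T K MK F \<delta>r = (SUP \<delta>\<in>MK. T (mix K \<delta> F)) - T (mix K \<delta>r F)"

definition disc_err ::
  "((real \<Rightarrow> real) \<Rightarrow> real) \<Rightarrow> nat \<Rightarrow> (real \<Rightarrow> real) set \<Rightarrow> (nat \<Rightarrow> real) set
     \<Rightarrow> (nat \<Rightarrow> real) set \<Rightarrow> real" where
  "disc_err T K D MK Mn =
     (SUP F\<in>{F. \<forall>i\<in>{1..K}. F i \<in> D}.
        \<bar>(SUP \<delta>\<in>MK. T (mix K \<delta> F)) - (SUP \<delta>\<in>Mn. T (mix K \<delta> F))\<bar>)"

definition marg_cdf :: "(nat \<Rightarrow> real) measure \<Rightarrow> nat \<Rightarrow> real \<Rightarrow> real" where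
  "marg_cdf \<mu> i = (\<lambda>x. measure \<mu> {y\<in>space \<mu>. y i \<le> x})"

end

theory Submission
  imports Defs
begin

text \<open>On the event that every empirical cdf stays within the confidence radius in all rounds, the
  best element of the discretization is never eliminated, and the regret against it is at most \<open>2 C\<close> times
  the largest final deviation among the surviving arms, each of which has been sampled at least
  \<open>n div K\<close> times. The sample sizes are random. They are handled by functions \<open>f\<close> of the
  list of outcomes observed on one arm that do not increase on average when one further outcome is
  appended: as the assignment is predictable, the expected value of such an \<open>f\<close> at the final list is
  at most \<open>f []\<close>, for every arm separately and hence for a sum over the arms. For integrands not known
  to be measurable the integral is a lower integral, and a lower integral over a product is at most
  the iterated one, which is the direction needed here.

  Exponentials of deviations on a quantile grid, frozen at sample size \<open>r\<close>, give the tail bound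
  \<open>10 r exp (1 - 2 r \<epsilon>\<^sup>2)\<close>, which suffices for the failure of the confidence radii and for the
  rate that is logarithmic in \<open>n\<close>. The rate without \<open>log n\<close> comes from Doob's inequality for the martingale
  \<open>x \<mapsto> (F\<^sub>n x - F x) / (1 - F x)\<close> in the spatial variable.\<close>

subsection \<open>Sampling by a predictable rule\<close>

text \<open>The obstacle is that sample sizes depend on the outcomes: conditioning on the final
  length of an arm's list would destroy the i.i.d. structure. Instead each event is dominated by a
  function of the list on all lengths that can occur, and only its value at \<open>[]\<close> is
  computed. Such functions arise in two ways. One is a product of one-letter exponentials that stops
  after a fixed number of entries; it controls one sample size, and a union bound over sizes costs
  the \<open>log n\<close>. The other is the conditional expectation, given the entries seen so far,
  of a maximal function of \<open>n\<close> entries; by Jensen it dominates at every length up to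
  \<open>n\<close> at once. Doob's inequality is proved for words over a finite alphabet: for a
  finite chain of sets only the first set containing a point matters, so expectations become finite
  sums and conditioning becomes splitting a word. Its constant does not depend on the length of the
  chain, so the grid can be refined for free. The factor \<open>4 C\<close> is \<open>2 C\<close>
  (one deviation for the best element, one for the recommended one) times a factor 2 left for the
  rates.\<close>

definition superharmonic :: "real measure \<Rightarrow> (real list \<Rightarrow> ennreal) \<Rightarrow> bool" where
  "superharmonic \<nu> f \<longleftrightarrow> (\<forall>zs. (\<lambda>y. f (zs @ [y])) \<in> borel_measurable \<nu>
     \<and> (\<integral>\<^sup>+y. f (zs @ [y]) \<partial>\<nu>) \<le> f zs)"

lemma superharmonicI:
  assumes "\<And>zs. (\<lambda>y. f (zs @ [y])) \<in> borel_measurable \<nu>"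
    and "\<And>zs. (\<integral>\<^sup>+y. f (zs @ [y]) \<partial>\<nu>) \<le> f zs"
  shows "superharmonic \<nu> f"
  using assms by (auto simp: superharmonic_def)

lemma superharmonicD:
  assumes "superharmonic \<nu> f"
  shows "(\<lambda>y. f (zs @ [y])) \<in> borel_measurable \<nu>" "(\<integral>\<^sup>+y. f (zs @ [y]) \<partial>\<nu>) \<le> f zs"
  using assms by (auto simp: superharmonic_def)

lemma superharmonic_zero: "superharmonic \<nu> (\<lambda>_. 0)"
  by (auto intro!: superharmonicI)

lemma superharmonic_const: "prob_space \<nu> \<Longrightarrow> superharmonic \<nu> (\<lambda>_. c)"
  by (auto intro!: superharmonicI simp: prob_space.emeasure_space_1)

lemma superharmonic_cmult:
  assumes "superharmonic \<nu> f"
  shows "superharmonic \<nu> (\<lambda>zs. c * f zs)"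
  using superharmonicD[OF assms]
  by (auto intro!: superharmonicI mult_left_mono simp: nn_integral_cmult)

lemma superharmonic_add:
  assumes "superharmonic \<nu> f" "superharmonic \<nu> g"
  shows "superharmonic \<nu> (\<lambda>zs. f zs + g zs)"
  using superharmonicD[OF assms(1)] superharmonicD[OF assms(2)]
  by (auto intro!: superharmonicI add_mono simp: nn_integral_add)

lemma superharmonic_sum:
  assumes "\<And>k. k \<in> I \<Longrightarrow> superharmonic \<nu> (f k)"
  shows "superharmonic \<nu> (\<lambda>zs. \<Sum>k\<in>I. f k zs)"
  using assms
  by (induction I rule: infinite_finite_induct)
     (auto intro!: superharmonic_zero superharmonic_add)

definition sampled :: "(nat \<Rightarrow> nat) \<Rightarrow> (nat \<Rightarrow> nat \<Rightarrow> real) \<Rightarrow> nat \<Rightarrow> nat \<Rightarrow> real list" where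
  "sampled A Y t i = map (\<lambda>s. Y s i) (filter (\<lambda>s. A s = i) [1..<Suc t])"

lemma sampled_0 [simp]: "sampled A Y 0 i = []"
  by (simp add: sampled_def)

lemma sampled_Suc:
  "sampled A Y (Suc t) i = sampled A Y t i @ (if A (Suc t) = i then [Y (Suc t) i] else [])"
  by (simp add: sampled_def)

lemma sampled_cong:
  assumes "\<And>s. s \<in> {1..t} \<Longrightarrow> A s = A' s" "\<And>s. s \<in> {1..t} \<Longrightarrow> Y s = Y' s"
  shows "sampled A Y t i = sampled A' Y' t i"
  using assms by (induction t) (auto simp: sampled_Suc)

text \<open>The assignment of subject \<open>s\<close> may use the full vectors of earlier subjects,
  unobserved potential outcomes included; only independence of subject \<open>s\<close> from all of
  these matters for the integration below.\<close>

definition predictable :: "((nat \<Rightarrow> nat \<Rightarrow> real) \<Rightarrow> nat \<Rightarrow> nat) \<Rightarrow> bool" where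
  "predictable A \<longleftrightarrow> (\<forall>Y Y' s. (\<forall>u\<in>{1..<s}. Y u = Y' u) \<longrightarrow> A Y s = A Y' s)"

text \<open>Tonelli for an integrand not known to be measurable. The lower integral is a supremum
  over simple functions below \<open>f\<close>; these are measurable, so iterated integration is
  exact for each of them, and monotonicity of the iterated integral gives the bound.\<close>

lemma (in product_sigma_finite) nn_integral_PiM_insert_le:
  assumes "finite I" "i \<notin> I"
  shows "integral\<^sup>N (Pi\<^sub>M (insert i I) M) f \<le> (\<integral>\<^sup>+ x. (\<integral>\<^sup>+ y. f (x(i := y)) \<partial>(M i)) \<partial>(Pi\<^sub>M I M))"
proof -
  have "integral\<^sup>S (Pi\<^sub>M (insert i I) M) g \<le> (\<integral>\<^sup>+ x. (\<integral>\<^sup>+ y. f (x(i := y)) \<partial>(M i)) \<partial>(Pi\<^sub>M I M))"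
    if g: "simple_function (Pi\<^sub>M (insert i I) M) g" "g \<le> f" for g
  proof -
    have "integral\<^sup>S (Pi\<^sub>M (insert i I) M) g = integral\<^sup>N (Pi\<^sub>M (insert i I) M) g"
      using g(1) by (simp add: nn_integral_eq_simple_integral)
    also have "\<dots> = (\<integral>\<^sup>+ x. (\<integral>\<^sup>+ y. g (x(i := y)) \<partial>(M i)) \<partial>(Pi\<^sub>M I M))"
      using g(1) assms by (intro product_nn_integral_insert borel_measurable_simple_function)
    also have "\<dots> \<le> (\<integral>\<^sup>+ x. (\<integral>\<^sup>+ y. f (x(i := y)) \<partial>(M i)) \<partial>(Pi\<^sub>M I M))"
      using g(2) by (intro nn_integral_mono) (auto simp: le_fun_def)
    finally show ?thesis .
  qed
  then show ?thesis
    unfolding nn_integral_def[of "Pi\<^sub>M (insert i I) M"] by (auto intro!: SUP_least)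
qed

text \<open>Summand \<open>i\<close> reads only the coordinate \<open>y i\<close>, so the outcomes
  of one subject may be dependent across arms: linearity reduces the claim to one arm, where either
  nothing is appended or superharmonicity applies.\<close>

lemma nn_integral_sampled_step:
  assumes "prob_space \<mu>" "finite I"
    and meas: "\<And>i. i \<in> I \<Longrightarrow> (\<lambda>y. y i) \<in> measurable \<mu> borel"
    and sup: "\<And>i. i \<in> I \<Longrightarrow> superharmonic (distr \<mu> borel (\<lambda>y. y i)) (f i)"
  shows "(\<integral>\<^sup>+ y. (\<Sum>i\<in>I. f i (z i @ (if k = i then [y i] else []))) \<partial>\<mu>) \<le> (\<Sum>i\<in>I. f i (z i))"
proof -
  interpret prob_space \<mu> by fact
  have m: "(\<lambda>y. f i (z i @ [y i])) \<in> borel_measurable \<mu>" if "i \<in> I" for i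
  proof -
    have "(\<lambda>y. f i (z i @ [y])) \<in> borel_measurable borel"
      using superharmonicD(1)[OF sup[OF that]] by simp
    from measurable_compose[OF meas[OF that] this] show ?thesis .
  qed
  have "(\<integral>\<^sup>+ y. (\<Sum>i\<in>I. f i (z i @ (if k = i then [y i] else []))) \<partial>\<mu>) =
        (\<Sum>i\<in>I. \<integral>\<^sup>+ y. f i (z i @ (if k = i then [y i] else [])) \<partial>\<mu>)"
    proof (rule nn_integral_sum)
    show "(\<lambda>y. f i (z i @ (if k = i then [y i] else []))) \<in> borel_measurable \<mu>" if "i \<in> I" for i
      using m[OF that] by (cases "k = i") auto
  qed
  also have "\<dots> \<le> (\<Sum>i\<in>I. f i (z i))"
  proof (rule sum_mono)
    fix i assume i: "i \<in> I"
    show "(\<integral>\<^sup>+ y. f i (z i @ (if k = i then [y i] else [])) \<partial>\<mu>) \<le> f i (z i)"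
    proof (cases "k = i")
      case True
      have "(\<integral>\<^sup>+ y. f i (z i @ [y i]) \<partial>\<mu>) = (\<integral>\<^sup>+ y. f i (z i @ [y]) \<partial>distr \<mu> borel (\<lambda>y. y i))"
        using superharmonicD(1)[OF sup[OF i]] meas[OF i] by (subst nn_integral_distr) auto
      also have "\<dots> \<le> f i (z i)"
        by (rule superharmonicD[OF sup[OF i]])
      finally show ?thesis using True by simp
    qed (simp add: emeasure_space_1)
  qed
  finally show ?thesis .
qed

text \<open>Integrate out the last subject first. Predictability makes \<open>A Y (Suc t)\<close>
  and all lists up to \<open>t\<close> constants in that inner integral.\<close>

theorem nn_integral_sampled_le:
  assumes "prob_space \<mu>" "finite I"
    and "\<And>i. i \<in> I \<Longrightarrow> (\<lambda>y. y i) \<in> measurable \<mu> borel"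
    and "\<And>i. i \<in> I \<Longrightarrow> superharmonic (distr \<mu> borel (\<lambda>y. y i)) (f i)"
    and pred: "predictable A"
  shows "(\<integral>\<^sup>+ Y. (\<Sum>i\<in>I. f i (sampled (A Y) Y t i)) \<partial>(PiM {1..t} (\<lambda>_. \<mu>))) \<le> (\<Sum>i\<in>I. f i [])"
proof (induction t)
  interpret prob_space \<mu> by fact
  interpret product_prob_space "\<lambda>_::nat. \<mu>" by unfold_locales
  case 0
  then show ?case by (simp add: PiM_empty nn_integral_count_space_finite)
next
  interpret prob_space \<mu> by fact
  interpret product_prob_space "\<lambda>_::nat. \<mu>" by unfold_locales
  case (Suc t)
  let ?P = "PiM {1..t} (\<lambda>_. \<mu>)"
  have "(\<integral>\<^sup>+ Y. (\<Sum>i\<in>I. f i (sampled (A Y) Y (Suc t) i)) \<partial>(PiM {1..Suc t} (\<lambda>_. \<mu>))) \<le>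
      (\<integral>\<^sup>+ Y. \<integral>\<^sup>+ y. (\<Sum>i\<in>I. f i (sampled (A (Y(Suc t := y))) (Y(Suc t := y)) (Suc t) i)) \<partial>\<mu> \<partial>?P)"
    using nn_integral_PiM_insert_le[of "{1..t}" "Suc t"] by (simp add: atLeastAtMostSuc_conv)
  also have "\<dots> \<le> (\<integral>\<^sup>+ Y. (\<Sum>i\<in>I. f i (sampled (A Y) Y t i)) \<partial>?P)"
  proof (rule nn_integral_mono)
    fix Y
    have A: "A (Y(Suc t := y)) s = A Y s" if "s \<le> Suc t" for s y
      using pred[unfolded predictable_def, rule_format, of s "Y(Suc t := y)" Y] that by auto
    have "sampled (A (Y(Suc t := y))) (Y(Suc t := y)) (Suc t) i =
        sampled (A Y) Y t i @ (if A Y (Suc t) = i then [y i] else [])" for y i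
      using sampled_cong[of t "A (Y(Suc t := y))" "A Y" "Y(Suc t := y)" Y i]
      by (simp add: sampled_Suc A)
    then show "(\<integral>\<^sup>+ y. (\<Sum>i\<in>I. f i (sampled (A (Y(Suc t := y))) (Y(Suc t := y)) (Suc t) i)) \<partial>\<mu>)
        \<le> (\<Sum>i\<in>I. f i (sampled (A Y) Y t i))"
      using nn_integral_sampled_step[OF assms(1-4), of "\<lambda>i. sampled (A Y) Y t i" "A Y (Suc t)"]
      by simp
  qed
  also have "\<dots> \<le> (\<Sum>i\<in>I. f i [])" by (rule Suc)
  finally show ?case .
qed

subsection \<open>Doob's inequality for words over a finite alphabet\<close>

text \<open>Hoeffding's lemma for a centred Bernoulli variable. \<open>Hoeffdings_lemma_aux\<close>
  is applied with a nonnegative parameter; a negative \<open>s\<close> is reduced to it by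
  exchanging success and failure.\<close>

lemma two_point_mgf_le:
  fixes p s :: real
  assumes "0 \<le> p" "p \<le> 1"
  shows "p * exp (s * (1 - p)) + (1 - p) * exp (- (s * p)) \<le> exp (s\<^sup>2 / 8)"
proof -
  have *: "1 - q + q * exp h \<le> exp (h * q + h\<^sup>2 / 8)" if "0 \<le> h" "0 \<le> q" "q \<le> 1" for h q :: real
  proof -
    have pos: "1 + q * (exp h - 1) > 0"
      using that by (intro add_pos_nonneg mult_nonneg_nonneg) auto
    have "ln (1 + q * (exp h - 1)) \<le> h * q + h\<^sup>2 / 8"
      using Hoeffdings_lemma_aux[of h q] that by simp
    then have "1 + q * (exp h - 1) \<le> exp (h * q + h\<^sup>2 / 8)"
      using pos by (metis exp_le_cancel_iff exp_ln)
    then show ?thesis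
      by (simp add: right_diff_distrib)
  qed
  show ?thesis
  proof (cases "s \<ge> 0")
    case True
    have "p * exp (s * (1 - p)) + (1 - p) * exp (- (s * p)) = exp (- (s * p)) * (1 - p + p * exp s)"
      using exp_add[of "- (s * p)" s] by (simp add: algebra_simps)
    also have "\<dots> \<le> exp (- (s * p)) * exp (s * p + s\<^sup>2 / 8)"
      using *[of s p] True assms by (intro mult_left_mono) auto
    also have "\<dots> = exp (s\<^sup>2 / 8)"
      by (simp flip: exp_add)
    finally show ?thesis .
  next
    case False
    have "p * exp (s * (1 - p)) + (1 - p) * exp (- (s * p)) =
        exp (s * (1 - p)) * (1 - (1 - p) + (1 - p) * exp (- s))"
      using exp_add[of "s * (1 - p)" "- s"] by (simp add: algebra_simps)
    also have "\<dots> \<le> exp (s * (1 - p)) * exp (- s * (1 - p) + (- s)\<^sup>2 / 8)"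
      using *[of "- s" "1 - p"] False assms by (intro mult_left_mono) auto
    also have "\<dots> = exp (s\<^sup>2 / 8)"
      by (simp flip: exp_add)
    finally show ?thesis .
  qed
qed

text \<open>Expectation over words of \<open>n\<close> independent letters with weights
  \<open>p\<close>. The recursion on the first letter makes conditioning on a prefix a mere
  unfolding.\<close>

fun expn :: "nat \<Rightarrow> (nat \<Rightarrow> real) \<Rightarrow> nat \<Rightarrow> (nat list \<Rightarrow> real) \<Rightarrow> real" where
  "expn m p 0 G = G []"
| "expn m p (Suc n) G = (\<Sum>y\<le>m. p y * expn m p n (\<lambda>zs. G (y # zs)))"

lemma expn_mono:
  assumes "\<And>y. y \<le> m \<Longrightarrow> 0 \<le> p y"
    and "\<And>zs. set zs \<subseteq> {..m} \<Longrightarrow> length zs = n \<Longrightarrow> G zs \<le> H zs"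
  shows "expn m p n G \<le> expn m p n H"
  using assms(2)
proof (induction n arbitrary: G H)
  case (Suc n)
  have "expn m p n (\<lambda>zs. G (y # zs)) \<le> expn m p n (\<lambda>zs. H (y # zs))" if "y \<le> m" for y
    using that by (intro Suc.IH Suc.prems) auto
  then show ?case
    using assms(1) by (auto intro!: sum_mono mult_left_mono)
qed simp

lemma expn_add: "expn m p n (\<lambda>zs. G zs + H zs) = expn m p n G + expn m p n H"
  by (induction n arbitrary: G H) (simp_all add: distrib_left sum.distrib)

lemma expn_cmult: "expn m p n (\<lambda>zs. c * G zs) = c * expn m p n G"
  by (induction n arbitrary: G) (simp_all add: mult.left_commute sum_distrib_left)

lemma expn_zero: "expn m p n (\<lambda>zs. 0) = 0"
  using expn_cmult[of m p n 0 "\<lambda>_. 0"] by simp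

lemma expn_sum: "expn m p n (\<lambda>zs. \<Sum>i\<in>I. G i zs) = (\<Sum>i\<in>I. expn m p n (G i))"
  by (induction I rule: infinite_finite_induct) (auto simp: expn_zero expn_add)

lemma expn_nonneg:
  assumes "\<And>y. y \<le> m \<Longrightarrow> 0 \<le> p y" "\<And>zs. 0 \<le> G zs"
  shows "0 \<le> expn m p n G"
  using expn_mono[of m p n "\<lambda>_. 0" G] assms by (simp add: expn_zero)

lemma expn_prod_list:
  "expn m p n (\<lambda>zs. c * prod_list (map u zs)) = c * (\<Sum>y\<le>m. p y * u y) ^ n"
proof (induction n arbitrary: c)
  case (Suc n)
  have "expn m p (Suc n) (\<lambda>zs. c * prod_list (map u zs)) =
      (\<Sum>y\<le>m. p y * expn m p n (\<lambda>zs. (c * u y) * prod_list (map u zs)))"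
    by (simp add: mult.assoc)
  also have "\<dots> = c * (\<Sum>y\<le>m. p y * u y) ^ Suc n"
    unfolding Suc by (simp add: sum_distrib_left sum_distrib_right mult_ac)
  finally show ?case .
qed simp

text \<open>Replaces the conditional expectation inequality \<open>E[u | y \<and> k] \<ge> v\<close>, where only the truncation of
  a letter at level \<open>k\<close> is observed, by its consequence for product weights.\<close>

lemma expn_tilt_mono:
  assumes p: "\<And>y. y \<le> m \<Longrightarrow> 0 \<le> p y" and u: "\<And>y. 0 \<le> u y"
    and uv: "\<And>g. (\<And>y. 0 \<le> g y) \<Longrightarrow> (\<And>y y'. k < y \<Longrightarrow> k < y' \<Longrightarrow> g y = g y') \<Longrightarrow>
        (\<Sum>y\<le>m. p y * (g y * v y)) \<le> (\<Sum>y\<le>m. p y * (g y * u y))"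
    and v: "\<And>y. 0 \<le> v y"
    and h: "\<And>zs. 0 \<le> h zs"
    and inv: "\<And>zs zs'. list_all2 (\<lambda>x y. x = y \<or> k < x \<and> k < y) zs zs' \<Longrightarrow> h zs = h zs'"
  shows "expn m p n (\<lambda>zs. h zs * prod_list (map v zs)) \<le> expn m p n (\<lambda>zs. h zs * prod_list (map u zs))"
  using h inv
proof (induction n arbitrary: h)
  case 0
  show ?case by simp
next
  case (Suc n)
  define g where "g y = expn m p n (\<lambda>zs. h (y # zs) * prod_list (map v zs))" for y
  have refl: "list_all2 (\<lambda>x y. x = y \<or> k < x \<and> k < y) zs zs" for zs
    by (auto simp: list_all2_conv_all_nth)
  have "expn m p (Suc n) (\<lambda>zs. h zs * prod_list (map v zs)) = (\<Sum>y\<le>m. p y * (g y * v y))"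
    unfolding expn.simps
  proof (intro sum.cong refl arg_cong2[where f = "(*)"])
    fix y
    have "expn m p n (\<lambda>zs. h (y # zs) * prod_list (map v (y # zs))) =
        expn m p n (\<lambda>zs. v y * (h (y # zs) * prod_list (map v zs)))"
      by (simp add: mult_ac)
    then show "expn m p n (\<lambda>zs. h (y # zs) * prod_list (map v (y # zs))) = g y * v y"
      by (simp add: expn_cmult g_def)
  qed auto
  also have "\<dots> \<le> (\<Sum>y\<le>m. p y * (g y * u y))"
  proof (rule uv)
    show "0 \<le> g y" for y
      unfolding g_def using p v Suc.prems(1)
      by (intro expn_nonneg mult_nonneg_nonneg prod_list_nonneg) auto
    show "g y = g y'" if "k < y" "k < y'" for y y'
      unfolding g_def using that refl
      by (intro arg_cong[where f = "expn m p n"] ext arg_cong2[where f = "(*)"] Suc.prems(2)) auto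
  qed
  also have "\<dots> \<le> expn m p (Suc n) (\<lambda>zs. h zs * prod_list (map u zs))"
    unfolding expn.simps
  proof (intro sum_mono mult_left_mono)
    fix y
    assume y: "y \<in> {..m}"
    have "g y \<le> expn m p n (\<lambda>zs. h (y # zs) * prod_list (map u zs))"
      unfolding g_def using Suc.prems(2) by (intro Suc.IH) (auto simp: Suc.prems(1))
    then have "g y * u y \<le> u y * expn m p n (\<lambda>zs. h (y # zs) * prod_list (map u zs))"
      by (metis mult.commute mult_left_mono u)
    also have "\<dots> = expn m p n (\<lambda>zs. h (y # zs) * prod_list (map u (y # zs)))"
      by (simp add: mult.left_commute expn_cmult)
    finally show "g y * u y \<le> expn m p n (\<lambda>zs. h (y # zs) * prod_list (map u (y # zs)))" .
  qed (use p in auto)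
  finally show ?case .
qed

fun running_max :: "(nat \<Rightarrow> real) \<Rightarrow> nat \<Rightarrow> real" where
  "running_max U 0 = U 0"
| "running_max U (Suc k) = max (running_max U k) (U (Suc k))"

lemma running_max_ge: "j \<le> k \<Longrightarrow> U j \<le> running_max U k"
  by (induction k) (auto simp: le_Suc_eq)

lemma running_max_cong: "(\<And>j. j \<le> k \<Longrightarrow> U j = U' j) \<Longrightarrow> running_max U k = running_max U' k"
  by (induction k) auto

text \<open>Pathwise form of Doob's inequality with its constant 4. Write \<open>S\<close> for the
  running maximum. Its discrete integral against the increments of \<open>U\<close> is at most
  \<open>S U - S^2 / 2\<close>, because \<open>S\<close> moves only when it then equals
  \<open>U\<close>; \<open>(S - 2 U)^2 \<ge> 0\<close> finishes. The integral is split into two sums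
  so that expectations can be taken separately.\<close>

lemma running_max_square_le:
  "(running_max U m)\<^sup>2 + 4 * (\<Sum>k<m. running_max U k * U (Suc k))
     \<le> 4 * (U m)\<^sup>2 + 4 * (\<Sum>k<m. running_max U k * U k)"
proof -
  have "(\<Sum>k<m. running_max U k * (U (Suc k) - U k)) \<le> running_max U m * U m - (running_max U m)\<^sup>2 / 2"
  proof (induction m)
    case (Suc m)
    have "x * u - x\<^sup>2 / 2 \<le> max x u * u - (max x u)\<^sup>2 / 2" for x u :: real
      using zero_le_power2[of "x - u"] unfolding power2_diff
      by (cases "x \<le> u") (simp_all add: max_def power2_eq_square[of u, symmetric])
    from this[of "running_max U m" "U (Suc m)"] Suc show ?case
      by (simp add: algebra_simps)
  qed (simp add: power2_eq_square)
  moreover have "0 \<le> (running_max U m)\<^sup>2 - 4 * (running_max U m * U m) + 4 * (U m)\<^sup>2"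
    using zero_le_power2[of "running_max U m - 2 * U m"] by (simp add: power2_diff power_mult_distrib)
  moreover have "(\<Sum>k<m. running_max U k * (U (Suc k) - U k)) =
      (\<Sum>k<m. running_max U k * U (Suc k)) - (\<Sum>k<m. running_max U k * U k)"
    by (simp add: right_diff_distrib sum_subtractf)
  ultimately show ?thesis
    by linarith
qed

text \<open>Doob's \<open>L\<^sup>2\<close> inequality, by integrating the preceding pathwise inequality.\<close>

lemma expn_running_max_le:
  assumes p: "\<And>y. y \<le> m \<Longrightarrow> 0 \<le> p y"
    and u: "\<And>k y. 0 \<le> u k y"
    and adapted: "\<And>k y y'. k < y \<Longrightarrow> k < y' \<Longrightarrow> u k y = u k y'"
    and step: "\<And>k g. k < M \<Longrightarrow> (\<And>y. 0 \<le> g y) \<Longrightarrow> (\<And>y y'. k < y \<Longrightarrow> k < y' \<Longrightarrow> g y = g y') \<Longrightarrow>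
        (\<Sum>y\<le>m. p y * (g y * u k y)) \<le> (\<Sum>y\<le>m. p y * (g y * u (Suc k) y))"
  shows "expn m p n (\<lambda>zs. (running_max (\<lambda>k. prod_list (map (u k) zs)) M)\<^sup>2)
    \<le> 4 * (\<Sum>y\<le>m. p y * (u M y)\<^sup>2) ^ n"
proof -
  define U where "U zs k = prod_list (map (u k) zs)" for zs k
  have U_nonneg: "0 \<le> U zs k" for zs k
    unfolding U_def using u by (intro prod_list_nonneg) auto
  have max_nonneg: "0 \<le> running_max (U zs) k" for zs k
    using order_trans[OF U_nonneg running_max_ge[of 0 k "U zs"]] by simp
  have U_cong: "U zs k = U zs' k" if "list_all2 (\<lambda>x y. x = y \<or> k < x \<and> k < y) zs zs'" for zs zs' k
    using that unfolding U_def
  proof (induction rule: list_all2_induct)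
    case (Cons x xs y ys)
    then have "u k x = u k y"
      using adapted by blast
    with Cons show ?case by simp
  qed simp
  have tilt: "expn m p n (\<lambda>zs. running_max (U zs) k * U zs k)
      \<le> expn m p n (\<lambda>zs. running_max (U zs) k * U zs (Suc k))" if k: "k < M" for k
    unfolding U_def[of _ k] U_def[of _ "Suc k"]
  proof (rule expn_tilt_mono[where k = k, OF p u _ u max_nonneg])
    show "(\<Sum>y\<le>m. p y * (g y * u k y)) \<le> (\<Sum>y\<le>m. p y * (g y * u (Suc k) y))"
      if "\<And>y. 0 \<le> g y" "\<And>y y'. k < y \<Longrightarrow> k < y' \<Longrightarrow> g y = g y'" for g
      by (rule step[OF k]) (fact that)+
    show "running_max (U zs) k = running_max (U zs') k"
      if "list_all2 (\<lambda>x y. x = y \<or> k < x \<and> k < y) zs zs'" for zs zs'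
    proof (rule running_max_cong)
      fix j assume "j \<le> k"
      then show "U zs j = U zs' j"
        using that by (intro U_cong) (auto elim!: list_all2_mono)
    qed
  qed
  have "expn m p n (\<lambda>zs. (running_max (U zs) M)\<^sup>2 + 4 * (\<Sum>k<M. running_max (U zs) k * U zs (Suc k)))
     \<le> expn m p n (\<lambda>zs. 4 * (U zs M)\<^sup>2 + 4 * (\<Sum>k<M. running_max (U zs) k * U zs k))"
    using p by (intro expn_mono running_max_square_le) auto
  moreover have "(\<Sum>k<M. expn m p n (\<lambda>zs. running_max (U zs) k * U zs k))
      \<le> (\<Sum>k<M. expn m p n (\<lambda>zs. running_max (U zs) k * U zs (Suc k)))"
    using tilt by (intro sum_mono) auto
  ultimately have "expn m p n (\<lambda>zs. (running_max (U zs) M)\<^sup>2) \<le> expn m p n (\<lambda>zs. 4 * (U zs M)\<^sup>2)"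
    by (simp add: expn_add expn_cmult expn_sum)
  also have "(\<lambda>zs. 4 * (U zs M)\<^sup>2) = (\<lambda>zs. 4 * prod_list (map (\<lambda>y. (u M y)\<^sup>2) zs))"
  proof
    fix zs
    have "(prod_list (map (u M) zs))\<^sup>2 = prod_list (map (\<lambda>y. (u M y)\<^sup>2) zs)"
      by (induction zs) (auto simp: power_mult_distrib)
    then show "4 * (U zs M)\<^sup>2 = 4 * prod_list (map (\<lambda>y. (u M y)\<^sup>2) zs)"
      by (simp add: U_def)
  qed
  finally show ?thesis
    by (simp add: expn_prod_list U_def[abs_def])
qed

lemma sum_threshold:
  fixes p :: "nat \<Rightarrow> real"
  assumes "k \<le> m"
  shows "(\<Sum>y\<le>m. p y * (if y \<le> k then a else b)) = sum p {..k} * a + (sum p {..m} - sum p {..k}) * b"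
proof -
  have eq: "{..m} = {..k} \<union> {k<..m}" "{..k} \<inter> {k<..m} = {}"
    using assms by auto
  have "(\<Sum>y\<le>m. p y * (if y \<le> k then a else b)) =
      (\<Sum>y\<le>k. p y * (if y \<le> k then a else b)) + (\<Sum>y\<in>{k<..m}. p y * (if y \<le> k then a else b))"
    unfolding eq(1) by (rule sum.union_disjoint) (use eq in auto)
  also have "\<dots> = sum p {..k} * a + sum p {k<..m} * b"
    by (simp add: sum_distrib_right)
  also have "sum p {k<..m} = sum p {..m} - sum p {..k}"
    unfolding eq(1) by (subst sum.union_disjoint) (use eq in auto)
  finally show ?thesis .
qed

text \<open>The one-letter increment of the martingale \<open>k \<mapsto> (1\<^sub>k - P k) / (1 - P k)\<close>, with \<open>1\<^sub>k\<close> the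
  indicator of \<open>y \<le> k\<close>.\<close>

definition normalized_step :: "(nat \<Rightarrow> real) \<Rightarrow> nat \<Rightarrow> nat \<Rightarrow> real" where
  "normalized_step P k y = (if y \<le> k then 1 else - P k / (1 - P k))"

section \<open>The normalized martingale along a chain of mass at most one half\<close>

context
  fixes p P :: "nat \<Rightarrow> real" and M :: nat
  assumes p_nonneg: "\<And>y. y \<le> Suc M \<Longrightarrow> 0 \<le> p y" and p_sum: "sum p {..Suc M} = 1"
    and P_def: "\<And>k. k \<le> M \<Longrightarrow> P k = sum p {..k}" and P_le: "P M \<le> 1 / 2"
begin

lemma P_bounds: "k \<le> M \<Longrightarrow> 0 \<le> P k \<and> P k \<le> 1 / 2"
proof
  assume k: "k \<le> M"
  then show "0 \<le> P k"
    using p_nonneg by (auto simp: P_def intro!: sum_nonneg)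
  have "sum p {..k} \<le> sum p {..M}"
    using k p_nonneg by (intro sum_mono2) auto
  then show "P k \<le> 1 / 2"
    using k P_le by (simp add: P_def)
qed

lemma normalized_step_mean: "k \<le> M \<Longrightarrow> (\<Sum>y\<le>Suc M. p y * normalized_step P k y) = 0"
  using P_bounds[of k] sum_threshold[of k "Suc M" p 1 "- P k / (1 - P k)"] p_sum
  by (simp add: normalized_step_def P_def del: sum.atMost_Suc)

text \<open>Jensen's inequality at mean zero, through \<open>1 + x \<le> exp x\<close>. It later
  lets letters not yet drawn be averaged out without lowering the exponential.\<close>

lemma normalized_step_mgf_ge:
  assumes "k \<le> M"
  shows "1 \<le> (\<Sum>y\<le>Suc M. p y * exp (\<theta> * normalized_step P k y))"
proof -
  have "1 = (\<Sum>y\<le>Suc M. p y * (1 + \<theta> * normalized_step P k y))"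
    using normalized_step_mean[OF assms] p_sum
    by (simp add: distrib_left sum.distrib mult.left_commute sum_distrib_left[symmetric] del: sum.atMost_Suc)
  also have "\<dots> \<le> (\<Sum>y\<le>Suc M. p y * exp (\<theta> * normalized_step P k y))"
    using p_nonneg by (intro sum_mono mult_left_mono exp_ge_add_one_self) auto
  finally show ?thesis .
qed

text \<open>The step takes two values at distance \<open>1 / (1 - P k) \<le> 2\<close>, so
  Hoeffding's lemma applies with \<open>s = \<theta> / (1 - P k)\<close>, and
  \<open>s^2 / 8 \<le> \<theta>^2 / 2\<close>.\<close>

lemma normalized_step_mgf_le:
  assumes "k \<le> M"
  shows "(\<Sum>y\<le>Suc M. p y * exp (\<theta> * normalized_step P k y)) \<le> exp (\<theta>\<^sup>2 / 2)"
proof -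
  define q s where "q = P k" and "s = \<theta> / (1 - q)"
  have q: "0 \<le> q" "q \<le> 1 / 2"
    using P_bounds[OF assms] by (auto simp: q_def)
  have s: "s * (1 - q) = \<theta>"
    using q by (simp add: s_def)
  have "(\<Sum>y\<le>Suc M. p y * exp (\<theta> * normalized_step P k y)) =
      (\<Sum>y\<le>Suc M. p y * (if y \<le> k then exp \<theta> else exp (- (s * q))))"
    by (intro sum.cong refl) (auto simp: normalized_step_def s_def q_def)
  also have "\<dots> = q * exp (s * (1 - q)) + (1 - q) * exp (- (s * q))"
    using sum_threshold[of k "Suc M" p "exp \<theta>" "exp (- (s * q))"]
      P_def[OF assms, folded q_def, symmetric] assms p_sum by (simp add: s del: sum.atMost_Suc)
  also have "\<dots> \<le> exp (s\<^sup>2 / 8)"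
    using q by (intro two_point_mgf_le) auto
  also have "s\<^sup>2 / 8 \<le> \<theta>\<^sup>2 / 2"
  proof -
    have "\<theta>\<^sup>2 = s\<^sup>2 * (1 - q)\<^sup>2"
      using s by (metis power_mult_distrib)
    moreover have "(1 / 2)\<^sup>2 \<le> (1 - q)\<^sup>2"
      using q by (intro power_mono) auto
    then have "s\<^sup>2 * (1 / 2)\<^sup>2 \<le> s\<^sup>2 * (1 - q)\<^sup>2"
      by (intro mult_left_mono) auto
    ultimately show ?thesis
      by (simp add: power2_eq_square)
  qed
  finally show ?thesis by simp
qed

text \<open>Convexity of \<open>exp\<close>: its tangent at the old value lies below the new value.
  The increment of the step vanishes on letters up to \<open>k\<close>; above \<open>k\<close> the
  weight \<open>g y * exp (t * normalized_step P k y)\<close> is constant. As the increment has mean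
  zero, the linear term contributes nothing.\<close>

lemma normalized_step_submartingale:
  assumes k: "k < M" and g: "\<And>y. 0 \<le> g y" and const: "\<And>y y'. k < y \<Longrightarrow> k < y' \<Longrightarrow> g y = g y'"
  shows "(\<Sum>y\<le>Suc M. p y * (g y * exp (t * normalized_step P k y)))
    \<le> (\<Sum>y\<le>Suc M. p y * (g y * exp (t * normalized_step P (Suc k) y)))"
proof -
  let ?x = "normalized_step P"
  define d where "d = g (Suc k) * exp (t * ?x k (Suc k))"
  have "(\<Sum>y\<le>Suc M. p y * (g y * exp (t * ?x k y))) =
      (\<Sum>y\<le>Suc M. p y * (g y * exp (t * ?x k y))) + d * t * (\<Sum>y\<le>Suc M. p y * (?x (Suc k) y - ?x k y))"
    using normalized_step_mean[of k] normalized_step_mean[of "Suc k"] k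
    by (simp add: right_diff_distrib sum_subtractf del: sum.atMost_Suc)
  also have "\<dots> = (\<Sum>y\<le>Suc M. p y * (g y * exp (t * ?x k y) * (1 + t * (?x (Suc k) y - ?x k y))))"
    unfolding sum_distrib_left sum.distrib[symmetric]
  proof (rule sum.cong)
    fix y
    show "p y * (g y * exp (t * ?x k y)) + d * t * (p y * (?x (Suc k) y - ?x k y)) =
        p y * (g y * exp (t * ?x k y) * (1 + t * (?x (Suc k) y - ?x k y)))"
    proof (cases "y \<le> k")
      case False
      then have "d = g y * exp (t * ?x k y)"
        using const[of y "Suc k"] by (simp add: d_def normalized_step_def)
      then show ?thesis by (simp add: algebra_simps)
    qed (simp add: normalized_step_def)
  qed simp
  also have "\<dots> \<le> (\<Sum>y\<le>Suc M. p y * (g y * exp (t * ?x (Suc k) y)))"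
  proof (intro sum_mono mult_left_mono)
    fix y assume "y \<in> {..Suc M}"
    have "g y * exp (t * ?x k y) * (1 + t * (?x (Suc k) y - ?x k y))
        \<le> g y * exp (t * ?x k y) * exp (t * (?x (Suc k) y - ?x k y))"
      using g by (intro mult_left_mono exp_ge_add_one_self) auto
    also have "\<dots> = g y * exp (t * ?x (Suc k) y)"
      by (simp add: mult.assoc right_diff_distrib flip: exp_add)
    finally show "g y * exp (t * ?x k y) * (1 + t * (?x (Suc k) y - ?x k y)) \<le> g y * exp (t * ?x (Suc k) y)" .
  qed (use p_nonneg in auto)
  finally show ?thesis .
qed

text \<open>Halving \<open>\<theta>\<close> makes the square of the running maximum the maximum of
  the exponentials with parameter \<open>\<theta>\<close>. So the \<open>L^2\<close> inequality
  bounds an exponential maximum by 4 times a single moment, the one at the end \<open>M\<close> of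
  the chain.\<close>

lemma expn_chain_le:
  "expn (Suc M) p n (\<lambda>zs. (running_max (\<lambda>k. prod_list (map (\<lambda>y. exp (\<theta> / 2 * normalized_step P k y)) zs)) M)\<^sup>2)
    \<le> 4 * exp (\<theta>\<^sup>2 * n / 2)"
proof -
  have "expn (Suc M) p n (\<lambda>zs. (running_max (\<lambda>k. prod_list (map (\<lambda>y. exp (\<theta> / 2 * normalized_step P k y)) zs)) M)\<^sup>2)
      \<le> 4 * (\<Sum>y\<le>Suc M. p y * (exp (\<theta> / 2 * normalized_step P M y))\<^sup>2) ^ n"
  proof (rule expn_running_max_le)
    show "exp (\<theta> / 2 * normalized_step P k y) = exp (\<theta> / 2 * normalized_step P k y')"
      if "k < y" "k < y'" for k y y'
      using that by (simp add: normalized_step_def)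
    show "(\<Sum>y\<le>Suc M. p y * (g y * exp (\<theta> / 2 * normalized_step P k y)))
        \<le> (\<Sum>y\<le>Suc M. p y * (g y * exp (\<theta> / 2 * normalized_step P (Suc k) y)))"
      if "k < M" "\<And>y. 0 \<le> g y" "\<And>y y'. k < y \<Longrightarrow> k < y' \<Longrightarrow> g y = g y'" for k g
      by (rule normalized_step_submartingale) (fact that)+
  qed (use p_nonneg in auto)
  also have "(\<Sum>y\<le>Suc M. p y * (exp (\<theta> / 2 * normalized_step P M y))\<^sup>2) =
      (\<Sum>y\<le>Suc M. p y * exp (\<theta> * normalized_step P M y))"
    by (simp flip: exp_double add: algebra_simps del: sum.atMost_Suc)
  also have "4 * \<dots> ^ n \<le> 4 * exp (\<theta>\<^sup>2 / 2) ^ n"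
    using normalized_step_mgf_ge[of M \<theta>] normalized_step_mgf_le[of M \<theta>]
    by (intro mult_left_mono power_mono) auto
  also have "\<dots> = 4 * exp (\<theta>\<^sup>2 * n / 2)"
    by (simp add: exp_of_nat_mult[symmetric] mult.commute)
  finally show ?thesis by simp
qed

end

lemma prod_list_exp_mult: "prod_list (map (\<lambda>z. exp (\<theta> * f z :: real)) zs) = exp (\<theta> * sum_list (map f zs))"
  by (induction zs) (auto simp: exp_add distrib_left)

text \<open>Transfers the word estimate to real samples. \<open>f\<close> is the conditional
  expectation, given the letters drawn so far, of the maximal exponential over \<open>n\<close>
  letters, kept constant beyond \<open>n\<close> entries: a Doob martingale that starts at the
  maximal bound.\<close>

lemma superharmonic_chain:
  fixes \<nu> :: "real measure" and A :: "nat \<Rightarrow> real set" and M n :: nat and \<theta> :: real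
  assumes "prob_space \<nu>"
    and A: "\<And>k. k \<le> M \<Longrightarrow> A k \<in> sets \<nu>"
    and mono: "\<And>j k. j \<le> k \<Longrightarrow> k \<le> M \<Longrightarrow> A j \<subseteq> A k"
    and half: "measure \<nu> (A M) \<le> 1 / 2"
    and UNIV: "space \<nu> = UNIV"
  obtains f where "superharmonic \<nu> f" "f [] \<le> ennreal (4 * exp (\<theta>\<^sup>2 * n / 2))"
    "\<And>zs k. length zs \<le> n \<Longrightarrow> k \<le> M \<Longrightarrow>
      ennreal (exp (\<theta> * (\<Sum>z\<leftarrow>zs. (indicator (A k) z - measure \<nu> (A k)) / (1 - measure \<nu> (A k))))) \<le> f zs"
proof -
  interpret prob_space \<nu> by fact
  \<comment> \<open>The letter of \<open>z\<close> is the first index whose set contains it,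
    \<open>Suc M\<close> if there is none, so that \<open>A k\<close> becomes the event of a letter
    at most \<open>k\<close>.\<close>
  define c where "c z = (if z \<in> A M then LEAST k. z \<in> A k else Suc M)" for z
  define C where "C j = (if j \<le> M then A j else UNIV) - (if j = 0 then {} else A (j - 1))" for j
  define p where "p j = measure \<nu> (C j)" for j
  define P where "P k = measure \<nu> (A k)" for k
  have c_le: "c z \<le> k \<longleftrightarrow> z \<in> A k" if "k \<le> M" for z k
  proof
    assume "c z \<le> k"
    then have "z \<in> A M" and "(LEAST k. z \<in> A k) \<le> k"
      using that by (auto simp: c_def split: if_splits)
    moreover from this(1) have "z \<in> A (LEAST k. z \<in> A k)"
      by (rule LeastI)
    ultimately show "z \<in> A k"
      using mono that by blast
  next
    assume "z \<in> A k"
    moreover from this have "z \<in> A M"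
      using mono that by blast
    ultimately show "c z \<le> k"
      by (simp add: c_def Least_le)
  qed
  have c_bound: "c z \<le> Suc M" for z
    using c_le[of M z] by (cases "z \<in> A M") (auto simp: c_def)
  have C_iff: "z \<in> C j \<longleftrightarrow> c z = j" if "j \<le> Suc M" for z j
  proof -
    have "j \<le> M \<or> j = Suc M" using that by auto
    then show ?thesis
      using c_le[of j z] c_le[of "j - 1" z] c_bound[of z] by (cases j) (auto simp: C_def)
  qed
  have C_sets [measurable]: "C j \<in> sets \<nu>" if "j \<le> Suc M" for j
    using A that sets.top[of \<nu>] UNIV by (auto simp: C_def)
  have C_Un: "(\<Union>j\<le>k. C j) = (if k \<le> M then A k else UNIV)" if "k \<le> Suc M" for k
    using that C_iff c_le[of k] c_bound by (auto simp: le_Suc_eq)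
  have p_sum: "sum p {..k} = measure \<nu> (if k \<le> M then A k else UNIV)" if "k \<le> Suc M" for k
  proof -
    have "disjoint_family_on C {..k}"
      using that C_iff by (fastforce simp: disjoint_family_on_def)
    then have "measure \<nu> (\<Union>j\<le>k. C j) = sum p {..k}"
      using that C_sets unfolding p_def by (intro finite_measure_finite_Union) auto
    then show ?thesis using C_Un[OF that] by simp
  qed
  have pP: "\<And>y. y \<le> Suc M \<Longrightarrow> 0 \<le> p y" "sum p {..Suc M} = 1" "\<And>k. k \<le> M \<Longrightarrow> P k = sum p {..k}" "P M \<le> 1 / 2"
    using p_sum[of "Suc M"] p_sum half prob_space UNIV by (auto simp: p_def P_def)
  have nn: "(\<lambda>z. ennreal (g (c z))) \<in> borel_measurable \<nu> \<and>
      (\<integral>\<^sup>+z. ennreal (g (c z)) \<partial>\<nu>) = ennreal (\<Sum>y\<le>Suc M. p y * g y)"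
    if g: "\<And>y. 0 \<le> g y" for g
  proof -
    have eq: "ennreal (g (c z)) = (\<Sum>j\<le>Suc M. ennreal (g j) * indicator (C j) z)" for z
    proof -
      have "(\<Sum>j\<le>Suc M. ennreal (g j) * indicator (C j) z) = (\<Sum>j\<le>Suc M. if j = c z then ennreal (g j) else 0)"
        using C_iff by (intro sum.cong) (auto simp: indicator_def)
      then show ?thesis using c_bound[of z] by simp
    qed
    have "(\<lambda>z. \<Sum>j\<le>Suc M. ennreal (g j) * indicator (C j) z) \<in> borel_measurable \<nu>"
      using C_sets by (intro borel_measurable_sum borel_measurable_times_ennreal borel_measurable_indicator) auto
    moreover have "(\<integral>\<^sup>+z. (\<Sum>j\<le>Suc M. ennreal (g j) * indicator (C j) z) \<partial>\<nu>) =
        (\<Sum>j\<le>Suc M. \<integral>\<^sup>+z. ennreal (g j) * indicator (C j) z \<partial>\<nu>)"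
      using C_sets by (intro nn_integral_sum borel_measurable_times_ennreal borel_measurable_indicator) auto
    moreover have "\<dots> = (\<Sum>j\<le>Suc M. ennreal (p j * g j))"
      using C_sets g by (intro sum.cong)
        (auto simp: nn_integral_cmult_indicator emeasure_eq_measure p_def ennreal_mult mult.commute)
    moreover have "\<dots> = ennreal (\<Sum>y\<le>Suc M. p y * g y)"
      using g by (intro sum_ennreal) (auto simp: p_def)
    ultimately show ?thesis
      unfolding eq by (simp del: sum.atMost_Suc)
  qed
  define G where "G zs = (running_max (\<lambda>k. prod_list (map (\<lambda>y. exp (\<theta> / 2 * normalized_step P k y)) zs)) M)\<^sup>2" for zs
  define V where "V cs = expn (Suc M) p (n - length cs) (\<lambda>ws. G (cs @ ws))" for cs
  define f where "f zs = ennreal (V (take n (map c zs)))" for zs :: "real list"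
  have V_nonneg: "0 \<le> V cs" for cs
    unfolding V_def G_def using pP(1) by (intro expn_nonneg) auto
  have "superharmonic \<nu> f"
  proof (rule superharmonicI)
    fix zs :: "real list"
    consider "length zs < n" | "n \<le> length zs" by linarith
    then have "(\<lambda>y. f (zs @ [y])) \<in> borel_measurable \<nu> \<and> (\<integral>\<^sup>+y. f (zs @ [y]) \<partial>\<nu>) \<le> f zs"
    proof cases
      case 1
      have *: "f (zs @ [y]) = ennreal (V (map c zs @ [c y]))" for y
        using 1 by (simp add: f_def)
      \<comment> \<open>The next real observation has a letter with the same law as the first of the
        missing letters, so the value is preserved on average.\<close>
      have "n - length zs = Suc (n - Suc (length zs))"
        using 1 by simp
      then have "V (map c zs) = (\<Sum>y\<le>Suc M. p y * V (map c zs @ [y]))"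
        by (simp add: V_def del: sum.atMost_Suc)
      then show ?thesis
        unfolding * using nn[of "\<lambda>j. V (map c zs @ [j])"] V_nonneg 1 by (simp add: f_def)
    next
      case 2
      then have "f (zs @ [y]) = f zs" for y
        by (simp add: f_def)
      then show ?thesis by (simp add: emeasure_space_1)
    qed
    then show "(\<lambda>y. f (zs @ [y])) \<in> borel_measurable \<nu>" "(\<integral>\<^sup>+y. f (zs @ [y]) \<partial>\<nu>) \<le> f zs" by auto
  qed
  moreover have "f [] \<le> ennreal (4 * exp (\<theta>\<^sup>2 * n / 2))"
    using expn_chain_le[OF pP, of n \<theta>] by (auto simp: f_def V_def G_def intro!: ennreal_leI)
  moreover have "ennreal (exp (\<theta> * (\<Sum>z\<leftarrow>zs. (indicator (A k) z - measure \<nu> (A k)) / (1 - measure \<nu> (A k))))) \<le> f zs"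
    if "length zs \<le> n" "k \<le> M" for zs k
  proof -
    let ?e = "\<lambda>ws. exp (\<theta> * (\<Sum>y\<leftarrow>ws. normalized_step P k y))"
    have P1: "P k \<noteq> 1"
      using P_bounds[OF pP that(2)] by auto
    have "(indicator (A k) z - P k) / (1 - P k) = normalized_step P k (c z)" for z
      using c_le[OF that(2), of z] P1 by (simp add: normalized_step_def)
    then have "(\<Sum>z\<leftarrow>zs. (indicator (A k) z - P k) / (1 - P k)) = (\<Sum>y\<leftarrow>map c zs. normalized_step P k y)"
      by (simp add: comp_def)
    moreover have "?e (map c zs) \<le> V (map c zs)"
    proof -
      \<comment> \<open>Each letter not yet drawn contributes a mean factor of at least 1, so the
        exponential of the observed part lies below an average over full words of length
        \<open>n\<close>.\<close>
      have "?e (map c zs) * 1 \<le> ?e (map c zs) * (\<Sum>y\<le>Suc M. p y * exp (\<theta> * normalized_step P k y)) ^ (n - length zs)"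
        using normalized_step_mgf_ge[OF pP that(2), of \<theta>] by (intro mult_left_mono one_le_power) auto
      also have "\<dots> = expn (Suc M) p (n - length zs) (\<lambda>ws. ?e (map c zs) * prod_list (map (\<lambda>y. exp (\<theta> * normalized_step P k y)) ws))"
        by (simp add: expn_prod_list del: sum.atMost_Suc)
      also have "\<dots> \<le> V (map c zs)"
        unfolding V_def length_map
      proof (rule expn_mono)
        fix ws
        let ?U = "\<lambda>k. prod_list (map (\<lambda>y. exp (\<theta> / 2 * normalized_step P k y)) (map c zs @ ws))"
        have "?e (map c zs) * prod_list (map (\<lambda>y. exp (\<theta> * normalized_step P k y)) ws) = (?U k)\<^sup>2"
        proof -
          have "?U k = exp (\<theta> / 2 * sum_list (map (normalized_step P k) (map c zs @ ws)))"
            by (rule prod_list_exp_mult)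
          then have "(?U k)\<^sup>2 = exp (\<theta> * sum_list (map (normalized_step P k) (map c zs @ ws)))"
            by (simp only: exp_double[symmetric]) simp
          then show ?thesis
            by (simp only: prod_list_exp_mult map_append sum_list_append distrib_left exp_add)
        qed
        also have "\<dots> \<le> G (map c zs @ ws)"
          unfolding G_def
          by (intro power_mono running_max_ge that(2)) (auto intro!: mult_nonneg_nonneg prod_list_nonneg)
        finally show "?e (map c zs) * prod_list (map (\<lambda>y. exp (\<theta> * normalized_step P k y)) ws) \<le> G (map c zs @ ws)" .
      qed (use pP(1) in auto)
      finally show ?thesis by simp
    qed
    ultimately show ?thesis
      using that(1) by (auto simp: f_def P_def intro!: ennreal_leI)
  qed
  ultimately show ?thesis by (rule that)
qed

subsection \<open>Brackets of the cumulative distribution function\<close>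

definition ecdf :: "real list \<Rightarrow> real \<Rightarrow> real" where
  "ecdf zs x = real (length (filter (\<lambda>z. z \<le> x) zs)) / real (length zs)"

definition deviation_sum :: "real measure \<Rightarrow> real set \<Rightarrow> real list \<Rightarrow> real" where
  "deviation_sum \<nu> B zs = (\<Sum>z\<leftarrow>zs. indicator B z - measure \<nu> B)"

text \<open>The half-line up to the \<open>q\<close>-quantile, closed here and open in
  \<open>quantile_open\<close>. The quantifier form avoids an infimum: it gives the whole line when
  no point reaches level \<open>q\<close>, and the empty set when the points of level
  \<open>q\<close> are unbounded below.\<close>

definition quantile_closed :: "real measure \<Rightarrow> real \<Rightarrow> real set" where
  "quantile_closed \<nu> q = {y. \<forall>x. q \<le> cdf \<nu> x \<longrightarrow> y \<le> x}"

definition quantile_open :: "real measure \<Rightarrow> real \<Rightarrow> real set" where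
  "quantile_open \<nu> q = {y. \<forall>x. q \<le> cdf \<nu> x \<longrightarrow> y < x}"

lemma quantile_mono:
  assumes "q \<le> q'"
  shows "quantile_closed \<nu> q \<subseteq> quantile_closed \<nu> q'" "quantile_open \<nu> q \<subseteq> quantile_open \<nu> q'"
  using assms by (auto simp: quantile_closed_def quantile_open_def intro: order_trans)

context real_distribution
begin

lemma quantile_open_eq: "quantile_open M q = {y. cdf M y < q}"
proof (intro set_eqI iffI)
  fix y
  assume "y \<in> quantile_open M q"
  then show "y \<in> {y. cdf M y < q}"
    by (force simp: quantile_open_def not_less[symmetric])
next
  fix y assume "y \<in> {y. cdf M y < q}"
  then have "cdf M y < cdf M x" if "q \<le> cdf M x" for x
    using that by simp
  then show "y \<in> quantile_open M q"
    unfolding quantile_open_def using cdf_nondecreasing by (force simp: not_le[symmetric])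
qed

lemma quantile_closed_sets: "quantile_closed M q \<in> sets borel"
proof -
  have "quantile_closed M q = (\<Inter>x\<in>{x. q \<le> cdf M x}. {..x})"
    by (auto simp: quantile_closed_def)
  also have "closed \<dots>"
    by (intro closed_INT) auto
  ultimately show ?thesis by simp
qed

lemma quantile_open_sets: "quantile_open M q \<in> sets borel"
proof -
  have "cdf M \<in> borel_measurable borel"
    by (intro borel_measurable_mono monoI cdf_nondecreasing)
  then show ?thesis
    unfolding quantile_open_eq by (simp add: borel_measurable_less)
qed

text \<open>By right continuity the cdf has reached \<open>q\<close> at the infimum of the points of
  level \<open>q\<close>. An atom there may push the mass above \<open>q\<close>.\<close>

lemma measure_quantile_closed_ge:
  assumes "q \<le> 1"
  shows "q \<le> measure M (quantile_closed M q)"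
proof (cases "q \<le> 0 \<or> {x. q \<le> cdf M x} = {}")
  case True
  moreover have "measure M (quantile_closed M q) = 1" if "{x. q \<le> cdf M x} = {}"
    using that prob_space by (simp add: quantile_closed_def)
  ultimately show ?thesis
    using assms order_trans[OF _ measure_nonneg] by auto
next
  case False
  define S where "S = {x. q \<le> cdf M x}"
  have ne: "S \<noteq> {}" and q: "0 < q"
    using False by (auto simp: S_def)
  have "eventually (\<lambda>x. cdf M x < q) at_bot"
    using cdf_lim_at_bot q by (rule order_tendstoD)
  then obtain l where l: "\<And>x. x \<le> l \<Longrightarrow> cdf M x < q"
    by (auto simp: eventually_at_bot_linorder)
  have bdd: "bdd_below S"
    using l by (intro bdd_belowI[of _ l]) (force simp: S_def not_less[symmetric])
  define x0 where "x0 = Inf S"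
  have "eventually (\<lambda>x. q \<le> cdf M x) (at_right x0)"
  proof -
    have "q \<le> cdf M x" if less: "x0 < x" for x
    proof -
      obtain x' where "x' \<in> S" "x' < x"
        using less cInf_lessD[OF ne, of x] by (auto simp: x0_def)
      then show ?thesis
        using cdf_nondecreasing[of x' x] by (auto simp: S_def)
    qed
    then show ?thesis
      by (auto simp: eventually_at_right_field intro: exI[of _ "x0 + 1"])
  qed
  moreover have "(cdf M \<longlongrightarrow> cdf M x0) (at_right x0)"
    using cdf_is_right_cont[of x0] by (simp add: continuous_within)
  ultimately have "q \<le> cdf M x0"
    by (intro tendsto_lowerbound[of "cdf M"]) auto
  also have "cdf M x0 \<le> measure M (quantile_closed M q)"
    unfolding cdf_def
  proof (rule finite_measure_mono)
    show "{..x0} \<subseteq> quantile_closed M q"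
      using bdd by (auto simp: quantile_closed_def x0_def S_def intro: order_trans[OF _ cInf_lower])
  qed (use quantile_closed_sets in auto)
  finally show ?thesis .
qed

text \<open>The left limit of the cdf at the quantile is at most \<open>q\<close>, as all smaller
  points lie below that level. Degenerate cases: a level never reached forces
  \<open>1 \<le> q\<close>, and points of level \<open>q\<close> unbounded below make the set
  empty.\<close>

lemma measure_quantile_open_le:
  assumes "0 \<le> q"
  shows "measure M (quantile_open M q) \<le> q"
proof -
  define S where "S = {x. q \<le> cdf M x}"
  consider "S = {}" | "S \<noteq> {}" "\<not> bdd_below S" | "S \<noteq> {}" "bdd_below S" by argo
  then show ?thesis
  proof cases
    case 1
    then have "cdf M x \<le> q" for x
      by (metis S_def empty_iff linear mem_Collect_eq)
    then have "1 \<le> q"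
      by (intro tendsto_upperbound[OF cdf_lim_at_top_prob]) auto
    then show ?thesis
      using prob_le_1 order_trans by blast
  next
    case 2
    have "\<exists>x. q \<le> cdf M x \<and> x < y" for y
      using 2(2) by (metis S_def bdd_belowI mem_Collect_eq not_le)
    then have "quantile_open M q = {}"
      unfolding quantile_open_def by (blast dest: less_asym)
    then show ?thesis using assms by simp
  next
    case 3
    define x0 where "x0 = Inf S"
    have less: "cdf M x < q" if "x < x0" for x
    proof (rule ccontr)
      assume "\<not> cdf M x < q"
      then have "x0 \<le> x"
        unfolding x0_def using 3 by (intro cInf_lower) (auto simp: S_def)
      with that show False by simp
    qed
    have "measure M (quantile_open M q) \<le> measure M {..<x0}"
    proof (rule finite_measure_mono)
      show "quantile_open M q \<subseteq> {..<x0}"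
      proof
        fix y assume y: "y \<in> quantile_open M q"
        have "cdf M y < q"
          using y by (simp add: quantile_open_eq)
        moreover have "(cdf M \<longlongrightarrow> cdf M y) (at_right y)"
          using cdf_is_right_cont[of y] by (simp add: continuous_within)
        ultimately have "eventually (\<lambda>x. cdf M x < q) (at_right y)"
          by (simp add: order_tendstoD)
        then obtain b where b: "y < b" "\<And>x. y < x \<Longrightarrow> x < b \<Longrightarrow> cdf M x < q"
          by (auto simp: eventually_at_right_field)
        have "(y + b) / 2 \<le> x" if "x \<in> S" for x
        proof (rule ccontr)
          assume "\<not> (y + b) / 2 \<le> x"
          then have "x < b" using b(1) by simp
          moreover have "y < x"
            using y that by (auto simp: quantile_open_def S_def)
          ultimately show False
            using b(2)[of x] that by (simp add: S_def)
        qed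
        then have "(y + b) / 2 \<le> x0"
          unfolding x0_def using 3 by (intro cInf_greatest) auto
        then show "y \<in> {..<x0}" using b(1) by simp
      qed
    qed auto
    also have "\<dots> \<le> q"
      using less by (intro tendsto_upperbound[OF cdf_at_left])
        (auto simp: eventually_at_left_field intro!: exI[of _ "x0 - 1"] less_imp_le)
    finally show ?thesis .
  qed
qed

lemma deviation_sum_atMost: "deviation_sum M {..x} zs = real (length zs) * (ecdf zs x - cdf M x)"
proof -
  have "deviation_sum M {..x} zs = real (length (filter (\<lambda>z. z \<le> x) zs)) - real (length zs) * cdf M x"
    by (induction zs) (auto simp: deviation_sum_def cdf_def algebra_simps)
  then show ?thesis
    by (cases "zs = []") (auto simp: ecdf_def right_diff_distrib)
qed

text \<open>Only the centring can go the wrong way, by the difference of the two masses per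
  entry.\<close>

lemma deviation_sum_mono:
  assumes "B \<subseteq> B'"
  shows "deviation_sum M B zs \<le> deviation_sum M B' zs + real (length zs) * (measure M B' - measure M B)"
proof (induction zs)
  case (Cons z zs)
  have "indicator B z \<le> (indicator B' z :: real)"
    using assms by (auto simp: indicator_def)
  with Cons show ?case
    by (simp add: deviation_sum_def algebra_simps)
qed (simp add: deviation_sum_def)

text \<open>With \<open>k / m \<le> cdf M x < (k + 1) / m\<close>, the half-line up to
  \<open>x\<close> lies between the closed quantile set at the lower level and the open one at the
  upper level. Closed below and open above is the choice for which atoms cannot spoil the comparison
  of masses within \<open>1 / m\<close>. If \<open>cdf M x = 1\<close>, the upper level exceeds 1
  and its set is the whole line.\<close>

lemma ecdf_bracket:
  fixes m :: nat
  assumes m: "0 < m"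
  obtains k where "k \<le> m"
    "real (length zs) * (ecdf zs x - cdf M x - 1 / m) \<le> deviation_sum M (quantile_open M (real (Suc k) / m)) zs"
    "real (length zs) * (cdf M x - ecdf zs x - 1 / m) \<le> - deviation_sum M (quantile_closed M (k / m)) zs"
proof -
  define k where "k = nat \<lfloor>m * cdf M x\<rfloor>"
  have nonneg: "0 \<le> m * cdf M x"
    using cdf_nonneg[of x] by simp
  then have "real k = real_of_int \<lfloor>m * cdf M x\<rfloor>"
    by (simp add: k_def)
  then have k1: "k \<le> m * cdf M x" and k2: "m * cdf M x < k + 1"
    by linarith+
  have "real k \<le> m * 1"
    using k1 mult_left_mono[OF cdf_bounded_prob[of x], of "real m"] by linarith
  then have km: "k \<le> m" by simp
  have low: "k / m \<le> cdf M x" and up: "cdf M x < real (Suc k) / m"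
    using k1 k2 m by (auto simp: field_simps)
  have Suc_div: "real (Suc k) / m = k / m + 1 / m"
    by (simp add: add_divide_distrib)
  have "{..x} \<subseteq> quantile_open M (real (Suc k) / m)"
    unfolding quantile_open_eq using up cdf_nondecreasing by (force intro: le_less_trans)
  from deviation_sum_mono[OF this, of zs]
  have "real (length zs) * (ecdf zs x - cdf M x) \<le> deviation_sum M (quantile_open M (real (Suc k) / m)) zs
      + real (length zs) * (measure M (quantile_open M (real (Suc k) / m)) - cdf M x)"
    unfolding deviation_sum_atMost by (simp add: cdf_def)
  also have "real (length zs) * (measure M (quantile_open M (real (Suc k) / m)) - cdf M x) \<le> real (length zs) * (1 / m)"
    using measure_quantile_open_le[of "real (Suc k) / m"] low Suc_div
    by (intro mult_left_mono) auto
  finally have 1: "real (length zs) * (ecdf zs x - cdf M x - 1 / m) \<le> deviation_sum M (quantile_open M (real (Suc k) / m)) zs"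
    by (simp add: right_diff_distrib)
  have "quantile_closed M (k / m) \<subseteq> {..x}"
    using low by (auto simp: quantile_closed_def)
  from deviation_sum_mono[OF this, of zs]
  have "deviation_sum M (quantile_closed M (k / m)) zs \<le> real (length zs) * (ecdf zs x - cdf M x)
      + real (length zs) * (cdf M x - measure M (quantile_closed M (k / m)))"
    unfolding deviation_sum_atMost by (simp add: cdf_def)
  also have "real (length zs) * (cdf M x - measure M (quantile_closed M (k / m))) \<le> real (length zs) * (1 / m)"
    using measure_quantile_closed_ge[of "k / m"] up km m Suc_div
    by (intro mult_left_mono) auto
  finally have 2: "real (length zs) * (cdf M x - ecdf zs x - 1 / m) \<le> - deviation_sum M (quantile_closed M (k / m)) zs"
    by (simp add: right_diff_distrib)
  from km 1 2 show ?thesis by (rule that)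
qed

end

text \<open>The product stops after \<open>N\<close> entries, so on every longer list it still
  reports its value at sample size \<open>N\<close>, and a data-dependent final length does no
  harm.\<close>

lemma superharmonic_take_prod:
  assumes [measurable]: "g \<in> borel_measurable \<nu>" and le1: "(\<integral>\<^sup>+y. g y \<partial>\<nu>) \<le> 1" and "prob_space \<nu>"
  shows "superharmonic \<nu> (\<lambda>zs. prod_list (map g (take N zs)))"
proof (rule superharmonicI)
  interpret prob_space \<nu> by fact
  fix zs :: "real list"
  let ?f = "\<lambda>zs. prod_list (map g (take N zs))"
  consider "length zs < N" | "N \<le> length zs" by linarith
  then have "(\<lambda>y. ?f (zs @ [y])) \<in> borel_measurable \<nu> \<and> (\<integral>\<^sup>+y. ?f (zs @ [y]) \<partial>\<nu>) \<le> ?f zs"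
  proof cases
    case 1
    then have eq: "?f (zs @ [y]) = ?f zs * g y" for y
      by simp
    show ?thesis
      unfolding eq using mult_left_mono[OF le1, of "?f zs"] by (simp add: nn_integral_cmult)
  qed (simp add: emeasure_space_1)
  then show "(\<lambda>y. ?f (zs @ [y])) \<in> borel_measurable \<nu>" "(\<integral>\<^sup>+y. ?f (zs @ [y]) \<partial>\<nu>) \<le> ?f zs"
    by auto
qed

section \<open>Exponential bounds over quantile sets: one sample size, then all sizes at
  once\<close>

context real_distribution
begin

lemma nn_integral_exp_indicator_le:
  assumes "B \<in> sets borel"
  shows "(\<integral>\<^sup>+z. ennreal (exp (s * (indicator B z - measure M B) - s\<^sup>2 / 8)) \<partial>M) \<le> 1"
proof -
  define p where "p = measure M B"
  have p: "0 \<le> p" "p \<le> 1" and [measurable]: "B \<in> sets M"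
    using assms by (auto simp: p_def)
  define u v where "u = exp (s * (1 - p) - s\<^sup>2 / 8)" and "v = exp (- (s * p) - s\<^sup>2 / 8)"
  have "(\<integral>\<^sup>+z. ennreal (exp (s * (indicator B z - p) - s\<^sup>2 / 8)) \<partial>M) =
      (\<integral>\<^sup>+z. ennreal u * indicator B z + ennreal v * indicator (space M - B) z \<partial>M)"
    by (intro nn_integral_cong) (auto simp: indicator_def u_def v_def)
  also have "\<dots> = ennreal u * ennreal p + ennreal v * ennreal (1 - p)"
    using prob_compl[of B] assms
    by (subst nn_integral_add) (auto simp: nn_integral_cmult_indicator emeasure_eq_measure p_def)
  also have "\<dots> = ennreal (u * p + v * (1 - p))"
    using p by (simp add: u_def v_def ennreal_mult ennreal_plus)
  also have "\<dots> \<le> ennreal 1"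
  proof (rule ennreal_leI)
    have "u * p + v * (1 - p) = (p * exp (s * (1 - p)) + (1 - p) * exp (- (s * p))) * exp (- (s\<^sup>2 / 8))"
      unfolding u_def v_def diff_conv_add_uminus[of _ "s\<^sup>2 / 8"] exp_add by (simp add: algebra_simps)
    also have "\<dots> \<le> exp (s\<^sup>2 / 8) * exp (- (s\<^sup>2 / 8))"
      using p by (intro mult_right_mono two_point_mgf_le) auto
    also have "\<dots> = 1"
      by (simp flip: exp_add)
    finally show "u * p + v * (1 - p) \<le> 1" .
  qed
  finally show ?thesis
    by (simp add: p_def)
qed

lemma superharmonic_exp_deviation:
  assumes "B \<in> sets borel"
  obtains f where "superharmonic M f" "f [] = ennreal c"
    "\<And>zs. N \<le> length zs \<Longrightarrow>
      f zs = ennreal c * ennreal (exp (s * deviation_sum M B (take N zs) - N * (s\<^sup>2 / 8)))"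
proof -
  define g where "g z = ennreal (exp (s * (indicator B z - measure M B) - s\<^sup>2 / 8))" for z
  let ?f = "\<lambda>zs. ennreal c * prod_list (map g (take N zs))"
  have "superharmonic M (\<lambda>zs. prod_list (map g (take N zs)))"
  proof (rule superharmonic_take_prod)
    have [measurable]: "B \<in> sets M" using assms by simp
    show "g \<in> borel_measurable M"
      unfolding g_def by measurable
    show "(\<integral>\<^sup>+y. g y \<partial>M) \<le> 1"
      unfolding g_def by (rule nn_integral_exp_indicator_le[OF assms])
  qed unfold_locales
  then have "superharmonic M ?f"
    by (rule superharmonic_cmult)
  moreover have "?f [] = ennreal c"
    by simp
  moreover have "prod_list (map g zs) = ennreal (exp (s * deviation_sum M B zs - length zs * (s\<^sup>2 / 8)))" for zs
    by (induction zs) (auto simp: g_def deviation_sum_def ennreal_mult[symmetric] exp_add[symmetric] algebra_simps add_divide_distrib)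
  then have "?f zs = ennreal c * ennreal (exp (s * deviation_sum M B (take N zs) - N * (s\<^sup>2 / 8)))"
    if "N \<le> length zs" for zs
    using that by simp
  ultimately show ?thesis by (rule that)
qed

text \<open>The parameter \<open>4 * \<epsilon>\<close> maximizes
  \<open>s * \<epsilon> - s^2 / 8\<close>, with value \<open>2 * \<epsilon>^2\<close>. A grid with
  \<open>m = 4 * N\<close> loses \<open>1 / m\<close> per entry, which adds exactly
  \<open>\<epsilon>\<close> to the exponent, and the \<open>2 * (4 * N + 1) \<le> 10 * N\<close>
  functions of the union bound give the prefactor.\<close>

lemma superharmonic_tail:
  fixes N :: nat and \<epsilon> :: real
  assumes N: "1 \<le> N" and \<epsilon>: "0 < \<epsilon>"
  obtains f where "superharmonic M f" "f [] \<le> ennreal (10 * real N * exp (\<epsilon> - 2 * real N * \<epsilon>\<^sup>2))"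
    "\<And>zs x. N \<le> length zs \<Longrightarrow> \<epsilon> < \<bar>ecdf (take N zs) x - cdf M x\<bar> \<Longrightarrow> 1 \<le> f zs"
proof -
  define m where "m = 4 * N"
  define c where "c = exp (\<epsilon> - 2 * real N * \<epsilon>\<^sup>2)"
  have m: "0 < m" and c0: "0 \<le> c" using N by (simp_all add: m_def c_def)
  \<comment> \<open>\<open>\<sigma>\<close> is the sign of the deviation; one computation serves
    both the open and the closed sets.\<close>
  have big: "1 \<le> ennreal c * ennreal (exp (s * w - N * (s\<^sup>2 / 8)))"
    if "N * (\<epsilon> - 1 / m) \<le> \<sigma> * w" "s = 4 * \<epsilon> * \<sigma>" "\<sigma>\<^sup>2 = 1" for \<sigma> w s :: real
  proof -
    have "4 * \<epsilon> * (N * (\<epsilon> - 1 / m)) \<le> 4 * \<epsilon> * (\<sigma> * w)"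
      using \<epsilon> that(1) by (intro mult_left_mono) auto
    moreover have "4 * \<epsilon> * (N * (\<epsilon> - 1 / m)) = 4 * real N * \<epsilon>\<^sup>2 - \<epsilon>"
      using N by (simp add: m_def field_simps power2_eq_square)
    moreover have "s * w = 4 * \<epsilon> * (\<sigma> * w)"
      using that(2) by simp
    moreover have "s\<^sup>2 / 8 = 2 * \<epsilon>\<^sup>2"
      using that(2,3) by (simp add: power_mult_distrib)
    then have "N * (s\<^sup>2 / 8) = 2 * real N * \<epsilon>\<^sup>2"
      by simp
    ultimately have "0 \<le> \<epsilon> - 2 * real N * \<epsilon>\<^sup>2 + (s * w - N * (s\<^sup>2 / 8))"
      using \<open>s * w = 4 * \<epsilon> * (\<sigma> * w)\<close> by linarith
    then have "1 \<le> exp (\<epsilon> - 2 * real N * \<epsilon>\<^sup>2 + (s * w - N * (s\<^sup>2 / 8)))"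
      by simp
    then show ?thesis
      unfolding c_def ennreal_mult[symmetric, OF exp_ge_zero exp_ge_zero] exp_add[symmetric]
      by (simp add: ennreal_ge_1)
  qed
  have "\<exists>f. superharmonic M f \<and> f [] = ennreal c \<and> (\<forall>zs. N \<le> length zs \<longrightarrow>
      f zs = ennreal c * ennreal (exp ((4 * \<epsilon>) * deviation_sum M (quantile_open M (real (Suc k) / m)) (take N zs) - N * ((4 * \<epsilon>)\<^sup>2 / 8))))" for k
    by (rule superharmonic_exp_deviation[OF quantile_open_sets, of c N "4 * \<epsilon>" "real (Suc k) / m"]) blast
  then obtain f where f: "\<And>k. superharmonic M (f k)" "\<And>k. f k [] = ennreal c"
    "\<And>k zs. N \<le> length zs \<Longrightarrow>
      f k zs = ennreal c * ennreal (exp ((4 * \<epsilon>) * deviation_sum M (quantile_open M (real (Suc k) / m)) (take N zs) - N * ((4 * \<epsilon>)\<^sup>2 / 8)))"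
    by metis
  have "\<exists>g. superharmonic M g \<and> g [] = ennreal c \<and> (\<forall>zs. N \<le> length zs \<longrightarrow>
      g zs = ennreal c * ennreal (exp ((- 4 * \<epsilon>) * deviation_sum M (quantile_closed M (k / m)) (take N zs) - N * ((- 4 * \<epsilon>)\<^sup>2 / 8))))" for k :: nat
    by (rule superharmonic_exp_deviation[OF quantile_closed_sets, of c N "- 4 * \<epsilon>" "k / m"]) blast
  then obtain g where g: "\<And>k. superharmonic M (g k)" "\<And>k. g k [] = ennreal c"
    "\<And>k zs. N \<le> length zs \<Longrightarrow>
      g k zs = ennreal c * ennreal (exp ((- 4 * \<epsilon>) * deviation_sum M (quantile_closed M (real k / m)) (take N zs) - N * ((- 4 * \<epsilon>)\<^sup>2 / 8)))"
    by metis
  let ?f = "\<lambda>zs. \<Sum>k\<le>m. f k zs + g k zs"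
  have "superharmonic M ?f"
    by (intro superharmonic_sum superharmonic_add f g)
  moreover have "?f [] \<le> ennreal (10 * real N * exp (\<epsilon> - 2 * real N * \<epsilon>\<^sup>2))"
  proof -
    have "?f [] = of_nat (Suc m) * (ennreal c + ennreal c)"
      by (simp add: f g)
    also have "\<dots> = ennreal (real (Suc m)) * ennreal (c + c)"
      using c0 by (simp only: ennreal_of_nat_eq_real_of_nat ennreal_plus)
    also have "\<dots> = ennreal (real (Suc m) * (c + c))"
      using c0 by (intro ennreal_mult[symmetric]) auto
    also have "\<dots> \<le> ennreal (10 * real N * c)"
      using N by (intro ennreal_leI) (auto simp: m_def c_def algebra_simps)
    finally show ?thesis by (simp add: c_def)
  qed
  moreover have "1 \<le> ?f zs" if zs: "N \<le> length zs" and x: "\<epsilon> < \<bar>ecdf (take N zs) x - cdf M x\<bar>" for zs x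
  proof -
    obtain k where k: "k \<le> m"
      and up: "real (length (take N zs)) * (ecdf (take N zs) x - cdf M x - 1 / m) \<le>
        deviation_sum M (quantile_open M (real (Suc k) / m)) (take N zs)"
      and low: "real (length (take N zs)) * (cdf M x - ecdf (take N zs) x - 1 / m) \<le>
        - deviation_sum M (quantile_closed M (real k / m)) (take N zs)"
      using ecdf_bracket[OF m, of "take N zs" x] by blast
    have len: "real (length (take N zs)) = N"
      using zs by simp
    have "1 \<le> f k zs \<or> 1 \<le> g k zs"
    proof (cases "ecdf (take N zs) x - cdf M x \<ge> 0")
      case True
      then have "N * (\<epsilon> - 1 / m) \<le> N * (ecdf (take N zs) x - cdf M x - 1 / m)"
        using x by (intro mult_left_mono) auto
      then show ?thesis
        unfolding f(3)[OF zs] using up unfolding len by (intro disjI1 big[of 1]) auto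
    next
      case False
      then have "N * (\<epsilon> - 1 / m) \<le> N * (cdf M x - ecdf (take N zs) x - 1 / m)"
        using x by (intro mult_left_mono) auto
      then show ?thesis
        unfolding g(3)[OF zs] using low unfolding len by (intro disjI2 big[of "-1"]) auto
    qed
    then have "1 \<le> f k zs + g k zs"
      using le_iff_add by (auto intro: order_trans add_increasing add_increasing2)
    also have "\<dots> \<le> ?f zs"
      using k by (intro member_le_sum) auto
    finally show ?thesis .
  qed
  ultimately show ?thesis by (rule that)
qed

lemma deviation_sum_compl:
  assumes "B \<in> sets borel"
  shows "deviation_sum M (- B) zs = - deviation_sum M B zs"
proof -
  have "measure M (- B) = 1 - measure M B"
    using prob_compl[of B] assms by (simp add: Compl_eq_Diff_UNIV)
  then show ?thesis
    by (induction zs) (auto simp: deviation_sum_def indicator_def)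
qed

text \<open>Prepending the empty set adds an index with deviation 0, so \<open>f\<close> is at least
  1, which settles nonpositive exponents. A positive exponent only grows when divided by
  \<open>1 - measure M (A k)\<close>, so the normalized estimate covers it.\<close>

lemma superharmonic_half_chain:
  fixes A :: "nat \<Rightarrow> real set"
  assumes A: "\<And>k. k < J \<Longrightarrow> A k \<in> sets borel"
    and mono: "\<And>j k. j \<le> k \<Longrightarrow> k < J \<Longrightarrow> A j \<subseteq> A k"
    and half: "\<And>k. k < J \<Longrightarrow> measure M (A k) \<le> 1 / 2"
  obtains f where "superharmonic M f" "f [] \<le> ennreal (4 * exp (\<theta>\<^sup>2 * n / 2))"
    "\<And>zs. length zs \<le> n \<Longrightarrow> 1 \<le> f zs"
    "\<And>zs k. length zs \<le> n \<Longrightarrow> k < J \<Longrightarrow> ennreal (exp (\<theta> * deviation_sum M (A k) zs)) \<le> f zs"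
proof -
  define A' where "A' k = (if k = 0 then {} else A (k - 1))" for k
  have "\<exists>f. superharmonic M f \<and> f [] \<le> ennreal (4 * exp (\<theta>\<^sup>2 * n / 2)) \<and>
    (\<forall>zs k. length zs \<le> n \<longrightarrow> k \<le> J \<longrightarrow>
      ennreal (exp (\<theta> * (\<Sum>z\<leftarrow>zs. (indicator (A' k) z - measure M (A' k)) / (1 - measure M (A' k))))) \<le> f zs)"
  proof (rule superharmonic_chain[of M J A' \<theta> n])
    show "A' k \<in> sets M" if "k \<le> J" for k
      using that A by (auto simp: A'_def)
    show "A' j \<subseteq> A' k" if "j \<le> k" "k \<le> J" for j k
      using that mono[of "j - 1" "k - 1"] by (auto simp: A'_def)
    show "measure M (A' J) \<le> 1 / 2"
      using half by (auto simp: A'_def)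
  qed (auto intro: prob_space_axioms)
  then obtain f where f: "superharmonic M f" "f [] \<le> ennreal (4 * exp (\<theta>\<^sup>2 * n / 2))"
    and ge: "\<And>zs k. length zs \<le> n \<Longrightarrow> k \<le> J \<Longrightarrow>
      ennreal (exp (\<theta> * (\<Sum>z\<leftarrow>zs. (indicator (A' k) z - measure M (A' k)) / (1 - measure M (A' k))))) \<le> f zs"
    by blast
  have ge1: "1 \<le> f zs" if "length zs \<le> n" for zs
    using ge[OF that, of 0] by (simp add: A'_def)
  have "ennreal (exp (\<theta> * deviation_sum M (A k) zs)) \<le> f zs" if zs: "length zs \<le> n" and k: "k < J" for zs k
  proof (cases "\<theta> * deviation_sum M (A k) zs \<le> 0")
    case True
    then have "ennreal (exp (\<theta> * deviation_sum M (A k) zs)) \<le> ennreal 1"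
      by (intro ennreal_leI) simp
    then show ?thesis
      unfolding ennreal_1 by (rule order_trans[OF _ ge1[OF zs]])
  next
    case False
    let ?p = "measure M (A k)"
    have "?p \<le> 1 / 2" "0 \<le> ?p"
      using half[OF k] by auto
    then have "\<theta> * deviation_sum M (A k) zs \<le> (\<theta> * deviation_sum M (A k) zs) / (1 - ?p)"
      using False by (simp add: pos_le_divide_eq mult_le_cancel_left1 right_diff_distrib)
    also have "deviation_sum M (A k) zs / (1 - ?p) = (\<Sum>z\<leftarrow>zs. (indicator (A k) z - ?p) / (1 - ?p))"
      unfolding deviation_sum_def by (induction zs) (auto simp: add_divide_distrib)
    then have "(\<theta> * deviation_sum M (A k) zs) / (1 - ?p) = \<theta> * (\<Sum>z\<leftarrow>zs. (indicator (A k) z - ?p) / (1 - ?p))"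
      by (metis times_divide_eq_right)
    finally have "ennreal (exp (\<theta> * deviation_sum M (A k) zs)) \<le>
        ennreal (exp (\<theta> * (\<Sum>z\<leftarrow>zs. (indicator (A k) z - ?p) / (1 - ?p))))"
      by (intro ennreal_leI) simp
    also have "\<dots> \<le> f zs"
      using ge[OF zs, of "Suc k"] k by (simp add: A'_def)
    finally show ?thesis .
  qed
  with f ge1 show ?thesis by (intro that)
qed

text \<open>The chain is split at measure one half, with complements above the split, to keep the
  normalization \<open>1 / (1 - P)\<close> bounded by \<open>2\<close>.\<close>

lemma superharmonic_deviation_chain:
  fixes B :: "nat \<Rightarrow> real set"
  assumes B: "\<And>k. k \<le> m \<Longrightarrow> B k \<in> sets borel"
    and mono: "\<And>j k. j \<le> k \<Longrightarrow> k \<le> m \<Longrightarrow> B j \<subseteq> B k"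
  obtains f where "superharmonic M f" "f [] \<le> ennreal (8 * exp (\<theta>\<^sup>2 * n / 2))"
    "\<And>zs. length zs \<le> n \<Longrightarrow> 1 \<le> f zs"
    "\<And>zs k. length zs \<le> n \<Longrightarrow> k \<le> m \<Longrightarrow> ennreal (exp (\<theta> * deviation_sum M (B k) zs)) \<le> f zs"
proof -
  define J where "J = (LEAST k. m < k \<or> 1 / 2 < measure M (B k))"
  have J: "m < J \<or> 1 / 2 < measure M (B J)"
    unfolding J_def by (rule LeastI[of _ "Suc m"]) simp
  have J_le: "J \<le> Suc m"
    unfolding J_def by (rule Least_le) simp
  have low: "k \<le> m \<and> measure M (B k) \<le> 1 / 2" if "k < J" for k
    using not_less_Least[OF that[unfolded J_def]] by auto
  have high: "1 / 2 < measure M (B k)" if "J \<le> k" "k \<le> m" for k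
  proof -
    have "measure M (B J) \<le> measure M (B k)"
      using that B mono by (intro finite_measure_mono) auto
    then show ?thesis using J that by auto
  qed
  obtain f where f: "superharmonic M f" "f [] \<le> ennreal (4 * exp (\<theta>\<^sup>2 * n / 2))"
    "\<And>zs. length zs \<le> n \<Longrightarrow> 1 \<le> f zs"
    "\<And>zs k. length zs \<le> n \<Longrightarrow> k < J \<Longrightarrow> ennreal (exp (\<theta> * deviation_sum M (B k) zs)) \<le> f zs"
    using superharmonic_half_chain[of J B \<theta> n] low B mono by blast
  have compl: "measure M (- B k) \<le> 1 / 2" if "J \<le> k" "k \<le> m" for k
    using prob_compl[of "B k"] high[OF that] B[OF that(2)] by (simp add: Compl_eq_Diff_UNIV)
  \<comment> \<open>Complements reverse inclusions, hence the index \<open>m - k\<close>, and change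
    the sign of the deviation, hence \<open>- \<theta>\<close>.\<close>
  obtain g where g: "superharmonic M g" "g [] \<le> ennreal (4 * exp ((- \<theta>)\<^sup>2 * n / 2))"
    "\<And>zs k. length zs \<le> n \<Longrightarrow> k < Suc m - J \<Longrightarrow> ennreal (exp (- \<theta> * deviation_sum M (- B (m - k)) zs)) \<le> g zs"
  proof (rule superharmonic_half_chain[of "Suc m - J" "\<lambda>k. - B (m - k)" "- \<theta>" n])
    show "- B (m - k) \<in> sets borel" if "k < Suc m - J" for k
      using B[of "m - k"] by auto
    show "- B (m - j) \<subseteq> - B (m - k)" if "j \<le> k" "k < Suc m - J" for j k
      using that mono[of "m - k" "m - j"] by auto
    show "measure M (- B (m - k)) \<le> 1 / 2" if "k < Suc m - J" for k
      using that by (intro compl) auto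
  qed blast
  have "superharmonic M (\<lambda>zs. f zs + g zs)"
    by (intro superharmonic_add f g)
  moreover have "f [] + g [] \<le> ennreal (8 * exp (\<theta>\<^sup>2 * n / 2))"
  proof -
    have "f [] + g [] \<le> ennreal (4 * exp (\<theta>\<^sup>2 * n / 2)) + ennreal (4 * exp (\<theta>\<^sup>2 * n / 2))"
      using f(2) g(2) by (intro add_mono) auto
    then show ?thesis by (simp flip: ennreal_plus)
  qed
  moreover have "1 \<le> f zs + g zs" if "length zs \<le> n" for zs
    using f(3)[OF that] by (simp add: add_increasing2)
  moreover have "ennreal (exp (\<theta> * deviation_sum M (B k) zs)) \<le> f zs + g zs"
    if zs: "length zs \<le> n" and k: "k \<le> m" for zs k
  proof (cases "k < J")
    case True
    then show ?thesis using f(4)[OF zs] by (simp add: add_increasing2)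
  next
    case False
    then show ?thesis
      using g(3)[OF zs, of "m - k"] k B[OF k] by (simp add: deviation_sum_compl add_increasing)
  qed
  ultimately show ?thesis by (rule that)
qed

text \<open>One function serves all thresholds \<open>x\<close>. Its value at \<open>[]\<close>
  collects two chains worth 8 each, open sets for positive and closed sets for negative deviations;
  unlike a union bound over the grid, it does not grow with \<open>m\<close>.\<close>

lemma superharmonic_sup_deviation:
  fixes m n :: nat and \<theta> :: real
  assumes m: "0 < m" and l: "0 \<le> \<theta>"
  obtains f where "superharmonic M f" "f [] \<le> ennreal (16 * exp (\<theta>\<^sup>2 * n / 2))"
    "\<And>zs x. length zs \<le> n \<Longrightarrow>
       ennreal (exp (\<theta> * (length zs * (\<bar>ecdf zs x - cdf M x\<bar> - 1 / m)))) \<le> f zs"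
proof -
  have div_mono: "real j / m \<le> real k / m" if "j \<le> k" for j k
    using that by (intro divide_right_mono) auto
  obtain f where f: "superharmonic M f" "f [] \<le> ennreal (8 * exp (\<theta>\<^sup>2 * n / 2))"
    "\<And>zs k. length zs \<le> n \<Longrightarrow> k \<le> m \<Longrightarrow>
      ennreal (exp (\<theta> * deviation_sum M (quantile_open M (real (Suc k) / m)) zs)) \<le> f zs"
    using superharmonic_deviation_chain[of m "\<lambda>k. quantile_open M (real (Suc k) / m)" \<theta> n]
      quantile_open_sets quantile_mono(2)[OF div_mono] by (metis Suc_le_mono)
  obtain g where g: "superharmonic M g" "g [] \<le> ennreal (8 * exp ((- \<theta>)\<^sup>2 * n / 2))"
    "\<And>zs k. length zs \<le> n \<Longrightarrow> k \<le> m \<Longrightarrow>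
      ennreal (exp (- \<theta> * deviation_sum M (quantile_closed M (real k / m)) zs)) \<le> g zs"
    using superharmonic_deviation_chain[of m "\<lambda>k. quantile_closed M (real k / m)" "- \<theta>" n]
      quantile_closed_sets quantile_mono(1)[OF div_mono] by metis
  have "superharmonic M (\<lambda>zs. f zs + g zs)"
    by (intro superharmonic_add f g)
  moreover have "f [] + g [] \<le> ennreal (16 * exp (\<theta>\<^sup>2 * n / 2))"
  proof -
    have "f [] + g [] \<le> ennreal (8 * exp (\<theta>\<^sup>2 * n / 2)) + ennreal (8 * exp (\<theta>\<^sup>2 * n / 2))"
      using f(2) g(2) by (intro add_mono) auto
    then show ?thesis by (simp flip: ennreal_plus)
  qed
  moreover have "ennreal (exp (\<theta> * (length zs * (\<bar>ecdf zs x - cdf M x\<bar> - 1 / m)))) \<le> f zs + g zs"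
    if zs: "length zs \<le> n" for zs x
  proof -
    obtain k where k: "k \<le> m"
      and up: "real (length zs) * (ecdf zs x - cdf M x - 1 / m) \<le>
        deviation_sum M (quantile_open M (real (Suc k) / m)) zs"
      and low: "real (length zs) * (cdf M x - ecdf zs x - 1 / m) \<le>
        - deviation_sum M (quantile_closed M (real k / m)) zs"
      using ecdf_bracket[OF m, of zs x] by blast
    show ?thesis
    proof (cases "ecdf zs x - cdf M x \<ge> 0")
      case True
      then have "ennreal (exp (\<theta> * (length zs * (\<bar>ecdf zs x - cdf M x\<bar> - 1 / m)))) \<le>
          ennreal (exp (\<theta> * deviation_sum M (quantile_open M (real (Suc k) / m)) zs))"
        using up l by (auto intro!: ennreal_leI mult_left_mono)
      also have "\<dots> \<le> f zs" by (rule f(3)[OF zs k])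
      finally show ?thesis by (simp add: add_increasing2)
    next
      case False
      then have "ennreal (exp (\<theta> * (length zs * (\<bar>ecdf zs x - cdf M x\<bar> - 1 / m)))) \<le>
          ennreal (exp (\<theta> * (- deviation_sum M (quantile_closed M (real k / m)) zs)))"
        using mult_left_mono[OF low l] by (auto intro!: ennreal_leI)
      also have "\<dots> \<le> g zs" using g(3)[OF zs k] by simp
      finally show ?thesis by (simp add: add_increasing)
    qed
  qed
  ultimately show ?thesis by (rule that)
qed

end

subsection \<open>Empirical distributions and mixtures\<close>

lemma length_sampled: "length (sampled A Y t i) = card {s\<in>{1..t}. A s = i}"
proof (induction t)
  case (Suc t)
  have "{s\<in>{1..Suc t}. A s = i} = (if A (Suc t) = i then insert (Suc t) {s\<in>{1..t}. A s = i} else {s\<in>{1..t}. A s = i})"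
    by (auto simp: le_Suc_eq)
  with Suc show ?case
    by (simp add: sampled_Suc)
qed simp

lemma length_sampled_le: "length (sampled A Y t i) \<le> t"
  using length_filter_le[of "\<lambda>s. A s = i" "[1..<Suc t]"] by (simp add: sampled_def del: upt_Suc)

lemma emp_cdf_eq_ecdf: "emp_cdf A Y t i = ecdf (sampled A Y t i)"
proof
  fix y
  have "card {s\<in>{1..t}. A s = i \<and> Y s i \<le> y} = length (filter (\<lambda>z. z \<le> y) (sampled A Y t i))"
  proof (induction t)
    case (Suc t)
    have "{s\<in>{1..Suc t}. A s = i \<and> Y s i \<le> y} =
        (if A (Suc t) = i \<and> Y (Suc t) i \<le> y then insert (Suc t) {s\<in>{1..t}. A s = i \<and> Y s i \<le> y}
         else {s\<in>{1..t}. A s = i \<and> Y s i \<le> y})"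
      by (auto simp: le_Suc_eq)
    with Suc show ?case
      by (simp add: sampled_Suc)
  qed simp
  then show "emp_cdf A Y t i y = ecdf (sampled A Y t i) y"
    by (simp add: emp_cdf_def ecdf_def length_sampled)
qed

lemma set_sampled: "set (sampled A Y t i) \<subseteq> (\<lambda>s. Y s i) ` {1..t}"
  by (auto simp: sampled_def)

text \<open>Entries are only appended, so the data of an arm after a round are a prefix of its final
  list. This turns statements about intermediate rounds into statements about \<open>take r\<close>
  of one list.\<close>

lemma take_sampled:
  assumes "t \<le> n" "\<And>s. s \<in> {1..t} \<Longrightarrow> A s = A' s"
  shows "take (length (sampled A Y t i)) (sampled A' Y n i) = sampled A Y t i"
  using assms(1)
proof (induction n rule: dec_induct)
  case base
  show ?case
    using sampled_cong[of t A A' Y Y i] assms(2) by simp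
next
  case (step n)
  have "length (sampled A Y t i) \<le> length (sampled A' Y n i)"
    using step.IH by (metis length_take min.cobounded1)
  with step.IH show ?case
    by (simp add: sampled_Suc)
qed

lemma length_sampled_mono:
  assumes "t \<le> n" "\<And>s. s \<in> {1..t} \<Longrightarrow> A s = A' s"
  shows "length (sampled A Y t i) \<le> length (sampled A' Y n i)"
proof -
  have "length (take (length (sampled A Y t i)) (sampled A' Y n i)) = length (sampled A Y t i)"
    by (subst take_sampled[OF assms]) auto
  then show ?thesis by simp
qed

lemma assign_next_before: "s \<le> t \<Longrightarrow> assign_next t k I A s = A s"
  by (simp add: assign_next_def)

lemma length_sampled_assign_next:
  assumes "finite I" "i \<in> I"
  shows "length (sampled (assign_next t (card I) I A) Y (t + card I) i) = Suc (length (sampled A Y t i))"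
proof -
  let ?l = "sorted_list_of_set I"
  obtain j where j: "j < card I" "?l ! j = i"
    using assms by (metis distinct_card in_set_conv_nth distinct_sorted_list_of_set set_sorted_list_of_set)
  have uniq: "j' = j" if "j' < card I" "?l ! j' = i" for j'
    using that j assms(1) nth_eq_iff_index_eq[of ?l j' j] by simp
  have "{s\<in>{1..t + card I}. assign_next t (card I) I A s = i} = insert (t + Suc j) {s\<in>{1..t}. A s = i}"
  proof (intro set_eqI iffI)
    fix s
    assume s: "s \<in> {s\<in>{1..t + card I}. assign_next t (card I) I A s = i}"
    show "s \<in> insert (t + Suc j) {s\<in>{1..t}. A s = i}"
    proof (cases "s \<le> t")
      case False
      then have "s - t - 1 < card I" "?l ! (s - t - 1) = i"
        using s by (auto simp: assign_next_def)
      then have "s - t - 1 = j" by (rule uniq)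
      then show ?thesis using False by auto
    qed (use s in \<open>auto simp: assign_next_def\<close>)
  qed (use j in \<open>auto simp: assign_next_def\<close>)
  then show ?thesis
    by (simp add: length_sampled)
qed

lemma ecdf_right_continuous: "continuous (at_right x) (ecdf zs)"
proof -
  have "continuous (at_right x) (\<lambda>y. real (length (filter (\<lambda>z. z \<le> y) zs)))"
  proof (induction zs)
    case (Cons z zs)
    have "continuous (at_right x) (\<lambda>y. if z \<le> y then 1 else 0 :: real)"
    proof (cases "z \<le> x")
      case True
      have "eventually (\<lambda>y. (if z \<le> y then 1 else 0 :: real) = 1) (at_right x)"
        using True by (auto simp: eventually_at_right_field intro!: exI[of _ "x + 1"])
      then show ?thesis
        using True by (simp add: continuous_within tendsto_eventually)
    next
      case False
      have "eventually (\<lambda>y. (if z \<le> y then 1 else 0 :: real) = 0) (at_right x)"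
        using False by (auto simp: eventually_at_right_field intro!: exI[of _ z])
      then show ?thesis
        using False by (simp add: continuous_within tendsto_eventually)
    qed
    moreover have "(\<lambda>y. real (length (filter (\<lambda>z. z \<le> y) (z # zs)))) =
        (\<lambda>y. (if z \<le> y then 1 else 0) + real (length (filter (\<lambda>z. z \<le> y) zs)))"
      by auto
    ultimately show ?case
      using Cons by (simp only: continuous_add)
  qed simp
  then show ?thesis
    unfolding ecdf_def by (cases "zs = []") (auto intro!: continuous_divide)
qed

lemma ecdf_in_cdf_ab:
  assumes "zs \<noteq> []" "set zs \<subseteq> {a..b}"
  shows "ecdf zs \<in> cdf_ab a b"
proof -
  have "length (filter (\<lambda>z. z \<le> x) zs) \<le> length (filter (\<lambda>z. z \<le> y) zs)" if "x \<le> y" for x y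
    using that by (induction zs) auto
  then have "mono (ecdf zs)"
    unfolding ecdf_def by (intro monoI divide_right_mono) auto
  moreover have "ecdf zs x = 0" if "x < a" for x
  proof -
    have "filter (\<lambda>z. z \<le> x) zs = []"
      using assms(2) that by (force simp: filter_empty_conv)
    then show ?thesis by (simp add: ecdf_def)
  qed
  moreover have "ecdf zs x = 1" if "b \<le> x" for x
  proof -
    have "filter (\<lambda>z. z \<le> x) zs = zs"
      using assms(2) that by (force simp: filter_id_conv)
    then show ?thesis using assms(1) by (simp add: ecdf_def)
  qed
  ultimately show ?thesis
    using ecdf_right_continuous by (simp add: cdf_ab_def)
qed

lemma cdf_ab_bounds: "F \<in> cdf_ab a b \<Longrightarrow> 0 \<le> F x \<and> F x \<le> 1"
proof
  assume F: "F \<in> cdf_ab a b"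
  then have "mono F" by (simp add: cdf_ab_def)
  then have "F (min x (a - 1)) \<le> F x" "F x \<le> F (max x b)"
    by (rule monoD; simp)+
  then show "0 \<le> F x" "F x \<le> 1"
    using F by (auto simp: cdf_ab_def)
qed

text \<open>The restriction to the support matters: deviation bounds are available for surviving
  arms only, and the empirical cdf of an empty list is constantly 0, hence not a cdf.\<close>

lemma mix_in_cdf_ab:
  assumes \<delta>: "\<delta> \<in> unit_simplex K" and G: "\<And>i. i \<in> {1..K} \<Longrightarrow> \<delta> i \<noteq> 0 \<Longrightarrow> G i \<in> cdf_ab a b"
  shows "mix K \<delta> G \<in> cdf_ab a b"
proof -
  have *: "mono (\<lambda>y. \<delta> i * G i y)" "continuous (at_right x) (\<lambda>y. \<delta> i * G i y)"
    "x < a \<Longrightarrow> \<delta> i * G i x = 0" "b \<le> x \<Longrightarrow> \<delta> i * G i x = \<delta> i" if i: "i \<in> {1..K}" for i x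
  proof -
    have nonneg: "0 \<le> \<delta> i"
      using \<delta> by (simp add: unit_simplex_def)
    have cases: "\<delta> i = 0 \<or> G i \<in> cdf_ab a b"
      using G[OF i] by blast
    show "mono (\<lambda>y. \<delta> i * G i y)"
      by (rule disjE[OF cases]) (use nonneg in \<open>auto simp: cdf_ab_def mono_def intro!: mult_left_mono\<close>)
    show "continuous (at_right x) (\<lambda>y. \<delta> i * G i y)"
      by (rule disjE[OF cases]) (auto simp: cdf_ab_def intro!: continuous_mult_left)
    show "x < a \<Longrightarrow> \<delta> i * G i x = 0" "b \<le> x \<Longrightarrow> \<delta> i * G i x = \<delta> i"
      by (rule disjE[OF cases]; simp add: cdf_ab_def)+
  qed
  then have "mono (mix K \<delta> G)"
    unfolding mix_def mono_def by (auto intro!: sum_mono)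
  moreover have "continuous (at_right x) (mix K \<delta> G)" for x
    unfolding mix_def using * by (intro continuous_sum) auto
  moreover have "mix K \<delta> G x = 0" if "x < a" for x
    unfolding mix_def using *(3)[OF _ that] by (intro sum.neutral) blast
  moreover have "mix K \<delta> G x = 1" if "b \<le> x" for x
  proof -
    have "mix K \<delta> G x = (\<Sum>i=1..K. \<delta> i)"
      unfolding mix_def using *(4)[OF _ that] by (intro sum.cong) auto
    then show ?thesis using \<delta> by (simp add: unit_simplex_def)
  qed
  ultimately show ?thesis by (simp add: cdf_ab_def)
qed

text \<open>Induction on normalized partial sums, as \<open>convex_fset\<close> speaks of two points
  only. While the accumulated weight is 0 there is nothing to normalize, hence the implication from
  \<open>0 < S k\<close>.\<close>

lemma mix_in_convex:
  assumes D: "convex_fset D" and F: "\<And>i. i \<in> {1..K} \<Longrightarrow> F i \<in> D" and \<delta>: "\<delta> \<in> unit_simplex K"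
  shows "mix K \<delta> F \<in> D"
proof -
  define S where "S k = (\<Sum>i=1..k. \<delta> i)" for k
  have nonneg: "0 \<le> \<delta> i" for i
    using \<delta> by (simp add: unit_simplex_def)
  have "0 < S k \<longrightarrow> (\<lambda>y. (\<Sum>i=1..k. \<delta> i * F i y) / S k) \<in> D" if "k \<le> K" for k
    using that
  proof (induction k)
    case (Suc k)
    then have FS: "F (Suc k) \<in> D" using F by simp
    have Sk: "0 \<le> S k" unfolding S_def using nonneg by (simp add: sum_nonneg)
    have SS: "S (Suc k) = S k + \<delta> (Suc k)" by (simp add: S_def)
    show ?case
    proof (intro impI)
      assume pos: "0 < S (Suc k)"
      show "(\<lambda>y. (\<Sum>i=1..Suc k. \<delta> i * F i y) / S (Suc k)) \<in> D"
      proof (cases "S k = 0")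
        case True
        then have "\<delta> i = 0" if "i \<in> {1..k}" for i
          using that nonneg sum_nonneg_eq_0_iff[of "{1..k}" \<delta>] by (simp add: S_def)
        then have "(\<lambda>y. (\<Sum>i=1..Suc k. \<delta> i * F i y) / S (Suc k)) = F (Suc k)"
          using pos SS True by (auto simp: fun_eq_iff)
        then show ?thesis using FS by simp
      next
        case False
        then have Sk: "0 < S k" using Sk by simp
        define l where "l = S k / S (Suc k)"
        have l: "l \<in> {0..1}"
          using Sk pos SS nonneg by (auto simp: l_def)
        have "(\<lambda>y. (\<Sum>i=1..k. \<delta> i * F i y) / S k) \<in> D"
          using Suc Sk by simp
        from D[unfolded convex_fset_def, rule_format, OF this FS l]
        have "(\<lambda>y. l * ((\<Sum>i=1..k. \<delta> i * F i y) / S k) + (1 - l) * F (Suc k) y) \<in> D" .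
        also have "(\<lambda>y. l * ((\<Sum>i=1..k. \<delta> i * F i y) / S k) + (1 - l) * F (Suc k) y) =
            (\<lambda>y. (\<Sum>i=1..Suc k. \<delta> i * F i y) / S (Suc k))"
        proof
          fix y
          have "1 - l = \<delta> (Suc k) / S (Suc k)"
            using pos SS by (simp add: l_def field_simps)
          then show "l * ((\<Sum>i=1..k. \<delta> i * F i y) / S k) + (1 - l) * F (Suc k) y =
              (\<Sum>i=1..Suc k. \<delta> i * F i y) / S (Suc k)"
            using Sk by (simp add: l_def add_divide_distrib)
        qed
        finally show ?thesis .
      qed
    qed
  qed (simp add: S_def)
  from this[of K] \<delta> show ?thesis
    by (simp add: mix_def[abs_def] S_def unit_simplex_def)
qed

section \<open>Lexicographic minimum of a finite subset of the simplex\<close>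

lemma lex_less_total:
  assumes "\<delta> \<in> unit_simplex K" "\<gamma> \<in> unit_simplex K" "\<delta> \<noteq> \<gamma>"
  shows "lex_less K \<delta> \<gamma> \<or> lex_less K \<gamma> \<delta>"
proof -
  define i where "i = (LEAST i. \<delta> i \<noteq> \<gamma> i)"
  have "\<exists>i. \<delta> i \<noteq> \<gamma> i"
    using assms(3) by (auto simp: fun_eq_iff)
  then have i: "\<delta> i \<noteq> \<gamma> i" unfolding i_def by (rule LeastI_ex)
  moreover have "\<delta> j = \<gamma> j" if "j < i" for j
    using not_less_Least that unfolding i_def by blast
  moreover have "i \<in> {1..K}"
  proof (rule ccontr)
    assume "i \<notin> {1..K}"
    then have "\<delta> i = 0" "\<gamma> i = 0"
      using assms(1,2) by (simp_all add: unit_simplex_def)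
    with i show False by simp
  qed
  ultimately show ?thesis
    unfolding lex_less_def by (metis linorder_neqE_linordered_idom)
qed

lemma lex_less_trans:
  assumes "lex_less K \<delta> \<gamma>" "lex_less K \<gamma> \<beta>"
  shows "lex_less K \<delta> \<beta>"
proof -
  obtain i j where i: "i \<in> {1..K}" "\<delta> i < \<gamma> i" "\<And>k. k \<in> {1..K} \<Longrightarrow> k < i \<Longrightarrow> \<delta> k = \<gamma> k"
    and j: "j \<in> {1..K}" "\<gamma> j < \<beta> j" "\<And>k. k \<in> {1..K} \<Longrightarrow> k < j \<Longrightarrow> \<gamma> k = \<beta> k"
    using assms unfolding lex_less_def by blast
  have "\<delta> (min i j) < \<beta> (min i j)"
    using i j by (cases i j rule: linorder_cases) (auto simp: min_def)
  then show ?thesis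
    unfolding lex_less_def using i j by (intro bexI[of _ "min i j"]) auto
qed

lemma lex_less_irrefl: "\<not> lex_less K \<delta> \<delta>"
  by (auto simp: lex_less_def)

lemma lex_min_in:
  assumes "finite S" "S \<noteq> {}" "S \<subseteq> unit_simplex K"
  shows "lex_min K S \<in> S"
proof -
  have "\<exists>\<delta>\<in>S. \<forall>\<gamma>\<in>S. \<gamma> \<noteq> \<delta> \<longrightarrow> lex_less K \<delta> \<gamma>"
    using assms
  proof (induction S rule: finite_ne_induct)
    case (insert \<beta> S)
    then obtain \<delta> where \<delta>: "\<delta> \<in> S" "\<forall>\<gamma>\<in>S. \<gamma> \<noteq> \<delta> \<longrightarrow> lex_less K \<delta> \<gamma>"
      by blast
    have "\<beta> \<noteq> \<delta>" using insert \<delta> by blast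
    then consider "lex_less K \<beta> \<delta>" | "lex_less K \<delta> \<beta>"
      using lex_less_total[of \<beta> K \<delta>] insert.prems \<delta>(1) by blast
    then show ?case
    proof cases
      case 1
      have "lex_less K \<beta> \<gamma>" if "\<gamma> \<in> S" for \<gamma>
        using 1 \<delta>(2) that lex_less_trans[OF 1] by (cases "\<gamma> = \<delta>") auto
      then have "\<forall>\<gamma>\<in>insert \<beta> S. \<gamma> \<noteq> \<beta> \<longrightarrow> lex_less K \<beta> \<gamma>"
        by simp
      then show ?thesis by blast
    qed (use \<delta> in blast)
  qed simp
  then obtain \<delta> where \<delta>: "\<delta> \<in> S" "\<forall>\<gamma>\<in>S. \<gamma> \<noteq> \<delta> \<longrightarrow> lex_less K \<delta> \<gamma>"
    by blast
  have "lex_min K S = \<delta>"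
    unfolding lex_min_def
  proof (rule the_equality)
    show "\<gamma> = \<delta>" if "\<gamma> \<in> S \<and> (\<forall>\<beta>\<in>S. \<beta> \<noteq> \<gamma> \<longrightarrow> lex_less K \<gamma> \<beta>)" for \<gamma>
      using that \<delta> lex_less_trans[of K \<delta> \<gamma> \<delta>] lex_less_irrefl[of K \<delta>] by metis
  qed (use \<delta> in simp)
  with \<delta> show ?thesis by simp
qed

subsection \<open>The elimination policy\<close>

text \<open>The update is kept as a disjunction because the survival argument has to treat rounds
  with and without elimination alike.\<close>

lemma pol_step_cases:
  fixes T :: "(real \<Rightarrow> real) \<Rightarrow> real" and C \<eta> :: real and K :: nat and R :: "nat set"
    and Y :: "nat \<Rightarrow> nat \<Rightarrow> real"
  assumes "st_t st + card (st_I st) \<le> n"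
  defines "st' \<equiv> pol_step T C K n R \<eta> Y st"
  shows "st_t st' = st_t st + card (st_I st)" "st_r st' = Suc (st_r st)"
    "st_A st' = assign_next (st_t st) (card (st_I st)) (st_I st) (st_A st)"
    and "st_M st' = st_M st \<and> st_I st' = st_I st \<or>
      st_M st' = {\<gamma>\<in>st_M st. Max ((\<lambda>\<delta>. T (mix K \<delta> (emp_cdf (st_A st') Y (st_t st')))) ` st_M st)
          - T (mix K \<gamma> (emp_cdf (st_A st') Y (st_t st'))) \<le> 2 * u_eta C K \<eta> (st_r st') n} \<and>
      st_I st' = {i\<in>st_I st. \<exists>\<gamma>\<in>st_M st'. 0 < \<gamma> i}"
  using assms(1) by (simp_all add: st'_def pol_step_def Let_def)

lemma pol_step_idle: "\<not> st_t st + card (st_I st) \<le> n \<Longrightarrow> pol_step T C K n R \<eta> Y st = st"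
  by (simp add: pol_step_def)

lemma pol_step_t_mono: "st_t st \<le> st_t (pol_step T C K n R \<eta> Y st)"
  using pol_step_cases(1)[of st n T C K R \<eta> Y] pol_step_idle[of st n T C K R \<eta> Y]
  by (cases "st_t st + card (st_I st) \<le> n") auto

lemma pol_step_A_before:
  assumes "s \<le> st_t st"
  shows "st_A (pol_step T C K n R \<eta> Y st) s = st_A st s"
  using assms pol_step_cases(3)[of st n T C K R \<eta> Y] pol_step_idle[of st n T C K R \<eta> Y]
  by (cases "st_t st + card (st_I st) \<le> n") (auto simp: assign_next_before)

definition pol_iter where
  "pol_iter T C K n R \<eta> Mn Y k = (pol_step T C K n R \<eta> Y ^^ k) (pol_init K Mn)"

lemma pol_iter_0 [simp]: "pol_iter T C K n R \<eta> Mn Y 0 = pol_init K Mn"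
  by (simp add: pol_iter_def)

lemma pol_iter_Suc [simp]:
  "pol_iter T C K n R \<eta> Mn Y (Suc k) = pol_step T C K n R \<eta> Y (pol_iter T C K n R \<eta> Mn Y k)"
  by (simp add: pol_iter_def)

lemma pol_loop_eq: "pol_loop T C K n R \<eta> Mn Y = pol_iter T C K n R \<eta> Mn Y (Suc n)"
  by (simp add: pol_iter_def pol_loop_def)

definition final_assign where
  "final_assign T C K n R \<eta> Mn Y = (let st = pol_loop T C K n R \<eta> Mn Y
     in assign_next (st_t st) (n - st_t st) (st_I st) (st_A st))"

lemma pol_iter_mono:
  assumes "j \<le> k"
  shows "st_t (pol_iter T C K n R \<eta> Mn Y j) \<le> st_t (pol_iter T C K n R \<eta> Mn Y k) \<and>
    (\<forall>s \<le> st_t (pol_iter T C K n R \<eta> Mn Y j). st_A (pol_iter T C K n R \<eta> Mn Y k) s = st_A (pol_iter T C K n R \<eta> Mn Y j) s)"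
  using assms
proof (induction k rule: dec_induct)
  case (step k)
  let ?st = "pol_iter T C K n R \<eta> Mn Y k"
  have "st_t ?st \<le> st_t (pol_step T C K n R \<eta> Y ?st)"
    by (rule pol_step_t_mono)
  moreover have "st_A (pol_step T C K n R \<eta> Y ?st) s = st_A ?st s" if "s \<le> st_t ?st" for s
    using that by (rule pol_step_A_before)
  ultimately show ?case
    using step.IH by (auto intro: order_trans)
qed simp

lemma final_assign_eq:
  assumes "k \<le> Suc n" "s \<le> st_t (pol_iter T C K n R \<eta> Mn Y k)"
  shows "final_assign T C K n R \<eta> Mn Y s = st_A (pol_iter T C K n R \<eta> Mn Y k) s"
proof -
  have "s \<le> st_t (pol_iter T C K n R \<eta> Mn Y (Suc n))"
    using pol_iter_mono[OF assms(1)] assms(2) order_trans by blast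
  then have "final_assign T C K n R \<eta> Mn Y s = st_A (pol_iter T C K n R \<eta> Mn Y (Suc n)) s"
    unfolding final_assign_def pol_loop_eq Let_def by (rule assign_next_before)
  then show ?thesis
    using pol_iter_mono[OF assms(1)] assms(2) by metis
qed

section \<open>Predictability of the assignment\<close>

lemma emp_cdf_cong:
  assumes "\<And>s. s \<in> {1..t} \<Longrightarrow> Y s = Y' s"
  shows "emp_cdf A Y t = emp_cdf A Y' t"
  by (rule ext, unfold emp_cdf_eq_ecdf, rule arg_cong[where f = ecdf], rule sampled_cong) (use assms in auto)

text \<open>A round fixes its assignments at the start and looks at outcomes only up to its last
  subject. If outcomes agree before \<open>s\<close>, a round ending before \<open>s\<close>
  therefore makes the same update, and a round reaching \<open>s\<close> has assigned
  \<open>s\<close> identically, whatever the update does afterwards.\<close>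

lemma pol_step_cong:
  assumes "\<And>u. u \<in> {1..<s} \<Longrightarrow> Y u = Y' u"
  shows "pol_step T C K n R \<eta> Y st = pol_step T C K n R \<eta> Y' st \<or>
    s \<le> st_t (pol_step T C K n R \<eta> Y st) \<and> s \<le> st_t (pol_step T C K n R \<eta> Y' st) \<and>
    st_A (pol_step T C K n R \<eta> Y st) s = st_A (pol_step T C K n R \<eta> Y' st) s"
proof (cases "st_t st + card (st_I st) \<le> n")
  case True
  show ?thesis
  proof (cases "s \<le> st_t st + card (st_I st)")
    case False
    then have "emp_cdf A Y (st_t st + card (st_I st)) = emp_cdf A Y' (st_t st + card (st_I st))" for A
      using assms by (intro emp_cdf_cong) auto
    then show ?thesis by (simp add: pol_step_def)
  next
    case s: True
    then show ?thesis
      using pol_step_cases(1,3)[OF True, of T C K R \<eta> Y] pol_step_cases(1,3)[OF True, of T C K R \<eta> Y'] by simp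
  qed
qed (simp add: pol_step_idle)

lemma predictable_final_assign: "predictable (final_assign T C K n R \<eta> Mn)"
  unfolding predictable_def
proof (intro allI impI)
  fix Y Y' :: "nat \<Rightarrow> nat \<Rightarrow> real" and s
  assume eq: "\<forall>u\<in>{1..<s}. Y u = Y' u"
  let ?st = "pol_iter T C K n R \<eta> Mn Y" and ?st' = "pol_iter T C K n R \<eta> Mn Y'"
  have "?st k = ?st' k \<or> s \<le> st_t (?st k) \<and> s \<le> st_t (?st' k) \<and> st_A (?st k) s = st_A (?st' k) s" for k
  proof (induction k)
    case (Suc k)
    show ?case
    proof (cases "?st k = ?st' k")
      case True
      then show ?thesis
        using pol_step_cong[of s Y Y'] eq by simp
    next
      case False
      with Suc have "s \<le> st_t (?st k)" "s \<le> st_t (?st' k)" "st_A (?st k) s = st_A (?st' k) s" by auto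
      then show ?thesis
        using pol_step_t_mono[of "?st k" T C K n R \<eta> Y] pol_step_t_mono[of "?st' k" T C K n R \<eta> Y']
        by (simp add: pol_step_A_before)
    qed
  qed simp
  from this[of "Suc n"] show "final_assign T C K n R \<eta> Mn Y s = final_assign T C K n R \<eta> Mn Y' s"
    unfolding final_assign_def pol_loop_eq Let_def by (auto simp: assign_next_before)
qed

text \<open>The deterministic core, free of probability. \<open>T_dev\<close> is the Lipschitz
  condition after mixing; it asks for small deviations only on the support of
  \<open>\<delta>\<close>, since those are the arms that are sampled as long as
  \<open>\<delta>\<close> survives.\<close>

locale elimination =
  fixes T :: "(real \<Rightarrow> real) \<Rightarrow> real" and C \<eta> :: real and K n :: nat and R :: "nat set"
    and Mn :: "(nat \<Rightarrow> real) set" and F :: "nat \<Rightarrow> real \<Rightarrow> real" and a b :: real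
  assumes K: "1 \<le> K" "K \<le> n" and C: "0 < C" and \<eta>: "0 < \<eta>"
    and Mn: "finite Mn" "Mn \<noteq> {}" "Mn \<subseteq> unit_simplex K"
    and T_dev: "\<And>\<delta> G B. \<delta> \<in> Mn \<Longrightarrow>
      (\<And>i. i \<in> {1..K} \<Longrightarrow> 0 < \<delta> i \<Longrightarrow> G i \<in> cdf_ab a b \<and> (\<forall>x. \<bar>G i x - F i x\<bar> \<le> B)) \<Longrightarrow>
      \<bar>T (mix K \<delta> F) - T (mix K \<delta> G)\<bar> \<le> C * B"
begin

text \<open>The bound \<open>st_t st \<le> K * st_r st\<close> converts subjects used into rounds
  completed; together with the exact sample count it yields the minimal sample size of the
  survivors.\<close>

definition pol_invariant :: "(nat \<Rightarrow> nat \<Rightarrow> real) \<Rightarrow> pstate \<Rightarrow> bool" where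
  "pol_invariant Y st \<longleftrightarrow> st_I st \<subseteq> {1..K} \<and> st_I st \<noteq> {} \<and> st_M st \<subseteq> Mn \<and> st_M st \<noteq> {} \<and>
     (\<forall>\<gamma>\<in>st_M st. \<forall>i. 0 < \<gamma> i \<longrightarrow> i \<in> st_I st) \<and> st_t st \<le> n \<and> st_t st \<le> K * st_r st \<and>
     (\<forall>i\<in>st_I st. length (sampled (st_A st) Y (st_t st) i) = st_r st)"

lemma simplex_pos:
  assumes "\<gamma> \<in> unit_simplex K"
  obtains i where "i \<in> {1..K}" "0 < \<gamma> i"
proof -
  have "\<exists>i\<in>{1..K}. 0 < \<gamma> i"
  proof (rule ccontr)
    assume "\<not> (\<exists>i\<in>{1..K}. 0 < \<gamma> i)"
    then have "(\<Sum>i=1..K. \<gamma> i) \<le> 0"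
      by (intro sum_nonpos) force
    then show False using assms by (simp add: unit_simplex_def)
  qed
  then show ?thesis using that by blast
qed

lemma simplex_support: "\<gamma> \<in> Mn \<Longrightarrow> 0 < \<gamma> i \<Longrightarrow> i \<in> {1..K}"
proof (rule ccontr)
  assume "\<gamma> \<in> Mn" "0 < \<gamma> i" "i \<notin> {1..K}"
  then have "\<gamma> i = 0" using Mn(3) by (auto simp: unit_simplex_def)
  then show False using \<open>0 < \<gamma> i\<close> by simp
qed

lemma u_eta_nonneg: "1 \<le> r \<Longrightarrow> 0 \<le> u_eta C K \<eta> r n"
proof -
  assume r: "1 \<le> r"
  then have "1 * 1 \<le> real r * real K"
    using K by (intro mult_mono) auto
  then show ?thesis
    using K C \<eta> by (auto simp: u_eta_def intro!: mult_nonneg_nonneg add_nonneg_nonneg)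
qed

lemma pol_invariant_init: "pol_invariant Y (pol_init K Mn)"
  using K Mn simplex_support by (auto simp: pol_invariant_def pol_init_def)

lemma pol_invariant_step:
  assumes inv: "pol_invariant Y st"
  shows "pol_invariant Y (pol_step T C K n R \<eta> Y st)"
proof (cases "st_t st + card (st_I st) \<le> n")
  case True
  let ?st' = "pol_step T C K n R \<eta> Y st"
  let ?val = "\<lambda>\<delta>. T (mix K \<delta> (emp_cdf (st_A ?st') Y (st_t ?st')))"
  note step = pol_step_cases[OF True, of T C K R \<eta> Y]
  have I: "st_I st \<subseteq> {1..K}" "st_I st \<noteq> {}" "finite (st_I st)" and M: "st_M st \<subseteq> Mn" "st_M st \<noteq> {}" "finite (st_M st)"
    and supp: "\<And>\<gamma> i. \<gamma> \<in> st_M st \<Longrightarrow> 0 < \<gamma> i \<Longrightarrow> i \<in> st_I st"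
    using inv Mn(1) by (auto simp: pol_invariant_def intro: finite_subset)
  have "card (st_I st) \<le> K"
    using card_mono[OF _ I(1)] by simp
  then have t: "st_t ?st' \<le> n" "st_t ?st' \<le> K * st_r ?st'"
    using inv True step by (auto simp: pol_invariant_def)
  have I': "st_I ?st' \<subseteq> st_I st"
    using step(4) by auto
  have len: "\<forall>i\<in>st_I ?st'. length (sampled (st_A ?st') Y (st_t ?st') i) = st_r ?st'"
    using I' length_sampled_assign_next[OF I(3)] inv step(1-3) by (auto simp: pol_invariant_def)
  have M': "st_M ?st' \<subseteq> st_M st" "st_M ?st' \<noteq> {}"
  proof -
    show "st_M ?st' \<subseteq> st_M st" using step(4) by auto
    \<comment> \<open>The empirical maximizer passes the test because the radius is nonnegative, so
      elimination never empties the set.\<close>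
    have "Max (?val ` st_M st) \<in> ?val ` st_M st"
      using M by (intro Max_in) auto
    then obtain \<gamma> where "\<gamma> \<in> st_M st" "?val \<gamma> = Max (?val ` st_M st)" by auto
    moreover have "0 \<le> u_eta C K \<eta> (st_r ?st') n"
      using step(2) by (intro u_eta_nonneg) simp
    ultimately have "\<gamma> \<in> st_M ?st'"
      using step(4) by auto
    then show "st_M ?st' \<noteq> {}" by blast
  qed
  have supp': "i \<in> st_I ?st'" if "\<gamma> \<in> st_M ?st'" "0 < \<gamma> i" for \<gamma> i
  proof -
    have "i \<in> st_I st" using that M'(1) supp by blast
    then show ?thesis using that step(4) by blast
  qed
  obtain \<gamma> where \<gamma>: "\<gamma> \<in> st_M ?st'" using M'(2) by blast
  then have "\<gamma> \<in> unit_simplex K" using M' M Mn(3) by blast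
  then obtain i where "0 < \<gamma> i" by (rule simplex_pos)
  then have "st_I ?st' \<noteq> {}" using supp'[OF \<gamma>] by blast
  with t I I' len M' M supp' show ?thesis
    unfolding pol_invariant_def by blast
qed (use inv in \<open>simp add: pol_step_idle\<close>)

lemma pol_invariant_iter: "pol_invariant Y (pol_iter T C K n R \<eta> Mn Y k)"
  by (induction k) (auto simp: pol_invariant_init pol_invariant_step)

text \<open>Each effective pass uses at least one subject, so after \<open>k\<close> passes either
  the loop has stopped or \<open>k\<close> subjects are assigned; for \<open>k = Suc n\<close> the
  latter is impossible.\<close>

lemma pol_loop_finished:
  "n < st_t (pol_loop T C K n R \<eta> Mn Y) + card (st_I (pol_loop T C K n R \<eta> Mn Y))"
proof -
  let ?st = "pol_iter T C K n R \<eta> Mn Y"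
  have "n < st_t (?st k) + card (st_I (?st k)) \<or> k \<le> st_t (?st k)" for k
  proof (induction k)
    case (Suc k)
    show ?case
    proof (cases "st_t (?st k) + card (st_I (?st k)) \<le> n")
      case True
      have "st_I (?st k) \<noteq> {}" "finite (st_I (?st k))"
        using pol_invariant_iter[of Y k] by (auto simp: pol_invariant_def intro: finite_subset)
      then have "0 < card (st_I (?st k))" by (simp add: card_gt_0_iff)
      then show ?thesis
        using Suc True pol_step_cases(1)[OF True, of T C K R \<eta> Y] by auto
    qed (use pol_step_idle in auto)
  qed simp
  from this[of "Suc n"] show ?thesis
    using pol_invariant_iter[of Y "Suc n"] by (auto simp: pol_loop_eq pol_invariant_def simp del: pol_iter_Suc)
qed

context
  fixes Y :: "nat \<Rightarrow> nat \<Rightarrow> real"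
  assumes Y: "\<And>s i. s \<in> {1..n} \<Longrightarrow> i \<in> {1..K} \<Longrightarrow> Y s i \<in> {a..b}"
begin

abbreviation zs where "zs \<equiv> sampled (final_assign T C K n R \<eta> Mn Y) Y n"

lemma T_deviation:
  assumes "\<delta> \<in> Mn" "t \<le> n"
    and "\<And>i. 0 < \<delta> i \<Longrightarrow> i \<in> {1..K} \<Longrightarrow> sampled A Y t i \<noteq> [] \<and> (\<forall>x. \<bar>ecdf (sampled A Y t i) x - F i x\<bar> \<le> B)"
  shows "\<bar>T (mix K \<delta> F) - T (mix K \<delta> (emp_cdf A Y t))\<bar> \<le> C * B"
proof (rule T_dev[OF assms(1)])
  fix i assume i: "i \<in> {1..K}" "0 < \<delta> i"
  have "set (sampled A Y t i) \<subseteq> {a..b}"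
    using set_sampled[of A Y t i] Y[OF _ i(1)] assms(2) by fastforce
  then show "emp_cdf A Y t i \<in> cdf_ab a b \<and> (\<forall>x. \<bar>emp_cdf A Y t i x - F i x\<bar> \<le> B)"
    using assms(3)[OF i(2,1)] ecdf_in_cdf_ab by (auto simp: emp_cdf_eq_ecdf)
qed

text \<open>The empirical values of \<open>\<delta>\<close> and of the empirical maximizer are each
  off by at most one radius, and \<open>\<delta>\<close> is truly at least as good, so the empirical
  gap is at most two radii. The confidence statements are read off prefixes of the final lists, for
  sizes actually reached.\<close>

lemma best_survives:
  assumes best: "\<delta> \<in> Mn" "\<And>\<gamma>. \<gamma> \<in> Mn \<Longrightarrow> T (mix K \<gamma> F) \<le> T (mix K \<delta> F)"
    and good: "\<And>i r x. i \<in> {1..K} \<Longrightarrow> r \<in> {1..n} \<Longrightarrow> r \<le> length (zs i) \<Longrightarrow>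
      \<bar>ecdf (take r (zs i)) x - F i x\<bar> \<le> u_eta C K \<eta> r n / C"
  shows "k \<le> Suc n \<Longrightarrow> \<delta> \<in> st_M (pol_iter T C K n R \<eta> Mn Y k)"
proof (induction k)
  case 0
  then show ?case using best by (simp add: pol_init_def)
next
  case (Suc k)
  define st st' where "st = pol_iter T C K n R \<eta> Mn Y k" and "st' = pol_step T C K n R \<eta> Y st"
  have st'_eq: "st' = pol_iter T C K n R \<eta> Mn Y (Suc k)"
    by (simp add: st'_def st_def)
  have IH: "\<delta> \<in> st_M st" using Suc by (simp add: st_def)
  have "\<delta> \<in> st_M st'"
  proof (cases "st_t st + card (st_I st) \<le> n")
    case True
    note step = pol_step_cases[OF True, of T C K R \<eta> Y, folded st'_def]
    let ?val = "\<lambda>\<delta>. T (mix K \<delta> (emp_cdf (st_A st') Y (st_t st')))"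
    let ?u = "u_eta C K \<eta> (st_r st') n"
    have inv: "pol_invariant Y st" "pol_invariant Y st'"
      unfolding st'_eq unfolding st_def by (rule pol_invariant_iter)+
    then have M: "st_M st \<subseteq> Mn" "st_M st \<noteq> {}" and t: "st_t st' \<le> n" and I: "st_I st \<subseteq> {1..K}"
      by (simp_all add: pol_invariant_def)
    have fin: "finite (st_M st)" "finite (st_I st)"
      using M(1) I Mn(1) by (auto intro: finite_subset)
    have dev: "\<bar>T (mix K \<gamma> F) - ?val \<gamma>\<bar> \<le> ?u" if \<gamma>: "\<gamma> \<in> st_M st" for \<gamma>
    proof -
      have "\<bar>T (mix K \<gamma> F) - ?val \<gamma>\<bar> \<le> C * (?u / C)"
      proof (rule T_deviation)
        show "\<gamma> \<in> Mn" using \<gamma> M by blast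
        fix i assume i: "0 < \<gamma> i" "i \<in> {1..K}"
        then have iI: "i \<in> st_I st"
          using inv(1) \<gamma> by (auto simp: pol_invariant_def)
        let ?l = "sampled (st_A st') Y (st_t st') i"
        have len: "length ?l = st_r st'"
          using length_sampled_assign_next[OF fin(2) iI] inv(1) iI step(1-3) by (simp add: pol_invariant_def)
        have agree: "st_A st' s = final_assign T C K n R \<eta> Mn Y s" if "s \<in> {1..st_t st'}" for s
          using final_assign_eq[OF Suc.prems, of s] that unfolding st'_eq by simp
        have "take (st_r st') (zs i) = ?l"
          using take_sampled[of "st_t st'" n "st_A st'" "final_assign T C K n R \<eta> Mn Y" Y i, OF t agree] len by simp
        moreover have "st_r st' \<le> length (zs i)"
          using length_sampled_mono[of "st_t st'" n "st_A st'" "final_assign T C K n R \<eta> Mn Y" Y i, OF t agree] len by simp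
        moreover have "st_r st' \<in> {1..n}"
          using length_sampled_le[of "st_A st'" Y "st_t st'" i] t len step(2) by simp
        ultimately show "?l \<noteq> [] \<and> (\<forall>x. \<bar>ecdf ?l x - F i x\<bar> \<le> ?u / C)"
          using good[OF i(2), of "st_r st'"] len step(2) by auto
      qed (rule t)
      then show ?thesis using C by simp
    qed
    have "Max (?val ` st_M st) \<in> ?val ` st_M st"
      using M fin by (intro Max_in) auto
    then obtain \<gamma> where \<gamma>: "\<gamma> \<in> st_M st" "?val \<gamma> = Max (?val ` st_M st)" by auto
    have "Max (?val ` st_M st) - ?val \<delta> \<le> 2 * ?u"
      using dev[OF \<gamma>(1)] dev[OF IH] best(2)[of \<gamma>] \<gamma> M(1) fin(1) by auto
    then show ?thesis
      using step(4) IH by auto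
  qed (use IH pol_step_idle in \<open>simp add: st'_def\<close>)
  then show ?case by (simp only: st'_eq)
qed

text \<open>When the loop stops, fewer than \<open>card I \<le> K\<close> subjects remain, and each
  of the \<open>r\<close> rounds used at most \<open>K\<close>. So \<open>n < K * (r + 1)\<close>,
  that is \<open>n div K \<le> r\<close>; the leftover subjects only lengthen the lists.\<close>

lemma recommendation:
  obtains M I where "pol_rec T C K n R \<eta> Mn Y \<in> M" "M \<subseteq> Mn" "I \<subseteq> {1..K}" "I \<noteq> {}"
    "\<And>\<gamma> i. \<gamma> \<in> M \<Longrightarrow> 0 < \<gamma> i \<Longrightarrow> i \<in> I"
    "\<And>i. i \<in> I \<Longrightarrow> n div K \<le> length (zs i)"
    "M = st_M (pol_loop T C K n R \<eta> Mn Y)"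
    "\<And>\<gamma>. \<gamma> \<in> M \<Longrightarrow> T (mix K \<gamma> (emp_cdf (final_assign T C K n R \<eta> Mn Y) Y n))
        \<le> T (mix K (pol_rec T C K n R \<eta> Mn Y) (emp_cdf (final_assign T C K n R \<eta> Mn Y) Y n))"
proof -
  define st where "st = pol_loop T C K n R \<eta> Mn Y"
  let ?A = "final_assign T C K n R \<eta> Mn Y"
  let ?val = "\<lambda>\<delta>. T (mix K \<delta> (emp_cdf ?A Y n))"
  have inv: "pol_invariant Y st"
    using pol_invariant_iter[of Y "Suc n"] by (simp add: st_def pol_loop_eq del: pol_iter_Suc)
  let ?S = "{\<delta>\<in>st_M st. ?val \<delta> = Max (?val ` st_M st)}"
  have M: "st_M st \<subseteq> Mn" "st_M st \<noteq> {}" "finite (st_M st)"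
    using inv Mn(1) by (auto simp: pol_invariant_def intro: finite_subset)
  have "Max (?val ` st_M st) \<in> ?val ` st_M st"
    using M by (intro Max_in) auto
  then obtain \<gamma> where "\<gamma> \<in> st_M st" "?val \<gamma> = Max (?val ` st_M st)" by auto
  then have "?S \<noteq> {}" by blast
  then have "lex_min K ?S \<in> ?S"
    using M Mn(3) by (intro lex_min_in) auto
  moreover have rec: "pol_rec T C K n R \<eta> Mn Y = lex_min K ?S"
    by (simp add: pol_rec_def Let_def st_def final_assign_def)
  ultimately have in_M: "pol_rec T C K n R \<eta> Mn Y \<in> st_M st"
    and max: "?val (pol_rec T C K n R \<eta> Mn Y) = Max (?val ` st_M st)"
    by auto
  show ?thesis
  proof (rule that[OF in_M M(1)])
    show "n div K \<le> length (zs i)" if i: "i \<in> st_I st" for i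
    proof -
      have "card (st_I st) \<le> K"
        using inv card_mono[of "{1..K}" "st_I st"] by (simp add: pol_invariant_def)
      then have "n < K * st_r st + K"
        using pol_loop_finished[of Y] inv by (simp add: pol_invariant_def st_def)
      then have "n div K < Suc (st_r st)"
        using K(1) by (intro less_mult_imp_div_less) (simp add: algebra_simps)
      moreover have "length (sampled (st_A st) Y (st_t st) i) \<le> length (zs i)"
        using inv by (intro length_sampled_mono)
          (auto simp: pol_invariant_def final_assign_def Let_def st_def assign_next_before)
      ultimately show ?thesis
        using inv i by (simp add: pol_invariant_def)
    qed
    show "?val \<gamma> \<le> ?val (pol_rec T C K n R \<eta> Mn Y)" if "\<gamma> \<in> st_M st" for \<gamma>
      unfolding max using M that by (intro Max_ge) auto
  qed (use inv in \<open>auto simp: pol_invariant_def st_def\<close>)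
qed

text \<open>If all radii hold, the best element and the recommendation are both in the final set, so
  the gap is at most the sum of their two errors, each controlled by the worst surviving arm. Naming
  a single arm lets a sum over the arms dominate both alternatives.\<close>

theorem regret_dichotomy:
  assumes best: "\<delta> \<in> Mn" "\<And>\<gamma>. \<gamma> \<in> Mn \<Longrightarrow> T (mix K \<gamma> F) \<le> T (mix K \<delta> F)"
    and bdd: "\<And>i l. i \<in> {1..K} \<Longrightarrow> bdd_above (range (\<lambda>x. \<bar>ecdf l x - F i x\<bar>))"
    and n2: "1 \<le> n div K"
  shows "(\<exists>i\<in>{1..K}. \<exists>r\<in>{1..n}. r \<le> length (zs i) \<and> (\<exists>x. u_eta C K \<eta> r n / C < \<bar>ecdf (take r (zs i)) x - F i x\<bar>))
    \<or> (\<exists>i\<in>{1..K}. n div K \<le> length (zs i) \<and>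
        T (mix K \<delta> F) - T (mix K (pol_rec T C K n R \<eta> Mn Y) F) \<le> 2 * C * sup_dist (ecdf (zs i)) (F i))"
    (is "?bad \<or> ?good")
proof (cases ?bad)
  case False
  then have good: "\<bar>ecdf (take r (zs i)) x - F i x\<bar> \<le> u_eta C K \<eta> r n / C"
    if "i \<in> {1..K}" "r \<in> {1..n}" "r \<le> length (zs i)" for i r x
    using that by (meson not_less)
  let ?A = "final_assign T C K n R \<eta> Mn Y"
  let ?rec = "pol_rec T C K n R \<eta> Mn Y"
  obtain M I where rec: "?rec \<in> M" "M \<subseteq> Mn" and I: "I \<subseteq> {1..K}" "I \<noteq> {}"
    and supp: "\<And>\<gamma> i. \<gamma> \<in> M \<Longrightarrow> 0 < \<gamma> i \<Longrightarrow> i \<in> I"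
    and len: "\<And>i. i \<in> I \<Longrightarrow> n div K \<le> length (zs i)"
    and M: "M = st_M (pol_loop T C K n R \<eta> Mn Y)"
    and max: "\<And>\<gamma>. \<gamma> \<in> M \<Longrightarrow> T (mix K \<gamma> (emp_cdf ?A Y n)) \<le> T (mix K ?rec (emp_cdf ?A Y n))"
    by (rule recommendation) blast
  have \<delta>M: "\<delta> \<in> M"
    unfolding M pol_loop_eq using best good by (rule best_survives) auto
  define d where "d i = sup_dist (ecdf (zs i)) (F i)" for i
  have finI: "finite I" using I finite_subset by blast
  have "Max (d ` I) \<in> d ` I"
    using I finI by (intro Max_in) auto
  then obtain i where i: "i \<in> I" "Max (d ` I) = d i" by auto
  have dev: "\<bar>T (mix K \<gamma> F) - T (mix K \<gamma> (emp_cdf ?A Y n))\<bar> \<le> C * d i" if \<gamma>: "\<gamma> \<in> M" for \<gamma>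
  proof (rule T_deviation)
    show "\<gamma> \<in> Mn" using \<gamma> rec by blast
    fix j assume j: "0 < \<gamma> j" "j \<in> {1..K}"
    then have jI: "j \<in> I" using supp \<gamma> by blast
    have "\<bar>ecdf (zs j) x - F j x\<bar> \<le> d i" for x
    proof -
      have "\<bar>ecdf (zs j) x - F j x\<bar> \<le> d j"
        unfolding d_def sup_dist_def using bdd[OF j(2)] by (intro cSUP_upper) auto
      also have "d j \<le> d i"
        unfolding i(2)[symmetric] using jI finI by (intro Max_ge) auto
      finally show ?thesis .
    qed
    moreover have "zs j \<noteq> []"
      using len[OF jI] n2 by auto
    ultimately show "zs j \<noteq> [] \<and> (\<forall>x. \<bar>ecdf (zs j) x - F j x\<bar> \<le> d i)" by blast
  qed simp
  have "T (mix K \<delta> F) - T (mix K ?rec F) \<le> 2 * C * d i"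
    using dev[OF \<delta>M] dev[OF rec(1)] max[OF \<delta>M] by auto
  then have ?good
    using i(1) I(1) len unfolding d_def by blast
  then show ?thesis ..
qed blast

end

end

subsection \<open>Regret in terms of deviations\<close>

lemma sup_dist_bounds:
  assumes "\<And>x. 0 \<le> G x \<and> G x \<le> 1" "\<And>x. 0 \<le> H x \<and> H x \<le> 1"
  shows "bdd_above (range (\<lambda>x. \<bar>G x - H x\<bar>))" "sup_dist G H \<le> 1" "0 \<le> sup_dist G H"
proof -
  have le1: "\<bar>G x - H x\<bar> \<le> 1" for x
    using assms[of x] by (simp add: abs_le_iff)
  then show bdd: "bdd_above (range (\<lambda>x. \<bar>G x - H x\<bar>))"
    by (auto simp: bdd_above_def)
  show "sup_dist G H \<le> 1"
    unfolding sup_dist_def using le1 by (intro cSUP_least) auto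
  show "0 \<le> sup_dist G H"
    unfolding sup_dist_def using bdd by (intro cSUP_upper2[of _ _ 0]) auto
qed

lemma ecdf_bounds: "0 \<le> ecdf zs x \<and> ecdf zs x \<le> 1"
  by (cases "zs = []") (auto simp: ecdf_def divide_le_eq_1)

context real_distribution
begin

text \<open>A deviation above 1 is impossible, so the zero function serves for
  \<open>\<epsilon> > 1\<close>; otherwise the linear term of the exponent is at most 1.\<close>

lemma superharmonic_tail_uniform:
  fixes N :: nat and \<epsilon> :: real
  assumes N: "1 \<le> N" and \<epsilon>: "0 < \<epsilon>"
  shows "\<exists>f. superharmonic M f \<and> f [] \<le> ennreal (10 * real N * exp (1 - 2 * real N * \<epsilon>\<^sup>2)) \<and>
    (\<forall>zs x. N \<le> length zs \<longrightarrow> \<epsilon> < \<bar>ecdf (take N zs) x - cdf M x\<bar> \<longrightarrow> 1 \<le> f zs)"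
proof (cases "\<epsilon> \<le> 1")
  case True
  obtain f where "superharmonic M f" "f [] \<le> ennreal (10 * real N * exp (\<epsilon> - 2 * real N * \<epsilon>\<^sup>2))"
    "\<And>zs x. N \<le> length zs \<Longrightarrow> \<epsilon> < \<bar>ecdf (take N zs) x - cdf M x\<bar> \<Longrightarrow> 1 \<le> f zs"
    using superharmonic_tail[OF N \<epsilon>] by blast
  moreover have "ennreal (10 * real N * exp (\<epsilon> - 2 * real N * \<epsilon>\<^sup>2)) \<le> ennreal (10 * real N * exp (1 - 2 * real N * \<epsilon>\<^sup>2))"
    using True by (intro ennreal_leI mult_left_mono) auto
  ultimately show ?thesis by (meson order_trans)
next
  case False
  have "\<bar>ecdf l x - cdf M x\<bar> \<le> 1" for l x
    using ecdf_bounds[of l x] cdf_nonneg[of x] cdf_bounded_prob[of x] by (simp add: abs_le_iff)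
  then have "\<not> \<epsilon> < \<bar>ecdf l x - cdf M x\<bar>" for l x
    using False by (meson not_less order_trans less_imp_le)
  then show ?thesis
    using superharmonic_zero by (intro exI[of _ "\<lambda>_. 0"]) auto
qed

end

locale treatment_problem =
  fixes a b C :: real and K :: nat and D :: "(real \<Rightarrow> real) set" and T :: "(real \<Rightarrow> real) \<Rightarrow> real"
    and MK Mn :: "(nat \<Rightarrow> real) set"
  assumes K2: "2 \<le> K"
    and D_sub: "D \<subseteq> cdf_ab a b" and D_cvx: "convex_fset D"
    and C_pos: "0 < C"
    and T_Lip: "\<forall>F\<in>D. \<forall>G\<in>cdf_ab a b. \<bar>T F - T G\<bar> \<le> C * sup_dist F G"
    and MK_sub: "MK \<subseteq> unit_simplex K"
    and Mn: "finite Mn" "Mn \<noteq> {}" "Mn \<subseteq> MK"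
begin

text \<open>Two cdfs differ by at most 1, so a wrong recommendation never costs more than
  \<open>C\<close>. This is the price charged when a confidence radius fails.\<close>

lemma T_diff_le:
  assumes F: "\<And>i. i \<in> {1..K} \<Longrightarrow> F i \<in> D" and "\<delta> \<in> MK" "\<gamma> \<in> MK"
  shows "T (mix K \<delta> F) - T (mix K \<gamma> F) \<le> C"
proof -
  have D: "mix K \<delta> F \<in> D" "mix K \<gamma> F \<in> D"
    using assms MK_sub by (auto intro!: mix_in_convex[OF D_cvx])
  then have cdf: "mix K \<delta> F \<in> cdf_ab a b" "mix K \<gamma> F \<in> cdf_ab a b"
    using D_sub by auto
  have "sup_dist (mix K \<delta> F) (mix K \<gamma> F) \<le> 1"
    by (rule sup_dist_bounds(2)) (use cdf_ab_bounds[OF cdf(1)] cdf_ab_bounds[OF cdf(2)] in auto)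
  moreover have "\<bar>T (mix K \<delta> F) - T (mix K \<gamma> F)\<bar> \<le> C * sup_dist (mix K \<delta> F) (mix K \<gamma> F)"
    using T_Lip D cdf by blast
  ultimately have "\<bar>T (mix K \<delta> F) - T (mix K \<gamma> F)\<bar> \<le> C * 1"
    using C_pos by (meson mult_left_mono order_trans less_imp_le)
  then show ?thesis by simp
qed

lemma SUP_MK_bounds:
  assumes F: "\<And>i. i \<in> {1..K} \<Longrightarrow> F i \<in> D" and S: "S \<subseteq> MK" "\<gamma> \<in> S"
  shows "bdd_above ((\<lambda>\<delta>. T (mix K \<delta> F)) ` S)"
    and "T (mix K \<gamma> F) \<le> (SUP \<delta>\<in>S. T (mix K \<delta> F))"
    and "(SUP \<delta>\<in>S. T (mix K \<delta> F)) \<le> T (mix K \<gamma> F) + C"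
proof -
  have le: "T (mix K \<delta> F) \<le> T (mix K \<gamma> F) + C" if "\<delta> \<in> S" for \<delta>
    using T_diff_le[of F \<delta> \<gamma>] F S that by force
  then show bdd: "bdd_above ((\<lambda>\<delta>. T (mix K \<delta> F)) ` S)"
    by (auto simp: bdd_above_def)
  show "T (mix K \<gamma> F) \<le> (SUP \<delta>\<in>S. T (mix K \<delta> F))"
    using bdd S by (intro cSUP_upper) auto
  show "(SUP \<delta>\<in>S. T (mix K \<delta> F)) \<le> T (mix K \<gamma> F) + C"
    using S le by (intro cSUP_least) auto
qed

lemma disc_err_ge:
  assumes F: "\<forall>i\<in>{1..K}. F i \<in> D"
  shows "\<bar>(SUP \<delta>\<in>MK. T (mix K \<delta> F)) - (SUP \<delta>\<in>Mn. T (mix K \<delta> F))\<bar> \<le> disc_err T K D MK Mn"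
  unfolding disc_err_def
proof (rule cSUP_upper)
  obtain \<gamma> where \<gamma>: "\<gamma> \<in> Mn" using Mn(2) by blast
  have "\<bar>(SUP \<delta>\<in>MK. T (mix K \<delta> F)) - (SUP \<delta>\<in>Mn. T (mix K \<delta> F))\<bar> \<le> C"
    if "\<forall>i\<in>{1..K}. F i \<in> D" for F
    using SUP_MK_bounds(2,3)[of F MK \<gamma>] SUP_MK_bounds(2,3)[of F Mn \<gamma>] that \<gamma> Mn(3)
    by (auto simp: abs_le_iff)
  then show "bdd_above ((\<lambda>F. \<bar>(SUP \<delta>\<in>MK. T (mix K \<delta> F)) - (SUP \<delta>\<in>Mn. T (mix K \<delta> F))\<bar>) ` {F. \<forall>i\<in>{1..K}. F i \<in> D})"
    by (auto simp: bdd_above_def)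
qed (use F in auto)

lemma disc_err_nonneg: "\<forall>i\<in>{1..K}. F i \<in> D \<Longrightarrow> 0 \<le> disc_err T K D MK Mn"
  using disc_err_ge[of F] by linarith

lemma regret_le:
  assumes F: "\<forall>i\<in>{1..K}. F i \<in> D"
    and best: "\<delta> \<in> Mn" "\<And>\<gamma>. \<gamma> \<in> Mn \<Longrightarrow> T (mix K \<gamma> F) \<le> T (mix K \<delta> F)"
  shows "regret T K MK F \<beta> \<le> disc_err T K D MK Mn + (T (mix K \<delta> F) - T (mix K \<beta> F))"
proof -
  have "(SUP \<gamma>\<in>Mn. T (mix K \<gamma> F)) \<le> T (mix K \<delta> F)"
    using Mn(2) best by (intro cSUP_least) auto
  then show ?thesis
    using disc_err_ge[OF F] by (simp add: regret_def)
qed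

lemma T_dev_le:
  assumes F: "\<forall>i\<in>{1..K}. F i \<in> D" and \<delta>: "\<delta> \<in> Mn"
    and G: "\<And>i. i \<in> {1..K} \<Longrightarrow> 0 < \<delta> i \<Longrightarrow> G i \<in> cdf_ab a b \<and> (\<forall>x. \<bar>G i x - F i x\<bar> \<le> B)"
  shows "\<bar>T (mix K \<delta> F) - T (mix K \<delta> G)\<bar> \<le> C * B"
proof -
  have simplex: "\<delta> \<in> unit_simplex K" using \<delta> Mn MK_sub by blast
  then have nonneg: "0 \<le> \<delta> i" for i by (simp add: unit_simplex_def)
  have "mix K \<delta> F \<in> D"
    using F by (intro mix_in_convex[OF D_cvx _ simplex]) auto
  moreover have "mix K \<delta> G \<in> cdf_ab a b"
  proof (rule mix_in_cdf_ab[OF simplex])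
    fix i assume "i \<in> {1..K}" "\<delta> i \<noteq> 0"
    then show "G i \<in> cdf_ab a b" using G[of i] nonneg[of i] by auto
  qed
  ultimately have "\<bar>T (mix K \<delta> F) - T (mix K \<delta> G)\<bar> \<le> C * sup_dist (mix K \<delta> F) (mix K \<delta> G)"
    using T_Lip by blast
  also have "sup_dist (mix K \<delta> F) (mix K \<delta> G) \<le> B"
    unfolding sup_dist_def
  proof (rule cSUP_least)
    fix x
    have "\<bar>mix K \<delta> F x - mix K \<delta> G x\<bar> = \<bar>\<Sum>i=1..K. \<delta> i * (F i x - G i x)\<bar>"
      by (simp add: mix_def sum_subtractf right_diff_distrib)
    also have "\<dots> \<le> (\<Sum>i=1..K. \<bar>\<delta> i * (F i x - G i x)\<bar>)"
      by (rule sum_abs)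
    also have "\<dots> \<le> (\<Sum>i=1..K. \<delta> i * B)"
    proof (rule sum_mono)
      fix i assume i: "i \<in> {1..K}"
      show "\<bar>\<delta> i * (F i x - G i x)\<bar> \<le> \<delta> i * B"
      proof (cases "\<delta> i = 0")
        case False
        then have "\<bar>F i x - G i x\<bar> \<le> B"
          using G[OF i] nonneg[of i] abs_minus_commute[of "F i x" "G i x"] by auto
        then show ?thesis
          using nonneg[of i] by (auto simp: abs_mult intro!: mult_left_mono)
      qed simp
    qed
    also have "\<dots> = B"
      using simplex by (simp add: unit_simplex_def flip: sum_distrib_right)
    finally show "\<bar>mix K \<delta> F x - mix K \<delta> G x\<bar> \<le> B" .
  qed simp
  finally show ?thesis using C_pos by simp
qed

lemma elimination_locale:
  assumes "\<forall>i\<in>{1..K}. F i \<in> D" "K \<le> n" "0 < \<eta>"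
  shows "elimination T C \<eta> K n Mn F a b"
  by unfold_locales (use assms K2 C_pos Mn MK_sub T_dev_le in auto)

end

lemma marg_cdf_eq_cdf:
  assumes "prob_space \<mu>" "(\<lambda>y. y i) \<in> borel_measurable \<mu>"
  shows "real_distribution (distr \<mu> borel (\<lambda>y. y i))" "cdf (distr \<mu> borel (\<lambda>y. y i)) = marg_cdf \<mu> i"
proof -
  interpret prob_space \<mu> by fact
  show "real_distribution (distr \<mu> borel (\<lambda>y. y i))"
    unfolding real_distribution_def real_distribution_axioms_def
    using assms(2) by (auto intro!: prob_space_distr)
  show "cdf (distr \<mu> borel (\<lambda>y. y i)) = marg_cdf \<mu> i"
    using assms(2) by (auto simp: fun_eq_iff cdf_def marg_cdf_def measure_distr vimage_def Int_def intro!: arg_cong[where f = "measure \<mu>"])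
qed

text \<open>An atom at \<open>a\<close> is allowed and the cdf vanishes only strictly below
  \<open>a\<close>, so the lower bound is assembled from the levels
  \<open>a - 1 / Suc k\<close>.\<close>

lemma AE_marg_cdf:
  assumes \<mu>: "prob_space \<mu>" "(\<lambda>y. y i) \<in> borel_measurable \<mu>" and F: "marg_cdf \<mu> i \<in> cdf_ab a b"
  shows "AE y in \<mu>. y i \<in> {a..b}"
proof -
  interpret prob_space \<mu> by fact
  note [measurable] = \<mu>(2)
  have "AE y in \<mu>. a \<le> y i"
  proof -
    have "AE y in \<mu>. \<not> y i \<le> a - 1 / Suc k" for k
    proof -
      have "prob {y \<in> space \<mu>. y i \<le> a - 1 / Suc k} = 0"
        using F by (simp add: cdf_ab_def marg_cdf_def)
      then show ?thesis
        by (subst (asm) prob_eq_0) auto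
    qed
    then have "AE y in \<mu>. \<forall>k. \<not> y i \<le> a - 1 / Suc k"
      by (simp add: AE_all_countable)
    then show ?thesis
    proof eventually_elim
      case (elim y)
      show ?case
      proof (rule ccontr)
        assume "\<not> a \<le> y i"
        then obtain k where "1 / Suc k < a - y i"
          using reals_Archimedean[of "a - y i"] by (auto simp: inverse_eq_divide)
        then show False using elim[rule_format, of k] by simp
      qed
    qed
  qed
  moreover have "AE y in \<mu>. y i \<le> b"
  proof -
    have "prob {y \<in> space \<mu>. y i \<le> b} = 1"
      using F by (simp add: cdf_ab_def marg_cdf_def)
    then show ?thesis
      by (subst (asm) prob_eq_1) auto
  qed
  ultimately show ?thesis by eventually_elim auto
qed

subsection \<open>Numerical estimates\<close>

text \<open>Telescoping: \<open>1 / (n + 1) \<le> 1 / sqrt (n + 1) \<le> 2 * (sqrt (n + 1) - sqrt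
  n)\<close>. This crude order suffices, as it only has to turn \<open>1 / n\<close> into
  \<open>1 / sqrt n\<close> below.\<close>

lemma sum_inverse_le_sqrt: "(\<Sum>r=1..n. 1 / real r) \<le> 2 * sqrt (real n)"
proof (induction n)
  case (Suc n)
  define s t where "s = sqrt (real (Suc n))" and "t = sqrt (real n)"
  have s2: "s\<^sup>2 = real (Suc n)" and t2: "t\<^sup>2 = real n" and st: "1 \<le> s" "0 \<le> t" "t \<le> s"
    by (auto simp: s_def t_def)
  have "1 / real (Suc n) \<le> 1 / s"
    unfolding s2[symmetric] power2_eq_square
    using st mult_left_mono[OF st(1), of s] by (intro divide_left_mono) auto
  also have "1 / s \<le> 2 / (s + t)"
    using st by (simp add: divide_simps)
  also have "2 / (s + t) = 2 * (s - t)"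
  proof -
    have "(s - t) * (s + t) = 1"
      using s2 t2 by (simp add: algebra_simps power2_eq_square)
    then have "2 * (s - t) * (s + t) = 2" unfolding mult.assoc by simp
    then show ?thesis using st by (subst divide_eq_eq) auto
  qed
  finally show ?case
    using Suc by (simp add: s_def t_def)
qed simp

text \<open>The exponent splits into \<open>l\<close> and \<open>\<eta> * l\<close> with
  \<open>l \<ge> ln n\<close>. The first part gives \<open>1 / (n * r^2 * K^2)\<close>, leaving
  terms of order \<open>1 / r\<close>; the second gives \<open>n powr (- \<eta>)\<close>. With
  \<open>exp 1 \<le> 3\<close> everything sums to
  \<open>60 * n powr (- \<eta>) / (K * sqrt n)\<close>.\<close>

lemma confidence_radius_sum_le:
  fixes K n :: nat and \<eta> :: real
  assumes K: "2 \<le> K" and n: "4 \<le> n" and \<eta>: "0 < \<eta>"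
  shows "real K * (\<Sum>r=1..n. 10 * real r * exp (1 - (1 + \<eta>) * (ln (real n) + 2 * ln (real r * real K))))
    \<le> 4 * (real K powr (1 - 3 * \<eta> / (4 + 2 * \<eta>))) / sqrt (real n) * (1 + 18.5 / \<eta>)\<^sup>2"
proof -
  have term_le: "10 * real r * exp (1 - (1 + \<eta>) * (ln (real n) + 2 * ln (real r * real K)))
      \<le> 30 * real n powr (- \<eta>) / (real n * (real K)\<^sup>2) * (1 / real r)" if "r \<in> {1..n}" for r
  proof -
    have r: "1 \<le> real r" using that by simp
    define l where "l = ln (real n) + 2 * ln (real r * real K)"
    have "1 * 1 \<le> real r * real K" using r K by (intro mult_mono) auto
    then have l: "ln (real n) \<le> l" by (simp add: l_def)
    have "exp (1 - (1 + \<eta>) * l) = exp 1 * exp (- \<eta> * l) * exp (- l)"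
      by (simp add: algebra_simps flip: exp_add)
    also have "\<dots> \<le> 3 * exp (- \<eta> * ln (real n)) * exp (- l)"
      using l \<eta> exp_le by (intro mult_mono) auto
    also have "exp (- \<eta> * ln (real n)) = real n powr (- \<eta>)"
      using n by (simp add: powr_def)
    also have "exp (- l) = 1 / (real n * (real r * real K)\<^sup>2)"
    proof -
      have "exp l = real n * (real r * real K)\<^sup>2"
        using n r K by (simp add: l_def exp_add exp_double)
      then show ?thesis by (simp add: exp_minus inverse_eq_divide)
    qed
    finally have "10 * real r * exp (1 - (1 + \<eta>) * l) \<le>
        10 * real r * (3 * real n powr (- \<eta>) * (1 / (real n * (real r * real K)\<^sup>2)))"
      using r by (intro mult_left_mono) auto
    also have "\<dots> = 30 * real n powr (- \<eta>) / (real n * (real K)\<^sup>2) * (1 / real r)"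
      using r by (simp add: power2_eq_square)
    finally show ?thesis by (simp add: l_def)
  qed
  have "real K * (\<Sum>r=1..n. 10 * real r * exp (1 - (1 + \<eta>) * (ln (real n) + 2 * ln (real r * real K))))
      \<le> real K * (\<Sum>r=1..n. 30 * real n powr (- \<eta>) / (real n * (real K)\<^sup>2) * (1 / real r))"
    by (intro mult_left_mono sum_mono term_le) auto
  also have "\<dots> = real K * (30 * real n powr (- \<eta>) / (real n * (real K)\<^sup>2)) * (\<Sum>r=1..n. 1 / real r)"
    by (simp only: sum_distrib_left mult.assoc)
  also have "\<dots> \<le> real K * (30 * real n powr (- \<eta>) / (real n * (real K)\<^sup>2)) * (2 * sqrt (real n))"
    by (intro mult_left_mono sum_inverse_le_sqrt) auto
  also have "\<dots> = 4 * (1 / real K) / sqrt (real n) * (15 * real n powr (- \<eta>))"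
  proof -
    have "k * (30 * p / ((s * s) * k\<^sup>2)) * (2 * s) = 4 * (1 / k) / s * (15 * p)" if "0 < s" "0 < k" for k s p :: real
      using that by (simp add: field_simps power2_eq_square)
    from this[of "sqrt (real n)" "real K"] show ?thesis
      using K n by simp
  qed
  also have "\<dots> \<le> 4 * (real K powr (1 - 3 * \<eta> / (4 + 2 * \<eta>))) / sqrt (real n) * (1 + 18.5 / \<eta>)\<^sup>2"
  proof (intro mult_mono divide_right_mono mult_left_mono)
    have "3 * \<eta> / (4 + 2 * \<eta>) \<le> 2"
      using \<eta> by (simp add: divide_simps)
    then have "real K powr (-1) \<le> real K powr (1 - 3 * \<eta> / (4 + 2 * \<eta>))"
      using K by (intro powr_mono) auto
    then show "1 / real K \<le> real K powr (1 - 3 * \<eta> / (4 + 2 * \<eta>))"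
      using K by (simp add: powr_minus_divide)
    show "15 * real n powr (- \<eta>) \<le> (1 + 18.5 / \<eta>)\<^sup>2"
    \<comment> \<open>For \<open>\<eta> \<le> 6\<close> the right side is at least
      \<open>(1 + 3)^2 = 16\<close>; for larger \<open>\<eta>\<close> the power of
      \<open>n \<ge> 4\<close> is at most \<open>1 / 16\<close>.\<close>
    proof (cases "\<eta> \<le> 6")
      case True
      have "15 * real n powr (- \<eta>) \<le> 15 * real n powr 0"
        using n \<eta> by (intro mult_left_mono powr_mono) auto
      also have "\<dots> \<le> 4\<^sup>2" using n by simp
      also have "\<dots> \<le> (1 + 18.5 / \<eta>)\<^sup>2"
        using True \<eta> by (intro power_mono) (auto simp: field_simps)
      finally show ?thesis .
    next
      case False
      have "15 * real n powr (- \<eta>) \<le> 15 * real n powr (- 2)"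
        using n False by (intro mult_left_mono powr_mono) auto
      also have "real n powr (-2) = 1 / (real n)\<^sup>2"
        using n by (simp add: powr_minus_divide powr_numeral)
      also have "15 * (1 / (real n)\<^sup>2) \<le> 1\<^sup>2"
      proof -
        have "4\<^sup>2 \<le> (real n)\<^sup>2" using n by (intro power_mono) auto
        then show ?thesis by (simp add: divide_simps)
      qed
      also have "\<dots> \<le> (1 + 18.5 / \<eta>)\<^sup>2"
        using \<eta> by (intro power_mono) auto
      finally show ?thesis .
    qed
  qed auto
  finally show ?thesis .
qed

text \<open>Rounding \<open>n / K\<close> down loses less than 1, hence at most a third of it once
  \<open>n div K \<ge> 2\<close>.\<close>

lemma div_ge_two_thirds:
  fixes K n :: nat
  assumes "0 < K" "2 * K \<le> n"
  shows "2 * real n \<le> 3 * (real K * real (n div K))" "2 \<le> n div K"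
proof -
  show m: "2 \<le> n div K"
    using assms by (simp add: less_eq_div_iff_mult_less_eq)
  have "n < K * Suc (n div K)"
    using dividend_less_times_div[OF assms(1), of n] by simp
  then have "real n \<le> real K * real (n div K) + real K"
    by (simp add: algebra_simps flip: of_nat_add of_nat_mult)
  moreover have "real K * 2 \<le> real K * real (n div K)"
    using m by (intro mult_left_mono) auto
  ultimately show "2 * real n \<le> 3 * (real K * real (n div K))" by linarith
qed

lemma div_ge_three_quarters:
  fixes K n :: nat
  assumes "0 < K" "3 * K \<le> n"
  shows "3 * real n \<le> 4 * (real K * real (n div K))" "3 \<le> n div K"
proof -
  show m: "3 \<le> n div K"
    using assms by (simp add: less_eq_div_iff_mult_less_eq)
  have "n < K * Suc (n div K)"
    using dividend_less_times_div[OF assms(1), of n] by simp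
  then have "real n \<le> real K * real (n div K) + real K"
    by (simp add: algebra_simps flip: of_nat_add of_nat_mult)
  moreover have "real K * 3 \<le> real K * real (n div K)"
    using m by (intro mult_left_mono) auto
  ultimately show "3 * real n \<le> 4 * (real K * real (n div K))" by linarith
qed

subsection \<open>Expected regret\<close>

context treatment_problem
begin

theorem expected_regret_le:
  fixes n :: nat and R :: "nat set" and \<eta> c :: real and \<mu> :: "(nat \<Rightarrow> real) measure"
  assumes n: "2 * K \<le> n" and \<eta>: "0 < \<eta>" and c: "0 \<le> c"
    and mu_prob: "prob_space \<mu>" and mu_meas: "\<And>i. i \<in> {1..K} \<Longrightarrow> (\<lambda>y. y i) \<in> borel_measurable \<mu>"
    and mu_marg: "\<forall>i\<in>{1..K}. marg_cdf \<mu> i \<in> D"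
    and g: "\<And>i. i \<in> {1..K} \<Longrightarrow> superharmonic (distr \<mu> borel (\<lambda>y. y i)) (g i)"
    and g_dev: "\<And>i l. i \<in> {1..K} \<Longrightarrow> n div K \<le> length l \<Longrightarrow> length l \<le> n \<Longrightarrow>
      ennreal (2 * C * sup_dist (ecdf l) (marg_cdf \<mu> i)) \<le> ennreal c + g i l"
    and g_sum: "(\<Sum>i=1..K. g i []) \<le> ennreal g0" and g0: "0 \<le> g0"
  shows "(\<integral>\<^sup>+ Y. ennreal (regret T K MK (marg_cdf \<mu>) (pol_rec T C K n R \<eta> Mn Y)) \<partial>(PiM {1..n} (\<lambda>_. \<mu>)))
    \<le> ennreal (disc_err T K D MK Mn + (c + g0)
        + 4 * C * (real K powr (1 - 3 * \<eta> / (4 + 2 * \<eta>))) / sqrt (real n) * (1 + 18.5 / \<eta>)\<^sup>2)"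
proof -
  let ?F = "marg_cdf \<mu>" and ?\<nu> = "\<lambda>i. distr \<mu> borel (\<lambda>y. y i)"
  let ?P = "PiM {1..n} (\<lambda>_. \<mu>)"
  let ?A = "final_assign T C K n R \<eta> Mn"
  let ?zs = "\<lambda>Y. sampled (?A Y) Y n"
  define third where "third = 4 * C * (real K powr (1 - 3 * \<eta> / (4 + 2 * \<eta>))) / sqrt (real n) * (1 + 18.5 / \<eta>)\<^sup>2"
  define \<epsilon> where "\<epsilon> r = u_eta C K \<eta> r n / C" for r
  have Mn_MK: "Mn \<subseteq> MK" by (rule Mn(3))
  interpret prob_space \<mu> by fact
  interpret elimination T C \<eta> K n R Mn ?F a b
    by (rule elimination_locale) (use mu_marg n \<eta> in auto)
  have \<epsilon>_sq: "2 * real r * (\<epsilon> r)\<^sup>2 = (1 + \<eta>) * (ln (real n) + 2 * ln (real r * real K))" and \<epsilon>_pos: "0 < \<epsilon> r"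
    if "1 \<le> r" for r
  proof -
    define x where "x = (1 + \<eta>) / real r * (0.5 * ln (real n) + ln (real r * real K))"
    have "1 * 1 < real r * real K"
      using that K2 by (intro mult_le_less_imp_less) auto
    then have "0 < ln (real r * real K)" "0 \<le> ln (real n)"
      using n K2 by simp_all
    then have x: "0 < x"
      unfolding x_def using \<eta> that by (intro mult_pos_pos divide_pos_pos) auto
    have "\<epsilon> r = sqrt x"
      using C_pos by (simp add: \<epsilon>_def u_eta_def x_def)
    with x show "0 < \<epsilon> r" "2 * real r * (\<epsilon> r)\<^sup>2 = (1 + \<eta>) * (ln (real n) + 2 * ln (real r * real K))"
      using that by (simp_all add: x_def)
  qed
  define tail where "tail i r h \<longleftrightarrow> superharmonic (?\<nu> i) h \<and>
      h [] \<le> ennreal (10 * real r * exp (1 - 2 * real r * (\<epsilon> r)\<^sup>2)) \<and>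
      (\<forall>l x. r \<le> length l \<longrightarrow> \<epsilon> r < \<bar>ecdf (take r l) x - ?F i x\<bar> \<longrightarrow> 1 \<le> h l)" for i r h
  have "\<exists>h. tail i r h"
    if "i \<in> {1..K}" "r \<in> {1..n}" for i r
    using real_distribution.superharmonic_tail_uniform[OF marg_cdf_eq_cdf(1)[OF mu_prob mu_meas[OF that(1)]], of r "\<epsilon> r"]
      that(2) \<epsilon>_pos unfolding tail_def marg_cdf_eq_cdf(2)[OF mu_prob mu_meas[OF that(1)]] by auto
  then obtain h where "\<And>i r. i \<in> {1..K} \<Longrightarrow> r \<in> {1..n} \<Longrightarrow> tail i r (h i r)"
    by metis
  then have h: "\<And>i r. i \<in> {1..K} \<Longrightarrow> r \<in> {1..n} \<Longrightarrow> superharmonic (?\<nu> i) (h i r)"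
    "\<And>i r. i \<in> {1..K} \<Longrightarrow> r \<in> {1..n} \<Longrightarrow> h i r [] \<le> ennreal (10 * real r * exp (1 - 2 * real r * (\<epsilon> r)\<^sup>2))"
    "\<And>i r l x. i \<in> {1..K} \<Longrightarrow> r \<in> {1..n} \<Longrightarrow> r \<le> length l \<Longrightarrow> \<epsilon> r < \<bar>ecdf (take r l) x - ?F i x\<bar> \<Longrightarrow> 1 \<le> h i r l"
    unfolding tail_def by blast+
  define f where "f i l = g i l + ennreal C * (\<Sum>r=1..n. h i r l)" for i l
  have f: "superharmonic (?\<nu> i) (f i)" if "i \<in> {1..K}" for i
    unfolding f_def using that by (intro superharmonic_add superharmonic_cmult superharmonic_sum g h) auto
  have f_sum: "(\<Sum>i=1..K. f i []) \<le> ennreal (g0 + third)"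
  proof -
    have "(\<Sum>i=1..K. f i []) = (\<Sum>i=1..K. g i []) + ennreal C * (\<Sum>i=1..K. \<Sum>r=1..n. h i r [])"
      by (simp add: f_def sum.distrib sum_distrib_left)
    also have "\<dots> \<le> ennreal g0 + ennreal C * (\<Sum>i=1..K. \<Sum>r=1..n. ennreal (10 * real r * exp (1 - 2 * real r * (\<epsilon> r)\<^sup>2)))"
      using h(2) by (intro add_mono g_sum mult_left_mono sum_mono) auto
    also have "(\<Sum>r=1..n. ennreal (10 * real r * exp (1 - 2 * real r * (\<epsilon> r)\<^sup>2))) =
        ennreal (\<Sum>r=1..n. 10 * real r * exp (1 - (1 + \<eta>) * (ln (real n) + 2 * ln (real r * real K))))"
      using \<epsilon>_sq by (subst sum_ennreal) (auto intro!: arg_cong[where f = ennreal] sum.cong)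
    also have "(\<Sum>i=1..K. \<dots>) = ennreal (real K * (\<Sum>r=1..n. 10 * real r * exp (1 - (1 + \<eta>) * (ln (real n) + 2 * ln (real r * real K)))))"
      by (subst sum_ennreal) (auto intro!: sum_nonneg)
    also have "ennreal C * \<dots> = ennreal (C * (real K * (\<Sum>r=1..n. 10 * real r * exp (1 - (1 + \<eta>) * (ln (real n) + 2 * ln (real r * real K))))))"
      using C_pos by (intro ennreal_mult[symmetric] mult_nonneg_nonneg sum_nonneg) auto
    also have "\<dots> \<le> ennreal (C * (4 * (real K powr (1 - 3 * \<eta> / (4 + 2 * \<eta>))) / sqrt (real n) * (1 + 18.5 / \<eta>)\<^sup>2))"
      using C_pos n K2 \<eta> by (intro ennreal_leI mult_left_mono confidence_radius_sum_le) auto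
    also have "C * (4 * (real K powr (1 - 3 * \<eta> / (4 + 2 * \<eta>))) / sqrt (real n) * (1 + 18.5 / \<eta>)\<^sup>2) = third"
      by (simp add: third_def)
    finally show ?thesis
      using C_pos g0 by (simp add: third_def)
  qed
  obtain \<delta> where \<delta>: "\<delta> \<in> Mn" "\<And>\<gamma>. \<gamma> \<in> Mn \<Longrightarrow> T (mix K \<gamma> ?F) \<le> T (mix K \<delta> ?F)"
  proof -
    have "Max ((\<lambda>\<gamma>. T (mix K \<gamma> ?F)) ` Mn) \<in> (\<lambda>\<gamma>. T (mix K \<gamma> ?F)) ` Mn"
      using Mn by (intro Max_in) auto
    then obtain \<delta> where "\<delta> \<in> Mn" "T (mix K \<delta> ?F) = Max ((\<lambda>\<gamma>. T (mix K \<gamma> ?F)) ` Mn)" by auto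
    then show ?thesis using Mn by (intro that[of \<delta>]) auto
  qed
  have disc: "0 \<le> disc_err T K D MK Mn"
    using mu_marg by (rule disc_err_nonneg)
  have F_bounds: "0 \<le> ?F i x \<and> ?F i x \<le> 1" if "i \<in> {1..K}" for i x
    using mu_marg D_sub that by (intro cdf_ab_bounds) auto
  have path: "ennreal (regret T K MK ?F (pol_rec T C K n R \<eta> Mn Y)) \<le>
      ennreal (disc_err T K D MK Mn + c) + (\<Sum>i=1..K. f i (?zs Y i))"
    if Y: "\<forall>s\<in>{1..n}. \<forall>i\<in>{1..K}. Y s i \<in> {a..b}" for Y
  proof -
    let ?rec = "pol_rec T C K n R \<eta> Mn Y"
    let ?gap = "T (mix K \<delta> ?F) - T (mix K ?rec ?F)"
    have reg: "ennreal (regret T K MK ?F ?rec) \<le> ennreal (disc_err T K D MK Mn) + ennreal ?gap"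
    proof -
      have "regret T K MK ?F ?rec \<le> disc_err T K D MK Mn + max 0 ?gap"
        using regret_le[OF mu_marg \<delta>, of ?rec] by simp
      then have "ennreal (regret T K MK ?F ?rec) \<le> ennreal (disc_err T K D MK Mn) + ennreal (max 0 ?gap)"
        using disc by (metis ennreal_leI ennreal_plus max.cobounded1)
      then show ?thesis by simp
    qed
    have single: "f i (?zs Y i) \<le> (\<Sum>i=1..K. f i (?zs Y i))" if "i \<in> {1..K}" for i
      using that by (intro member_le_sum) auto
    have dichotomy: "(\<exists>i\<in>{1..K}. \<exists>r\<in>{1..n}. r \<le> length (?zs Y i) \<and>
          (\<exists>x. \<epsilon> r < \<bar>ecdf (take r (?zs Y i)) x - ?F i x\<bar>)) \<or>
        (\<exists>i\<in>{1..K}. n div K \<le> length (?zs Y i) \<and> ?gap \<le> 2 * C * sup_dist (ecdf (?zs Y i)) (?F i))"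
      unfolding \<epsilon>_def
    proof (rule regret_dichotomy)
      show "bdd_above (range (\<lambda>x. \<bar>ecdf l x - ?F i x\<bar>))" if "i \<in> {1..K}" for i l
        using F_bounds[OF that] ecdf_bounds by (intro sup_dist_bounds) auto
      show "1 \<le> n div K"
        using div_ge_two_thirds(2)[OF _ n] K2 by simp
    qed (use Y \<delta> in auto)
    have "ennreal ?gap \<le> ennreal c + (\<Sum>i=1..K. f i (?zs Y i))"
    proof (cases rule: disjE[OF dichotomy, case_names bad good])
      case bad
      then obtain i r x where bad': "i \<in> {1..K}" "r \<in> {1..n}" "r \<le> length (?zs Y i)"
        "\<epsilon> r < \<bar>ecdf (take r (?zs Y i)) x - ?F i x\<bar>" by blast
      have "?rec \<in> Mn"
        by (rule recommendation[of Y]) (use Y in auto)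
      then have "?gap \<le> C"
        using T_diff_le[of ?F \<delta> ?rec] mu_marg \<delta>(1) Mn_MK by blast
      then have "ennreal ?gap \<le> ennreal C * 1"
        by (simp add: ennreal_leI)
      also have "1 \<le> h i r (?zs Y i)"
        using h(3)[OF bad'(1,2,3,4)] .
      also have "h i r (?zs Y i) \<le> (\<Sum>r=1..n. h i r (?zs Y i))"
        using bad'(2) by (intro member_le_sum) auto
      also have "ennreal C * \<dots> \<le> f i (?zs Y i)"
        by (simp add: f_def)
      also have "\<dots> \<le> (\<Sum>i=1..K. f i (?zs Y i))"
        using bad'(1) by (rule single)
      finally show ?thesis
        by (simp add: add_increasing mult_left_mono)
    next
      case good
      then obtain i where good': "i \<in> {1..K}" "n div K \<le> length (?zs Y i)"
        "?gap \<le> 2 * C * sup_dist (ecdf (?zs Y i)) (?F i)" by blast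
      have "ennreal ?gap \<le> ennreal (2 * C * sup_dist (ecdf (?zs Y i)) (?F i))"
        using good'(3) by (rule ennreal_leI)
      also have "\<dots> \<le> ennreal c + g i (?zs Y i)"
        using good' by (intro g_dev length_sampled_le) auto
      also have "\<dots> \<le> ennreal c + f i (?zs Y i)"
        by (simp add: f_def)
      also have "\<dots> \<le> ennreal c + (\<Sum>i=1..K. f i (?zs Y i))"
        using single[OF good'(1)] by (rule add_left_mono)
      finally show ?thesis .
    qed
    then have "ennreal (disc_err T K D MK Mn) + ennreal ?gap \<le>
        ennreal (disc_err T K D MK Mn) + (ennreal c + (\<Sum>i=1..K. f i (?zs Y i)))"
      by (rule add_left_mono)
    from order_trans[OF reg this] show ?thesis
      using disc c by (simp only: ennreal_plus add.assoc)
  qed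
  \<comment> \<open>Empirical cdfs are known to lie in \<open>cdf_ab a b\<close> only if all
    outcomes are in \<open>{a..b}\<close>, which the marginals guarantee almost surely.\<close>
  have AE: "AE Y in ?P. \<forall>s\<in>{1..n}. \<forall>i\<in>{1..K}. Y s i \<in> {a..b}"
  proof (intro eventually_ball_finite ballI)
    fix s i assume "s \<in> {1..n}" "i \<in> {1..K}"
    then have "AE y in \<mu>. y i \<in> {a..b}"
      using mu_marg D_sub by (intro AE_marg_cdf mu_prob mu_meas) auto
    then show "AE Y in ?P. Y s i \<in> {a..b}"
      using mu_prob \<open>s \<in> {1..n}\<close> by (intro AE_PiM_component) auto
  qed auto
  \<comment> \<open>The constant is absorbed into the function of arm 1 instead of being pulled out:
    additivity of the integral would ask for a measurable integrand.\<close>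
  define d where "d = ennreal (disc_err T K D MK Mn + c)"
  define f' where "f' i l = f i l + (if i = 1 then d else 0)" for i l
  have f'_eq: "(\<Sum>i=1..K. f' i (l i)) = d + (\<Sum>i=1..K. f i (l i))" for l
    using K2 by (simp add: f'_def sum.distrib add.commute)
  have "superharmonic (?\<nu> i) (\<lambda>_. if i = 1 then d else 0)" if "i \<in> {1..K}" for i
    using mu_meas[OF that] by (intro superharmonic_const prob_space_distr)
  then have f': "superharmonic (?\<nu> i) (f' i)" if "i \<in> {1..K}" for i
    unfolding f'_def using that by (intro superharmonic_add f) auto
  have "(\<integral>\<^sup>+ Y. ennreal (regret T K MK ?F (pol_rec T C K n R \<eta> Mn Y)) \<partial>?P) \<le>
      (\<integral>\<^sup>+ Y. (\<Sum>i=1..K. f' i (?zs Y i)) \<partial>?P)"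
    using AE unfolding f'_eq d_def by (intro nn_integral_mono_AE, eventually_elim) (rule path)
  also have "\<dots> \<le> (\<Sum>i=1..K. f' i [])"
    by (rule nn_integral_sampled_le[OF mu_prob _ mu_meas f' predictable_final_assign]) auto
  also have "\<dots> \<le> d + ennreal (g0 + third)"
    unfolding f'_eq[of "\<lambda>_. []"] using f_sum by (rule add_left_mono)
  also have "\<dots> = ennreal (disc_err T K D MK Mn + (c + g0) + third)"
    using disc c g0 C_pos by (simp add: d_def third_def add_ac flip: ennreal_plus)
  finally show ?thesis
    by (simp add: third_def)
qed

end

context real_distribution
begin

text \<open>A union over the possible sample sizes. Beyond \<open>\<epsilon>\<close> the distance is
  still at most 1, which the tail function frozen at \<open>N = length l\<close> covers.\<close>

lemma sup_dist_union_bound: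
  fixes m n :: nat and \<epsilon> :: real
  assumes m: "1 \<le> m" and \<epsilon>: "0 < \<epsilon>"
  obtains g where "superharmonic M g"
    "g [] \<le> ennreal (\<Sum>N=m..n. 10 * real N * exp (1 - 2 * real N * \<epsilon>\<^sup>2))"
    "\<And>l. m \<le> length l \<Longrightarrow> length l \<le> n \<Longrightarrow> ennreal (sup_dist (ecdf l) (cdf M)) \<le> ennreal \<epsilon> + g l"
proof -
  define tail where "tail N h \<longleftrightarrow> superharmonic M h \<and> h [] \<le> ennreal (10 * real N * exp (1 - 2 * real N * \<epsilon>\<^sup>2)) \<and>
    (\<forall>l x. N \<le> length l \<longrightarrow> \<epsilon> < \<bar>ecdf (take N l) x - cdf M x\<bar> \<longrightarrow> 1 \<le> h l)" for N h
  have "\<exists>h. tail N h" if "N \<in> {m..n}" for N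
    using superharmonic_tail_uniform[of N \<epsilon>] m \<epsilon> that unfolding tail_def by auto
  then obtain h where "\<And>N. N \<in> {m..n} \<Longrightarrow> tail N (h N)" by metis
  then have h: "\<And>N. N \<in> {m..n} \<Longrightarrow> superharmonic M (h N)"
    "\<And>N. N \<in> {m..n} \<Longrightarrow> h N [] \<le> ennreal (10 * real N * exp (1 - 2 * real N * \<epsilon>\<^sup>2))"
    "\<And>N l x. N \<in> {m..n} \<Longrightarrow> N \<le> length l \<Longrightarrow> \<epsilon> < \<bar>ecdf (take N l) x - cdf M x\<bar> \<Longrightarrow> 1 \<le> h N l"
    unfolding tail_def by blast+
  let ?g = "\<lambda>l. \<Sum>N=m..n. h N l"
  have "superharmonic M ?g"
    using h(1) by (rule superharmonic_sum)
  moreover have "?g [] \<le> ennreal (\<Sum>N=m..n. 10 * real N * exp (1 - 2 * real N * \<epsilon>\<^sup>2))"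
  proof -
    have "?g [] \<le> (\<Sum>N=m..n. ennreal (10 * real N * exp (1 - 2 * real N * \<epsilon>\<^sup>2)))"
      using h(2) by (rule sum_mono)
    also have "\<dots> = ennreal (\<Sum>N=m..n. 10 * real N * exp (1 - 2 * real N * \<epsilon>\<^sup>2))"
      by (rule sum_ennreal) simp
    finally show ?thesis .
  qed
  moreover have "ennreal (sup_dist (ecdf l) (cdf M)) \<le> ennreal \<epsilon> + ?g l" if l: "m \<le> length l" "length l \<le> n" for l
  proof (cases "\<exists>x. \<epsilon> < \<bar>ecdf l x - cdf M x\<bar>")
    case True
    then obtain x where x: "\<epsilon> < \<bar>ecdf l x - cdf M x\<bar>" by blast
    have "sup_dist (ecdf l) (cdf M) \<le> 1"
      using ecdf_bounds cdf_nonneg cdf_bounded_prob by (intro sup_dist_bounds) auto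
    then have "ennreal (sup_dist (ecdf l) (cdf M)) \<le> 1"
      using ennreal_leI[of "sup_dist (ecdf l) (cdf M)" 1] by simp
    also have "1 \<le> h (length l) l"
      using h(3)[of "length l" l x] l x by simp
    also have "\<dots> \<le> ?g l"
      using l by (intro member_le_sum) auto
    finally show ?thesis by (simp add: add_increasing)
  next
    case False
    then have "sup_dist (ecdf l) (cdf M) \<le> \<epsilon>"
      unfolding sup_dist_def by (intro cSUP_least) (auto simp: not_less)
    then have "ennreal (sup_dist (ecdf l) (cdf M)) \<le> ennreal \<epsilon>"
      by (rule ennreal_leI)
    then show ?thesis by (simp add: add_increasing2)
  qed
  ultimately show ?thesis by (rule that)
qed

text \<open>The deviation enters only through \<open>y \<le> ln B - 1 + exp y / B\<close>, which is sharp at \<open>exp y = B\<close>.\<close>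

lemma sup_dist_maximal_bound:
  fixes m n m' :: nat and \<theta> B :: real
  assumes m: "1 \<le> m" and m': "0 < m'" and \<theta>: "0 < \<theta>" and B: "exp 1 \<le> B"
  obtains g where "superharmonic M g"
    "g [] \<le> ennreal (16 * exp (\<theta>\<^sup>2 * n / 2) / (\<theta> * m * B))"
    "\<And>l. m \<le> length l \<Longrightarrow> length l \<le> n \<Longrightarrow>
      ennreal (sup_dist (ecdf l) (cdf M)) \<le> ennreal (1 / m' + (ln B - 1) / (\<theta> * m)) + g l"
proof -
  have B0: "0 < B" using B by (meson exp_gt_zero less_le_trans)
  have lnB: "1 \<le> ln B" using B B0 by (simp add: ln_ge_iff)
  obtain f where f: "superharmonic M f" "f [] \<le> ennreal (16 * exp (\<theta>\<^sup>2 * n / 2))"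
    "\<And>l x. length l \<le> n \<Longrightarrow> ennreal (exp (\<theta> * (length l * (\<bar>ecdf l x - cdf M x\<bar> - 1 / m')))) \<le> f l"
    using superharmonic_sup_deviation[of m' \<theta> n] m' \<theta> by auto
  \<comment> \<open>The coefficient of \<open>f\<close> that remains when the bound
    \<open>ln B - 1 + exp y / B\<close> is divided by \<open>\<theta> * m\<close>.\<close>
  define k where "k = 1 / (\<theta> * m * B)"
  have k: "0 < k" using \<theta> m B0 by (simp add: k_def)
  let ?g = "\<lambda>l. ennreal k * f l"
  have "superharmonic M ?g"
    using f(1) by (rule superharmonic_cmult)
  moreover have "?g [] \<le> ennreal (16 * exp (\<theta>\<^sup>2 * n / 2) / (\<theta> * m * B))"
  proof -
    have "?g [] \<le> ennreal k * ennreal (16 * exp (\<theta>\<^sup>2 * n / 2))"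
      using f(2) by (rule mult_left_mono) simp
    also have "\<dots> = ennreal (k * (16 * exp (\<theta>\<^sup>2 * n / 2)))"
      using k by (intro ennreal_mult[symmetric]) auto
    finally show ?thesis by (simp add: k_def)
  qed
  moreover have "ennreal (sup_dist (ecdf l) (cdf M)) \<le> ennreal (1 / m' + (ln B - 1) / (\<theta> * m)) + ?g l"
    if l: "m \<le> length l" "length l \<le> n" for l
  proof (cases "f l")
    case (real \<phi>)
    have "\<bar>ecdf l x - cdf M x\<bar> \<le> 1 / m' + (ln B - 1) / (\<theta> * m) + k * \<phi>" for x
    \<comment> \<open>Replacing \<open>length l\<close> by its lower bound \<open>m\<close> goes in
      the right direction only if the deviation exceeds \<open>1 / m'\<close>.\<close>
    proof (cases "\<bar>ecdf l x - cdf M x\<bar> \<le> 1 / m'")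
      case True
      have "0 \<le> (ln B - 1) / (\<theta> * m) + k * \<phi>"
        using lnB \<theta> k real by (intro add_nonneg_nonneg mult_nonneg_nonneg divide_nonneg_nonneg) auto
      with True show ?thesis by linarith
    next
      case False
      let ?d = "\<bar>ecdf l x - cdf M x\<bar> - 1 / m'"
      define y where "y = \<theta> * (length l * ?d)"
      have "exp y \<le> \<phi>"
        using f(3)[OF l(2), of x] real by (simp add: y_def)
      then have "exp (y - ln B) \<le> \<phi> / B"
        using B0 by (simp add: exp_diff divide_right_mono)
      moreover have "1 + (y - ln B) \<le> exp (y - ln B)"
        by (rule exp_ge_add_one_self)
      ultimately have "y \<le> ln B - 1 + \<phi> / B" by linarith
      moreover have "\<theta> * (real m * ?d) \<le> y"
        unfolding y_def using \<theta> l(1) False by (intro mult_left_mono mult_right_mono) auto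
      ultimately have "?d * (\<theta> * m) \<le> ln B - 1 + \<phi> / B"
        by (simp add: mult_ac)
      then have "?d \<le> (ln B - 1 + \<phi> / B) / (\<theta> * m)"
        using \<theta> m by (subst pos_le_divide_eq) auto
      also have "\<dots> = (ln B - 1) / (\<theta> * m) + k * \<phi>"
        by (simp add: k_def add_divide_distrib mult_ac)
      finally show ?thesis by linarith
    qed
    then have "sup_dist (ecdf l) (cdf M) \<le> (1 / m' + (ln B - 1) / (\<theta> * m)) + k * \<phi>"
      unfolding sup_dist_def by (intro cSUP_least) auto
    then have "ennreal (sup_dist (ecdf l) (cdf M)) \<le> ennreal ((1 / m' + (ln B - 1) / (\<theta> * m)) + k * \<phi>)"
      by (rule ennreal_leI)
    also have "\<dots> = ennreal (1 / m' + (ln B - 1) / (\<theta> * m)) + ennreal (k * \<phi>)"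
      using lnB \<theta> k real by (intro ennreal_plus) auto
    also have "ennreal (k * \<phi>) = ?g l"
      using k real by (simp add: ennreal_mult)
    finally show ?thesis .
  next
    case top
    then show ?thesis using k by (simp add: ennreal_mult_top)
  qed
  ultimately show ?thesis by (rule that)
qed

end

text \<open>As \<open>K * N / n \<ge> 2 / 3\<close>, the factor 1.5 makes
  \<open>2 * N * \<epsilon>^2 \<ge> 3 * L\<close>, so each exponential is at most
  \<open>3 / (3 * K * n)^3\<close>. The union over arms and sizes is then of order
  \<open>1 / (K^2 * n)\<close>, which fits into the remaining 0.5 of the factor 2.\<close>

lemma logarithmic_rate:
  fixes K n :: nat and L \<epsilon> :: real
  assumes K: "2 \<le> K" and n: "2 * K \<le> n"
  defines "L \<equiv> ln (3.01 * real K * (real n + 2))"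
  defines "\<epsilon> \<equiv> 1.5 * (sqrt (real K / real n) * sqrt L)"
  shows "0 < \<epsilon>"
    and "\<epsilon> + real K * (\<Sum>N=n div K..n. 10 * real N * exp (1 - 2 * real N * \<epsilon>\<^sup>2)) \<le> 2 * (sqrt (real K / real n) * sqrt L)"
proof -
  have nK: "real n \<ge> 4" "real K \<ge> 2" using K n by simp_all
  have x: "3 * (real K * real n) \<le> 3.01 * real K * (real n + 2)"
    using nK by (simp add: algebra_simps)
  have x3: "3 \<le> 3.01 * real K * (real n + 2)"
  proof -
    have "1 * 1 \<le> real K * real n" using nK by (intro mult_mono) auto
    then show ?thesis using x by simp
  qed
  have expL: "exp L = 3.01 * real K * (real n + 2)"
    using x3 by (simp add: L_def)
  have L: "1 \<le> L"
  proof -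
    have "exp 1 \<le> exp L" using exp_le x3 unfolding expL by (rule order_trans)
    then show ?thesis by simp
  qed
  then show pos: "0 < \<epsilon>"
    using nK by (simp add: \<epsilon>_def)
  have \<epsilon>2: "\<epsilon>\<^sup>2 = 9 / 4 * (real K / real n * L)"
    using L nK by (simp add: \<epsilon>_def power_mult_distrib power_divide)
  have term_le: "10 * real N * exp (1 - 2 * real N * \<epsilon>\<^sup>2) \<le> 30 * real n * exp (- (3 * L))" if N: "N \<in> {n div K..n}" for N
  proof -
    have "2 * real n \<le> 3 * (real K * real (n div K))"
      using div_ge_two_thirds(1)[OF _ n] K by simp
    also have "\<dots> \<le> 3 * (real K * real N)"
      using N by (intro mult_left_mono) auto
    finally have "2 / 3 \<le> real K * real N / real n"
      using nK by (simp add: field_simps)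
    then have "9 / 2 * (2 / 3) * L \<le> 9 / 2 * (real K * real N / real n) * L"
      using L by (intro mult_right_mono mult_left_mono) auto
    also have "\<dots> = 2 * real N * \<epsilon>\<^sup>2"
      by (simp add: \<epsilon>2)
    finally have "exp (1 - 2 * real N * \<epsilon>\<^sup>2) \<le> exp (1 - 3 * L)"
      by simp
    also have "\<dots> = exp 1 * exp (- (3 * L))"
      by (simp flip: exp_add)
    also have "\<dots> \<le> 3 * exp (- (3 * L))"
      using exp_le by (intro mult_right_mono) auto
    finally have "10 * real N * exp (1 - 2 * real N * \<epsilon>\<^sup>2) \<le> 10 * real n * (3 * exp (- (3 * L)))"
      using N by (intro mult_mono) auto
    then show ?thesis by simp
  qed
  have exp3: "exp (- (3 * L)) \<le> 1 / (27 * (real K * real n) ^ 3)"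
  proof -
    have "(3 * (real K * real n)) ^ 3 \<le> exp L ^ 3"
      unfolding expL using x by (intro power_mono) auto
    also have "exp L ^ 3 = exp (3 * L)"
      by (simp flip: exp_of_nat_mult)
    finally have "27 * (real K * real n) ^ 3 \<le> exp (3 * L)"
      by (simp add: power_mult_distrib)
    moreover have "0 < 27 * (real K * real n) ^ 3" using nK by simp
    ultimately show ?thesis
      by (simp add: exp_minus inverse_eq_divide frac_le)
  qed
  have "(\<Sum>N=n div K..n. 10 * real N * exp (1 - 2 * real N * \<epsilon>\<^sup>2)) \<le> real (card {n div K..n}) * (30 * real n * exp (- (3 * L)))"
    using term_le by (intro sum_bounded_above) auto
  also have "\<dots> \<le> real n * (30 * real n * (1 / (27 * (real K * real n) ^ 3)))"
    using exp3 div_ge_two_thirds(2)[OF _ n] K by (intro mult_mono) auto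
  finally have "real K * (\<Sum>N=n div K..n. 10 * real N * exp (1 - 2 * real N * \<epsilon>\<^sup>2)) \<le>
      real K * (real n * (30 * real n * (1 / (27 * (real K * real n) ^ 3))))"
    by (intro mult_left_mono) auto
  also have "\<dots> = 10 / 9 / (real K)\<^sup>2 * (1 / real n)"
    using nK by (simp add: field_simps power2_eq_square power3_eq_cube)
  also have "\<dots> \<le> 1 / 2 * (1 / sqrt (real n))"
  proof (intro mult_mono)
    have "2\<^sup>2 \<le> (real K)\<^sup>2" using nK by (intro power_mono) auto
    then show "10 / 9 / (real K)\<^sup>2 \<le> 1 / 2" using nK by (simp add: divide_simps)
    show "1 / real n \<le> 1 / sqrt (real n)"
      using nK sqrt_le_D[of "real n" "real n"] by (intro divide_left_mono) (auto simp: real_le_rsqrt real_sqrt_le_iff power2_eq_square intro!: real_le_lsqrt)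
  qed auto
  also have "\<dots> = 1 / 2 * (sqrt (1 / real n) * 1)"
    by (simp add: real_sqrt_divide)
  also have "\<dots> \<le> 1 / 2 * (sqrt (real K / real n) * sqrt L)"
    using nK L by (intro mult_left_mono mult_mono) (auto intro!: divide_right_mono)
  finally show "\<epsilon> + real K * (\<Sum>N=n div K..n. 10 * real N * exp (1 - 2 * real N * \<epsilon>\<^sup>2)) \<le> 2 * (sqrt (real K / real n) * sqrt L)"
    by (simp add: \<epsilon>_def)
qed

text \<open>With \<open>X = 16 * K * exp (\<theta>^2 * n / 2)\<close>, the choice
  \<open>B = X\<close> minimizes \<open>ln B - 1 + X / B\<close>, with value \<open>ln X\<close>,
  and \<open>\<theta>\<close> then minimizes \<open>ln X / \<theta>\<close>. Apart from the grid
  error, \<open>\<theta> * n / (n div K)\<close> remains. For \<open>n \<ge> 3 * K\<close> rounding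
  costs a factor \<open>4 / 3\<close>, and \<open>sqrt 2 * 4 / 3 \<le> 1.9\<close> leaves 0.1 for
  the grid error; a rounding factor \<open>3 / 2\<close> would overshoot 2.\<close>

lemma maximal_rate:
  fixes K n :: nat and \<theta> B :: real
  assumes K: "2 \<le> K" and n: "3 * K \<le> n"
  defines "\<theta> \<equiv> sqrt (2 * ln (16 * real K) / real n)" and "B \<equiv> (16 * real K)\<^sup>2"
  shows "0 < \<theta>" "exp 1 \<le> B"
    and "(1 / real (n\<^sup>2) + (ln B - 1) / (\<theta> * real (n div K))) + real K * (16 * exp (\<theta>\<^sup>2 * real n / 2) / (\<theta> * real (n div K) * B))
      \<le> 2 * (sqrt (real K / real n) * sqrt (real K * ln (17 * real K)))"
proof -
  have nK: "real n \<ge> 6" "real K \<ge> 2" using K n by simp_all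
  define l l' where "l = ln (16 * real K)" and "l' = ln (17 * real K)"
  have l: "1 \<le> l" "l \<le> l'"
  proof -
    have "exp 1 \<le> 16 * real K" using exp_le nK by linarith
    then show "1 \<le> l" using nK by (simp add: l_def ln_ge_iff)
    show "l \<le> l'" using nK by (simp add: l_def l'_def)
  qed
  show \<theta>: "0 < \<theta>"
    using l nK by (simp add: \<theta>_def l_def)
  show "exp 1 \<le> B"
  proof -
    have "16 * 1 \<le> (16 * real K) * (16 * real K)" using nK by (intro mult_mono) auto
    then show ?thesis using exp_le unfolding B_def power2_eq_square by linarith
  qed
  have \<theta>2: "\<theta>\<^sup>2 * real n = 2 * l"
    using l nK by (simp add: \<theta>_def flip: l_def)
  have m: "3 * real n \<le> 4 * (real K * real (n div K))" "3 \<le> n div K"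
    using div_ge_three_quarters[OF _ n] K by auto
  define m where "m = real (n div K)"
  have m0: "0 < m" using m(2) by (simp add: m_def)
  have lnB: "ln B = 2 * l"
    unfolding B_def l_def using nK by (subst ln_realpow) auto
  have "exp (\<theta>\<^sup>2 * real n / 2) = 16 * real K"
    using nK by (simp add: \<theta>2 l_def)
  then have "real K * (16 * exp (\<theta>\<^sup>2 * real n / 2) / (\<theta> * m * B)) = 1 / (\<theta> * m)"
    using nK \<theta> m0 by (simp add: B_def power2_eq_square field_simps)
  then have "(1 / real (n\<^sup>2) + (ln B - 1) / (\<theta> * m)) + real K * (16 * exp (\<theta>\<^sup>2 * real n / 2) / (\<theta> * m * B))
      = 1 / real (n\<^sup>2) + 2 * l / (\<theta> * m)"
    by (simp add: lnB diff_divide_distrib)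
  also have "2 * l / (\<theta> * m) = \<theta> * (real n / m)"
    unfolding \<theta>2[symmetric] using \<theta> by (simp add: power2_eq_square)
  also have "\<dots> \<le> \<theta> * (4 / 3 * real K)"
    using m(1) m0 \<theta> by (intro mult_left_mono) (auto simp: m_def field_simps)
  also have "\<theta> * (4 / 3 * real K) \<le> (19 / 10 * sqrt (l' / real n)) * real K"
  proof -
    have "\<theta> \<le> sqrt (2 * (l' / real n))"
      using l nK by (auto simp: \<theta>_def simp flip: l_def intro!: divide_right_mono)
    also have "\<dots> = sqrt 2 * sqrt (l' / real n)"
      by (rule real_sqrt_mult)
    finally have "\<theta> * (4 / 3) \<le> sqrt 2 * sqrt (l' / real n) * (4 / 3)"
      by (rule mult_right_mono) simp
    also have "\<dots> = (sqrt 2 * (4 / 3)) * sqrt (l' / real n)"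
      by simp
    also have "\<dots> \<le> 19 / 10 * sqrt (l' / real n)"
    proof (rule mult_right_mono)
      have "sqrt 2 \<le> 57 / 40"
        by (rule real_le_lsqrt) (auto simp: power2_eq_square)
      then show "sqrt 2 * (4 / 3) \<le> 19 / 10" by simp
    qed (use l nK in auto)
    finally have "\<theta> * (4 / 3) * real K \<le> 19 / 10 * sqrt (l' / real n) * real K"
      by (rule mult_right_mono) simp
    then show ?thesis by simp
  qed
  also have "1 / real (n\<^sup>2) \<le> (1 / 10 * sqrt (l' / real n)) * real K"
  proof -
    have sq: "sqrt (real n) \<le> real n"
      using nK by (intro real_le_lsqrt) (auto simp: power2_eq_square)
    then have "6 * sqrt (real n) \<le> real n * real n"
      using nK by (intro mult_mono) auto
    then have "1 / real (n\<^sup>2) \<le> 1 / (6 * sqrt (real n))"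
      using nK by (simp add: power2_eq_square frac_le)
    also have "\<dots> \<le> 1 / 10 * sqrt (1 / real n) * 2"
      using nK by (auto simp: real_sqrt_divide intro!: divide_left_mono)
    also have "\<dots> \<le> 1 / 10 * sqrt (l' / real n) * real K"
      using nK l by (intro mult_mono) (auto intro!: divide_right_mono)
    finally show ?thesis .
  qed
  also have "(1 / 10 * sqrt (l' / real n)) * real K + (19 / 10 * sqrt (l' / real n)) * real K =
      2 * (sqrt (real K / real n) * sqrt (real K * l'))"
  proof -
    have "real K / real n * (real K * l') = real K * real K * (l' / real n)"
      by simp
    then have "sqrt (real K / real n) * sqrt (real K * l') = sqrt (real K * real K) * sqrt (l' / real n)"
      by (metis real_sqrt_mult)
    then show ?thesis by simp
  qed
  finally show "(1 / real (n\<^sup>2) + (ln B - 1) / (\<theta> * real (n div K))) + real K * (16 * exp (\<theta>\<^sup>2 * real n / 2) / (\<theta> * real (n div K) * B))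
      \<le> 2 * (sqrt (real K / real n) * sqrt (real K * ln (17 * real K)))"
    by (simp add: m_def l'_def)
qed

text \<open>In this range the argument of the logarithm is at most \<open>(17 * K)^2\<close>, and
  \<open>2 \<le> K\<close>. The logarithmic rate is then the minimum, so the other rate has to be
  proved for \<open>3 * K \<le> n\<close> only.\<close>

lemma rate_comparison:
  fixes K n :: nat
  assumes K: "2 \<le> K" and n: "n < 3 * K"
  shows "sqrt (ln (3.01 * real K * (real n + 2))) \<le> sqrt (real K * ln (17 * real K))"
proof (rule real_sqrt_le_mono)
  have nK: "real n + 2 \<le> 4 * real K" "real K \<ge> 2" using K n by simp_all
  have "3.01 * real K * (real n + 2) \<le> (17 * real K) * (17 * real K)"
    using nK by (intro mult_mono) auto
  then have "ln (3.01 * real K * (real n + 2)) \<le> ln ((17 * real K) * (17 * real K))"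
    using nK by (intro ln_mono) auto
  also have "\<dots> = 2 * ln (17 * real K)"
    using nK by (subst ln_mult) auto
  also have "\<dots> \<le> real K * ln (17 * real K)"
    using nK by (intro mult_right_mono) auto
  finally show "ln (3.01 * real K * (real n + 2)) \<le> real K * ln (17 * real K)" .
qed

text \<open>The deterministic part \<open>p\<close> is charged once and the remainder
  \<open>q\<close> once per arm, both with factor \<open>2 * C\<close>; with
  \<open>p + K * q \<le> 2 * d\<close> this gives \<open>4 * C * d\<close>.\<close>

lemma (in treatment_problem) expected_regret_le_deviation:
  fixes n :: nat and R :: "nat set" and \<eta> p q :: real and \<mu> :: "(nat \<Rightarrow> real) measure"
  assumes n: "2 * K \<le> n" and \<eta>: "0 < \<eta>" and pq: "0 \<le> p" "0 \<le> q" "p + real K * q \<le> 2 * d"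
    and mu_prob: "prob_space \<mu>" and mu_meas: "\<And>i. i \<in> {1..K} \<Longrightarrow> (\<lambda>y. y i) \<in> borel_measurable \<mu>"
    and mu_marg: "\<forall>i\<in>{1..K}. marg_cdf \<mu> i \<in> D"
    and dev: "\<And>i. i \<in> {1..K} \<Longrightarrow> \<exists>g. superharmonic (distr \<mu> borel (\<lambda>y. y i)) g \<and> g [] \<le> ennreal q \<and>
      (\<forall>l. n div K \<le> length l \<longrightarrow> length l \<le> n \<longrightarrow>
        ennreal (sup_dist (ecdf l) (cdf (distr \<mu> borel (\<lambda>y. y i)))) \<le> ennreal p + g l)"
  shows "(\<integral>\<^sup>+ Y. ennreal (regret T K MK (marg_cdf \<mu>) (pol_rec T C K n R \<eta> Mn Y)) \<partial>(PiM {1..n} (\<lambda>_. \<mu>)))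
    \<le> ennreal (disc_err T K D MK Mn + 4 * C * d
        + 4 * C * (real K powr (1 - 3 * \<eta> / (4 + 2 * \<eta>))) / sqrt (real n) * (1 + 18.5 / \<eta>)\<^sup>2)"
proof -
  from dev obtain g where g: "\<And>i. i \<in> {1..K} \<Longrightarrow> superharmonic (distr \<mu> borel (\<lambda>y. y i)) (g i)"
    "\<And>i. i \<in> {1..K} \<Longrightarrow> g i [] \<le> ennreal q"
    "\<And>i l. i \<in> {1..K} \<Longrightarrow> n div K \<le> length l \<Longrightarrow> length l \<le> n \<Longrightarrow>
        ennreal (sup_dist (ecdf l) (marg_cdf \<mu> i)) \<le> ennreal p + g i l"
    using marg_cdf_eq_cdf(2)[OF mu_prob mu_meas] by metis
  have "(\<integral>\<^sup>+ Y. ennreal (regret T K MK (marg_cdf \<mu>) (pol_rec T C K n R \<eta> Mn Y)) \<partial>(PiM {1..n} (\<lambda>_. \<mu>)))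
    \<le> ennreal (disc_err T K D MK Mn + (2 * C * p + real K * (2 * C * q))
        + 4 * C * (real K powr (1 - 3 * \<eta> / (4 + 2 * \<eta>))) / sqrt (real n) * (1 + 18.5 / \<eta>)\<^sup>2)"
  proof (rule expected_regret_le[where g = "\<lambda>i l. ennreal (2 * C) * g i l"])
    show "superharmonic (distr \<mu> borel (\<lambda>y. y i)) (\<lambda>l. ennreal (2 * C) * g i l)" if "i \<in> {1..K}" for i
      using g(1)[OF that] by (rule superharmonic_cmult)
    show "ennreal (2 * C * sup_dist (ecdf l) (marg_cdf \<mu> i)) \<le> ennreal (2 * C * p) + ennreal (2 * C) * g i l"
      if "i \<in> {1..K}" "n div K \<le> length l" "length l \<le> n" for i l
    proof -
      have "ennreal (2 * C * sup_dist (ecdf l) (marg_cdf \<mu> i)) = ennreal (2 * C) * ennreal (sup_dist (ecdf l) (marg_cdf \<mu> i))"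
        using C_pos by (intro ennreal_mult') auto
      also have "\<dots> \<le> ennreal (2 * C) * (ennreal p + g i l)"
        using g(3)[OF that] by (rule mult_left_mono) simp
      also have "\<dots> = ennreal (2 * C * p) + ennreal (2 * C) * g i l"
        using C_pos pq by (simp add: distrib_left ennreal_mult)
      finally show ?thesis .
    qed
    have "(\<Sum>i=1..K. ennreal (2 * C) * g i []) \<le> (\<Sum>i=1..K. ennreal (2 * C) * ennreal q)"
      using g(2) by (intro sum_mono mult_left_mono) auto
    also have "\<dots> = (\<Sum>i=1..K. ennreal (2 * C * q))"
      using C_pos pq by (simp add: ennreal_mult)
    also have "\<dots> = ennreal (\<Sum>i=1..K. 2 * C * q)"
      using C_pos pq by (intro sum_ennreal) auto
    finally show "(\<Sum>i=1..K. ennreal (2 * C) * g i []) \<le> ennreal (real K * (2 * C * q))"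
      by simp
  qed (use n \<eta> pq C_pos mu_prob mu_meas mu_marg in auto)
  also have "\<dots> \<le> ennreal (disc_err T K D MK Mn + 4 * C * d
        + 4 * C * (real K powr (1 - 3 * \<eta> / (4 + 2 * \<eta>))) / sqrt (real n) * (1 + 18.5 / \<eta>)\<^sup>2)"
  proof (intro ennreal_leI add_mono order_refl)
    have "2 * C * (p + real K * q) \<le> 2 * C * (2 * d)"
      using pq C_pos by (intro mult_left_mono) auto
    then show "2 * C * p + real K * (2 * C * q) \<le> 4 * C * d"
      by (simp add: algebra_simps)
  qed
  finally show ?thesis .
qed

theorem theorem5p2:
  fixes a b C \<eta> :: real and K n :: nat
    and D :: "(real \<Rightarrow> real) set"
    and T :: "(real \<Rightarrow> real) \<Rightarrow> real"
    and MK Mn :: "(nat \<Rightarrow> real) set"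
    and R :: "nat set"
    and \<mu> :: "(nat \<Rightarrow> real) measure"
  assumes ab: "a < b"
    and K2: "2 \<le> K"
    and D_sub: "D \<subseteq> cdf_ab a b" and D_ne: "D \<noteq> {}" and D_cvx: "convex_fset D"
    and C_pos: "0 < C"
    and T_Lip: "\<forall>F\<in>D. \<forall>G\<in>cdf_ab a b. \<bar>T F - T G\<bar> \<le> C * sup_dist F G"
    and T_meas: "\<forall>m::nat. \<forall>\<delta>\<in>unit_simplex m.
        (\<lambda>x. T (\<lambda>y. \<Sum>j=1..m. \<delta> j * (if x j \<le> y then 1 else 0)))
          \<in> borel_measurable (restrict_space (PiM {1..m} (\<lambda>_. borel)) (PiE {1..m} (\<lambda>_. {a..b})))"
    and MK_sub: "MK \<subseteq> unit_simplex K" and MK_closed: "closed MK"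
    and MK_two: "\<exists>\<delta>\<in>MK. \<exists>\<gamma>\<in>MK. \<delta> \<noteq> \<gamma>"
    and n_ge: "2 * K \<le> n"
    and Mn: "finite Mn" "Mn \<noteq> {}" "Mn \<subseteq> MK"
    and R_adm: "R \<subseteq> {1..n div 2}" "R \<noteq> {}" "Min R \<le> n div K"
    and eta_pos: "0 < \<eta>"
    and mu_prob: "prob_space \<mu>"
    and mu_sets: "sets \<mu> = sets (PiM {1..K} (\<lambda>_. borel))"
    and mu_marg: "\<forall>i\<in>{1..K}. marg_cdf \<mu> i \<in> D"
  shows "(\<integral>\<^sup>+ Y. ennreal (regret T K MK (marg_cdf \<mu>) (pol_rec T C K n R \<eta> Mn Y))
            \<partial>(PiM {1..n} (\<lambda>_. \<mu>)))
         \<le> ennreal (disc_err T K D MK Mn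
              + 4 * C * sqrt (real K / real n)
                  * min (sqrt (real K * ln (17 * real K))) (sqrt (ln (3.01 * real K * (real n + 2))))
              + 4 * C * (real K powr (1 - 3 * \<eta> / (4 + 2 * \<eta>))) / sqrt (real n)
                  * (1 + 18.5 / \<eta>)^2)"
proof -
  interpret treatment_problem a b C K D T MK Mn
    by unfold_locales (fact K2 D_sub D_cvx C_pos T_Lip MK_sub Mn)+
  have mu_meas: "(\<lambda>y. y i) \<in> borel_measurable \<mu>" if "i \<in> {1..K}" for i
    using measurable_component_singleton[OF that, of "\<lambda>_. borel"]
    by (subst measurable_cong_sets[OF mu_sets refl])
  have distr: "real_distribution (distr \<mu> borel (\<lambda>y. y i))" if "i \<in> {1..K}" for i
    using that by (intro marg_cdf_eq_cdf(1) mu_prob mu_meas)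
  let ?I = "\<integral>\<^sup>+ Y. ennreal (regret T K MK (marg_cdf \<mu>) (pol_rec T C K n R \<eta> Mn Y)) \<partial>(PiM {1..n} (\<lambda>_. \<mu>))"
  let ?bound = "\<lambda>d. ennreal (disc_err T K D MK Mn + 4 * C * d
        + 4 * C * (real K powr (1 - 3 * \<eta> / (4 + 2 * \<eta>))) / sqrt (real n) * (1 + 18.5 / \<eta>)\<^sup>2)"
  let ?s = "sqrt (real K / real n)"
  let ?A = "sqrt (real K * ln (17 * real K))" and ?L = "sqrt (ln (3.01 * real K * (real n + 2)))"
  have m1: "1 \<le> n div K"
    using div_ge_two_thirds(2)[OF _ n_ge] K2 by simp
  have log: "?I \<le> ?bound (?s * ?L)"
  proof (rule expected_regret_le_deviation[OF n_ge eta_pos _ _ logarithmic_rate(2)[OF K2 n_ge] mu_prob mu_meas mu_marg])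
    show "0 \<le> 1.5 * (?s * ?L)"
      using logarithmic_rate(1)[OF K2 n_ge] by simp
    show "\<exists>g. superharmonic (distr \<mu> borel (\<lambda>y. y i)) g \<and>
        g [] \<le> ennreal (\<Sum>N=n div K..n. 10 * real N * exp (1 - 2 * real N * (1.5 * (?s * ?L))\<^sup>2)) \<and>
        (\<forall>l. n div K \<le> length l \<longrightarrow> length l \<le> n \<longrightarrow>
          ennreal (sup_dist (ecdf l) (cdf (distr \<mu> borel (\<lambda>y. y i)))) \<le> ennreal (1.5 * (?s * ?L)) + g l)"
      if "i \<in> {1..K}" for i
      by (rule real_distribution.sup_dist_union_bound[OF distr[OF that] m1 logarithmic_rate(1)[OF K2 n_ge], of n]) blast
  qed (auto intro!: sum_nonneg)
  have maximal: "?I \<le> ?bound (?s * ?A)" if n3: "3 * K \<le> n"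
  proof -
    define \<theta> B where "\<theta> = sqrt (2 * ln (16 * real K) / real n)" and "B = (16 * real K)\<^sup>2"
    note rate = maximal_rate[OF K2 n3, folded \<theta>_def B_def]
    have "0 < B"
      using less_le_trans[OF exp_gt_zero rate(2)] .
    then have "1 \<le> ln B"
      using rate(2) by (simp add: ln_ge_iff)
    show ?thesis
    proof (rule expected_regret_le_deviation[OF n_ge eta_pos _ _ rate(3) mu_prob mu_meas mu_marg])
      show "0 \<le> 1 / real (n\<^sup>2) + (ln B - 1) / (\<theta> * real (n div K))"
        using rate(1) \<open>1 \<le> ln B\<close> by simp
      show "0 \<le> 16 * exp (\<theta>\<^sup>2 * real n / 2) / (\<theta> * real (n div K) * B)"
        using rate(1) \<open>0 < B\<close> by simp
      show "\<exists>g. superharmonic (distr \<mu> borel (\<lambda>y. y i)) g \<and>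
          g [] \<le> ennreal (16 * exp (\<theta>\<^sup>2 * real n / 2) / (\<theta> * real (n div K) * B)) \<and>
          (\<forall>l. n div K \<le> length l \<longrightarrow> length l \<le> n \<longrightarrow>
            ennreal (sup_dist (ecdf l) (cdf (distr \<mu> borel (\<lambda>y. y i)))) \<le>
              ennreal (1 / real (n\<^sup>2) + (ln B - 1) / (\<theta> * real (n div K))) + g l)"
        if "i \<in> {1..K}" for i
        \<comment> \<open>A grid of \<open>n^2\<close> cells makes the discretization error
          negligible at no cost elsewhere in the estimate.\<close>
        by (rule real_distribution.sup_dist_maximal_bound[OF distr[OF that] m1 _ rate(1,2), of "n\<^sup>2" n])
          (use n_ge K2 in \<open>auto simp del: of_nat_power\<close>)
    qed
  qed
  have "?I \<le> ?bound (?s * min ?A ?L)"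
  proof (cases "3 * K \<le> n")
    case True
    then show ?thesis
      using log maximal by (cases "?A \<le> ?L") (simp_all add: min_def)
  next
    case False
    then have "?L \<le> ?A"
      by (intro rate_comparison K2) simp
    then show ?thesis
      using log by (simp add: min_absorb2)
  qed
  then show ?thesis
    by (simp only: mult.assoc)
qed

end
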